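(* Let $P(z,\partial)=\sum_{|\alpha|\le m}a_\alpha(z)\left(\frac{\partial}{\partial z}\right)^\alpha$ with $a_\alpha$ holomorphic in a neighborhood $U$ of $0$ in $\mathbb{C}^n$, and let $S$ be a complex analytic hypersurface through $0$ with defining function $f(z)$ in $U$. Assume that $S$ is everywhere simply characteristic with respect to $P$. Then there exist solutions $u(z)$ to the equation $Pu=0$ in a neighborhood of $0$ (possibly multiple valued, ramified along $S$) of the form $$u(z)=\frac{F(z)}{f(z)}+G(z)\log f(z)+H(z),$$ where $F(z)$, $G(z)$ and $H(z)$ are holomorphic near $0$. Moreover, there exist such solutions for which $F(z)$ and $G(z)$ are not both identically $0$ and which do not extend holomorphically to a neighborhood of $0$.
   Context: The principal symbol of $P$ is $P_m(z,\zeta)=\sum_{|\alpha|=m}a_\alpha(z)\zeta^\alpha$, and $\partial_\zeta P_m=\left(\frac{\partial P_m}{\partial\zeta_1},\dots,\frac{\partial P_m}{\partial\zeta_n}\right)$. That $f$ is a defining function of $S$ in $U$ means $f$ is holomorphic in $U$, $S=\{z\in U: f(z)=0\}$, and $\partial f=\left(\frac{\partial f}{\partial z_1},\dots,\frac{\partial f}{\partial z_n}\right)\ne0$ on $S$. $S$ is everywhere simply characteristic with respect to $P$ if for every $z\in S$ one has $P_m(z,\partial f(z))=0$ and $\partial_\zeta P_m(z,\partial f(z))\ne(0,\dots,0)$. The function $u$ is understood on (neighborhood of $0$)$\,\setminus S$, multiple valued through the branches of $\log f$, and $Pu=0$ means that each local branch of $u$ satisfies the equation. *)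

theory Defs
  imports "HOL-Analysis.Analysis"
begin

text \<open>Functions of several complex variables are functions on \<^typ>\<open>complex ^ 'n\<close>. A function is
  holomorphic if its Frechet derivative exists everywhere and is complex linear; the notion is
  only used on open sets \<^term>\<open>U\<close>.\<close>

definition holo_on :: "(complex ^ 'n \<Rightarrow> complex) \<Rightarrow> (complex ^ 'n) set \<Rightarrow> bool" where
  "holo_on f U \<longleftrightarrow>
     (\<forall>z\<in>U. \<exists>D. (f has_derivative D) (at z) \<and> (\<forall>c h. D (c *s h) = c * D h))"

definition pd :: "'n \<Rightarrow> (complex ^ 'n \<Rightarrow> complex) \<Rightarrow> complex ^ 'n \<Rightarrow> complex" where
  "pd i f z = deriv (\<lambda>t. f (z + axis i t)) 0"

definition grad :: "(complex ^ 'n \<Rightarrow> complex) \<Rightarrow> complex ^ 'n \<Rightarrow> complex ^ 'n" where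
  "grad f z = (\<chi> i. pd i f z)"

definition mdeg :: "nat ^ 'n \<Rightarrow> nat" where
  "mdeg \<alpha> = (\<Sum>i\<in>UNIV. \<alpha> $ i)"

definition mpower :: "complex ^ 'n \<Rightarrow> nat ^ 'n \<Rightarrow> complex" where
  "mpower \<zeta> \<alpha> = (\<Prod>i\<in>UNIV. \<zeta> $ i ^ (\<alpha> $ i))"

text \<open>The index type carries no order, so the iterated partial derivative is taken along an
  arbitrary fixed enumeration of the indices. It is only applied to holomorphic functions, whose
  partial derivatives commute.\<close>

definition index_enum :: "'n::finite list" where
  "index_enum = (SOME xs. distinct xs \<and> set xs = UNIV)"

lemma index_enum: "distinct (index_enum :: 'n::finite list)" "set (index_enum :: 'n list) = UNIV"
proof -
  have "\<exists>xs :: 'n list. distinct xs \<and> set xs = UNIV"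
    using finite_distinct_list[of "UNIV :: 'n set"] by auto
  from someI_ex[OF this]
  show "distinct (index_enum :: 'n list)" "set (index_enum :: 'n list) = UNIV"
    unfolding index_enum_def by blast+
qed

definition mpd :: "nat ^ 'n \<Rightarrow> (complex ^ 'n \<Rightarrow> complex) \<Rightarrow> complex ^ 'n \<Rightarrow> complex" where
  "mpd \<alpha> u = foldr (\<lambda>i. pd i ^^ (\<alpha> $ i)) index_enum u"

lemma finite_mdeg_le: "finite {\<alpha> :: nat ^ 'n. mdeg \<alpha> \<le> m}"
proof -
  have "{\<alpha> :: nat ^ 'n. mdeg \<alpha> \<le> m} \<subseteq> vec_lambda ` (UNIV \<rightarrow>\<^sub>E {..m})"
  proof
    fix \<alpha> :: "nat ^ 'n"
    assume "\<alpha> \<in> {\<alpha>. mdeg \<alpha> \<le> m}"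
    moreover have "\<alpha> $ i \<le> mdeg \<alpha>" for i
      unfolding mdeg_def by (rule member_le_sum) auto
    ultimately have "vec_nth \<alpha> \<in> UNIV \<rightarrow>\<^sub>E {..m}"
      by (fastforce intro: le_trans)
    then show "\<alpha> \<in> vec_lambda ` (UNIV \<rightarrow>\<^sub>E {..m})"
      by (metis image_eqI vec_nth_inverse)
  qed
  then show ?thesis
    by (rule finite_subset) (intro finite_imageI finite_PiE; simp)
qed

text \<open>The differential operator of order \<^term>\<open>m\<close> with coefficients \<^term>\<open>a \<alpha>\<close>, and its
  principal symbol.\<close>

definition diff_op :: "nat \<Rightarrow> (nat ^ 'n \<Rightarrow> complex ^ 'n \<Rightarrow> complex) \<Rightarrow>
    (complex ^ 'n \<Rightarrow> complex) \<Rightarrow> complex ^ 'n \<Rightarrow> complex" where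
  "diff_op m a u z = (\<Sum>\<alpha> | mdeg \<alpha> \<le> m. a \<alpha> z * mpd \<alpha> u z)"

definition principal_symbol :: "nat \<Rightarrow> (nat ^ 'n \<Rightarrow> complex ^ 'n \<Rightarrow> complex) \<Rightarrow>
    complex ^ 'n \<Rightarrow> complex ^ 'n \<Rightarrow> complex" where
  "principal_symbol m a z \<zeta> = (\<Sum>\<alpha> | mdeg \<alpha> = m. a \<alpha> z * mpower \<zeta> \<alpha>)"

definition defining_function ::
    "(complex ^ 'n \<Rightarrow> complex) \<Rightarrow> (complex ^ 'n) set \<Rightarrow> (complex ^ 'n) set \<Rightarrow> bool" where
  "defining_function f S U \<longleftrightarrow>
     holo_on f U \<and> S = {z \<in> U. f z = 0} \<and> (\<forall>z\<in>S. grad f z \<noteq> 0)"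

definition simply_characteristic :: "nat \<Rightarrow> (nat ^ 'n \<Rightarrow> complex ^ 'n \<Rightarrow> complex) \<Rightarrow>
    (complex ^ 'n \<Rightarrow> complex) \<Rightarrow> (complex ^ 'n) set \<Rightarrow> bool" where
  "simply_characteristic m a f S \<longleftrightarrow>
     (\<forall>z\<in>S. principal_symbol m a z (grad f z) = 0 \<and>
            grad (principal_symbol m a z) (grad f z) \<noteq> 0)"

text \<open>The multiple valued function \<open>F/f + G log f + H\<close> is represented by its
  local single valued branches \<^term>\<open>u\<close> on open sets \<^term>\<open>W\<close>, one for each holomorphic branch
  \<^term>\<open>L\<close> of \<open>log f\<close> on \<^term>\<open>W\<close>.\<close>

definition local_branch :: "(complex ^ 'n \<Rightarrow> complex) \<Rightarrow> (complex ^ 'n \<Rightarrow> complex) \<Rightarrow>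
    (complex ^ 'n \<Rightarrow> complex) \<Rightarrow> (complex ^ 'n \<Rightarrow> complex) \<Rightarrow>
    (complex ^ 'n) set \<Rightarrow> (complex ^ 'n \<Rightarrow> complex) \<Rightarrow> bool" where
  "local_branch f F G H W u \<longleftrightarrow>
     open W \<and>
     (\<exists>L. holo_on L W \<and> (\<forall>z\<in>W. exp (L z) = f z) \<and>
          (\<forall>z\<in>W. u z = F z / f z + G z * L z + H z))"

definition ramified_solution :: "nat \<Rightarrow> (nat ^ 'n \<Rightarrow> complex ^ 'n \<Rightarrow> complex) \<Rightarrow>
    (complex ^ 'n \<Rightarrow> complex) \<Rightarrow> (complex ^ 'n) set \<Rightarrow> (complex ^ 'n) set \<Rightarrow>
    (complex ^ 'n \<Rightarrow> complex) \<Rightarrow> (complex ^ 'n \<Rightarrow> complex) \<Rightarrow> (complex ^ 'n \<Rightarrow> complex) \<Rightarrow> bool" where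
  "ramified_solution m a f S V F G H \<longleftrightarrow>
     holo_on F V \<and> holo_on G V \<and> holo_on H V \<and>
     (\<forall>W u. W \<subseteq> V - S \<and> local_branch f F G H W u \<longrightarrow> (\<forall>z\<in>W. diff_op m a u z = 0))"

text \<open>Some branch of \<open>F/f + G log f + H\<close> over \<^term>\<open>V - S\<close> continues to a single valued holomorphic
  function near \<open>0\<close>. As \<^term>\<open>N\<close> is connected, agreement on one nonempty open set suffices.\<close>

definition extends_holomorphically :: "(complex ^ 'n \<Rightarrow> complex) \<Rightarrow>
    (complex ^ 'n) set \<Rightarrow> (complex ^ 'n) set \<Rightarrow>
    (complex ^ 'n \<Rightarrow> complex) \<Rightarrow> (complex ^ 'n \<Rightarrow> complex) \<Rightarrow> (complex ^ 'n \<Rightarrow> complex) \<Rightarrow> bool" where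
  "extends_holomorphically f S V F G H \<longleftrightarrow>
     (\<exists>N w W u. open N \<and> connected N \<and> 0 \<in> N \<and> N \<subseteq> V \<and> holo_on w N \<and>
        W \<noteq> {} \<and> W \<subseteq> N - S \<and> local_branch f F G H W u \<and> (\<forall>z\<in>W. w z = u z))"

end

theory Submission
  imports Defs "HOL-Complex_Analysis.Conformal_Mappings"
begin

text \<open>The solution produced here has \<open>F = 0\<close>. It comes from one extra variable \<open>s\<close>: functions of \<open>z\<close> are sought as
\<open>g(f(z), z)\<close> with \<open>g(s, z)\<close> a convergent power series. By the chain rule (\<open>diff_op_chain\<close>)
\<open>P\<close> acts on such functions as the operator \<open>P' = \<Sum>\<^sub>\<beta> p\<^sub>\<beta>(z) \<partial>\<^sup>\<beta>\<close> in the \<open>n + 1\<close> variables \<open>(s, z)\<close> that is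
obtained by substituting \<open>\<partial>/\<partial>z\<^sub>i + (\<partial>f/\<partial>z\<^sub>i) \<partial>/\<partial>s\<close> for \<open>\<partial>/\<partial>z\<^sub>i\<close>. With \<open>m = k + 1\<close>, the coefficient of \<open>\<partial>\<^sub>s\<^sup>m\<close> is \<open>A(z) = P\<^sub>m(z, \<partial>f(z))\<close>
(\<open>op_coeff_top\<close>), which vanishes on \<open>S\<close>, and the coefficient of \<open>\<partial>\<^sub>s\<^sup>k \<partial>\<^sub>t\<close> is the \<open>t\<close>-th component of
\<open>\<partial>\<^sub>\<zeta> P\<^sub>m(z, \<partial>f(z))\<close> (\<open>op_coeff_subtop\<close>), which is nonzero at \<open>0\<close> for some \<open>t\<close> because \<open>S\<close> is simply
characteristic.

Hence \<open>P' h = R\<close> can be divided by that coefficient and read as a Goursat problem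
\<open>\<partial>\<^sub>s\<^sup>k \<partial>\<^sub>t h = R - (other terms)\<close>, with \<open>h\<close> divisible by \<open>s\<^sup>k z\<^sub>t\<close>. Put \<open>v = \<partial>\<^sub>s\<^sup>k \<partial>\<^sub>t h\<close>. On Taylor
coefficients, \<open>\<partial>\<^sup>\<beta>\<close> after the integration \<open>\<partial>\<^sub>s\<^sup>-\<^sup>k \<partial>\<^sub>t\<^sup>-\<^sup>1\<close> is a weighted shift, which is bounded for the norm
\<open>sup |v\<^sub>\<gamma>| \<gamma>! r\<^sup>\<gamma> / |\<gamma>|!\<close>, and if the radii \<open>r\<close> are chosen in suitable proportions all the terms on the
right have small norm: for \<open>\<partial>\<^sup>\<beta> = \<partial>\<^sub>s\<^sup>m\<close> this uses \<open>A(0) = 0\<close>. A Neumann series therefore converges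
(\<open>goursat_formal\<close>, \<open>solve_transport\<close>). This is used twice. First it gives \<open>g\<close> with \<open>P' g = 0\<close> and
\<open>g = s\<^sup>k + \<dots>\<close> divisible by \<open>s\<^sup>k\<close> (\<open>homogeneous_transport_solution\<close>).

Next, let \<open>L\<close> be a branch of \<open>log f\<close>. Replacing \<open>s\<^sup>p\<close> by \<open>s\<^sup>p (log s - H\<^sub>p)\<close>, where \<open>H\<^sub>p\<close> is the harmonic
number, commutes with \<open>\<partial>/\<partial>s\<close> on powers \<open>p > 0\<close>, and for \<open>p = 0\<close> it produces in addition \<open>1/s\<close>. Since
\<open>g\<close> is divisible by \<open>s\<^sup>k\<close>, the additional term appears only in the \<open>m\<close>-th \<open>s\<close>-derivative. So
\<open>P (g(f, z) L + (Hg)(f, z)) = A(z) u(z) / f(z)\<close> with \<open>u\<close> holomorphic, where \<open>Hg\<close> multiplies the coefficient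
of \<open>s\<^sup>p\<close> by \<open>-H\<^sub>p\<close> (\<open>cderiv_log_family\<close>). The right side is holomorphic because \<open>A\<close> is divisible by
\<open>f\<close> (\<open>holo_divide_by_defining\<close>), and the second use of the Goursat problem removes it. All this is put together in
\<open>ramified_solution_exists\<close>.

The function \<open>G = g(f, z)\<close> does not vanish identically on a coordinate line through \<open>0\<close> that is transversal to
\<open>S\<close>. If a branch of \<open>G log f + H\<close> extended to a holomorphic \<open>w\<close>, then on that line
\<open>((w - H)/G)' = f'/f\<close>, whereas \<open>f'/f\<close> has residue \<open>1\<close> and a derivative has residue \<open>0\<close>
(\<open>log_not_extends\<close>).\<close>

section \<open>Complex derivatives in several variables\<close>

text \<open>A complex linear derivative is recorded by the vector of its values on the coordinate axes, so that gradients can be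
computed by rules for sums, products and compositions.\<close>

definition cderiv :: "(complex ^ 'n \<Rightarrow> complex) \<Rightarrow> complex ^ 'n \<Rightarrow> complex ^ 'n \<Rightarrow> bool" where
  "cderiv f z d \<longleftrightarrow> (f has_derivative (\<lambda>h. \<Sum>i\<in>UNIV. h $ i * d $ i)) (at z)"

lemma norm_axis_complex: "norm (axis j x :: complex ^ 'k) = norm x"
  by (simp add: norm_vec_def L2_set_def axis_def if_distrib[of norm] if_distrib[of "\<lambda>x. x\<^sup>2"] cong: if_cong)

lemma bounded_linear_axis: "bounded_linear (axis j :: complex \<Rightarrow> complex ^ 'k)"
proof (rule bounded_linear_intro[where K=1])
  show "norm (axis j x :: complex ^ 'k) \<le> norm x * 1" for x by (simp add: norm_axis_complex)
qed (auto simp: vec_eq_iff axis_def)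

lemma vec_as_sum_axis: "(h :: complex ^ 'n) = (\<Sum>i\<in>UNIV. h $ i *s axis i 1)"
  by (simp add: vec_eq_iff axis_def if_distrib cong: if_cong)

lemma bounded_linear_smult: "bounded_linear (\<lambda>t. t *s (h :: complex ^ 'n))"
proof (rule bounded_linear_intro[where K="norm h"])
  fix x :: complex
  show "norm (x *s h) \<le> norm x * norm h"
    by (simp add: norm_vec_def L2_set_def norm_mult power_mult_distrib sum_distrib_left[symmetric] real_sqrt_mult)
qed (auto simp: vec_eq_iff algebra_simps)

lemma cderiv_line:
  assumes "cderiv f (z + t *s h) d"
  shows "((\<lambda>t. f (z + t *s h)) has_field_derivative (\<Sum>i\<in>UNIV. h $ i * d $ i)) (at t)"
proof -
  have "((\<lambda>t. z + t *s h) has_derivative (\<lambda>s. s *s h)) (at t)"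
    using bounded_linear_imp_has_derivative[OF bounded_linear_smult] by (auto intro!: derivative_eq_intros)
  from has_derivative_compose[OF this assms[unfolded cderiv_def]]
  moreover have "(\<lambda>s. \<Sum>i\<in>UNIV. (s *s h) $ i * d $ i) = (*) (\<Sum>i\<in>UNIV. h $ i * d $ i)"
    by (simp add: fun_eq_iff sum_distrib_left mult_ac)
  ultimately show ?thesis by (simp only: has_field_derivative_def)
qed

lemma pd_eqI: fixes z :: "complex ^ 'n" assumes "cderiv f z d" shows "pd i f z = d $ i"
proof -
  have *: "t *s axis i 1 = (axis i t :: complex ^ 'n)" for t by (simp add: vec_eq_iff axis_def)
  have "((\<lambda>t. f (z + t *s axis i 1)) has_field_derivative (\<Sum>j\<in>UNIV. axis i 1 $ j * d $ j)) (at 0)"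
    by (rule cderiv_line) (use assms in simp)
  moreover have "(\<Sum>j\<in>UNIV. axis i 1 $ j * d $ j) = d $ i"
    by (simp add: axis_def if_distrib[of "\<lambda>x. x * _"] cong: if_cong)
  ultimately show ?thesis by (simp add: pd_def * DERIV_imp_deriv)
qed

lemma grad_eqI: "cderiv f z d \<Longrightarrow> grad f z = d"
  by (simp add: grad_def vec_eq_iff pd_eqI)

lemma holo_onI:
  assumes "\<And>z. z \<in> U \<Longrightarrow> \<exists>d. cderiv f z d" shows "holo_on f U"
  unfolding holo_on_def
proof
  fix z assume "z \<in> U"
  then obtain d where "cderiv f z d" using assms by blast
  then show "\<exists>D. (f has_derivative D) (at z) \<and> (\<forall>c h. D (c *s h) = c * D h)"
    unfolding cderiv_def by (intro exI conjI) (auto simp: sum_distrib_left mult.assoc)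
qed

lemma holo_on_cderiv: assumes "holo_on f U" "z \<in> U" shows "cderiv f z (grad f z)"
proof -
  obtain D where D: "(f has_derivative D) (at z)" "\<And>c h. D (c *s h) = c * D h"
    using assms unfolding holo_on_def by blast
  interpret bounded_linear D using D(1) by (rule has_derivative_bounded_linear)
  have "D = (\<lambda>h. \<Sum>i\<in>UNIV. h $ i * (\<chi> i. D (axis i 1)) $ i)"
  proof
    fix h
    have "D h = D (\<Sum>i\<in>UNIV. h $ i *s axis i 1)" by (simp only: vec_as_sum_axis[symmetric])
    also have "\<dots> = (\<Sum>i\<in>UNIV. h $ i * D (axis i 1))" by (simp only: sum D(2))
    finally show "D h = (\<Sum>i\<in>UNIV. h $ i * (\<chi> i. D (axis i 1)) $ i)" by simp
  qed
  then have "cderiv f z (\<chi> i. D (axis i 1))" unfolding cderiv_def using D(1) by metis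
  then show ?thesis using grad_eqI by metis
qed


lemma cderiv_pd: "holo_on f U \<Longrightarrow> z \<in> U \<Longrightarrow> cderiv f z (\<chi> i. pd i f z)"
  using holo_on_cderiv unfolding grad_def .

lemma cderiv_const: "cderiv (\<lambda>z. c) z 0"
  by (simp add: cderiv_def)

lemma cderiv_coord: "cderiv (\<lambda>z. z $ i) (z :: complex ^ 'n) (axis i 1)"
proof -
  have "(\<Sum>j\<in>UNIV. h $ j * axis i 1 $ j) = h $ i" for h :: "complex ^ 'n"
    by (simp add: axis_def if_distrib[of "\<lambda>x. _ * x"] cong: if_cong)
  then show ?thesis unfolding cderiv_def
    by (simp add: bounded_linear_imp_has_derivative bounded_linear_vec_nth)
qed

lemma cderiv_add: "cderiv f z d \<Longrightarrow> cderiv g z e \<Longrightarrow> cderiv (\<lambda>z. f z + g z) z (d + e)"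
  unfolding cderiv_def by (drule (1) has_derivative_add) (simp add: algebra_simps sum.distrib)

lemma cderiv_mult: "cderiv f z d \<Longrightarrow> cderiv g z e \<Longrightarrow>
    cderiv (\<lambda>z. f z * g z) z (f z *s e + g z *s d)"
  unfolding cderiv_def by (drule (1) has_derivative_mult)
    (simp add: algebra_simps sum.distrib sum_distrib_left)

lemma cderiv_chain1:
  assumes "cderiv f z d" "(\<phi> has_field_derivative e) (at (f z))"
  shows "cderiv (\<lambda>z. \<phi> (f z)) z (e *s d)"
  using has_derivative_compose[OF assms(1)[unfolded cderiv_def] assms(2)[unfolded has_field_derivative_def]]
  unfolding cderiv_def by (simp add: sum_distrib_left algebra_simps)

lemma cderiv_cong_open:
  assumes "cderiv f z d" "open W" "z \<in> W" "\<And>w. w \<in> W \<Longrightarrow> f w = g w"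
  shows "cderiv g z d"
  using has_derivative_transform_within_open[OF assms(1)[unfolded cderiv_def] assms(2-4)]
  unfolding cderiv_def by simp

lemma cderiv_sum:
  assumes "\<And>i. i \<in> I \<Longrightarrow> cderiv (f i) z (d i)"
  shows "cderiv (\<lambda>z. \<Sum>i\<in>I. f i z) z (\<Sum>i\<in>I. d i)"
  using assms by (induction I rule: infinite_finite_induct) (auto simp: cderiv_const cderiv_add)

lemma cderiv_prod_sum:
  fixes g :: "complex ^ 'k \<Rightarrow> complex" and \<Phi> :: "complex ^ 'n \<Rightarrow> complex ^ 'k"
  assumes "cderiv g (\<Phi> z) d" "\<And>j. cderiv (\<lambda>z. \<Phi> z $ j) z (e j)"
  shows "cderiv (\<lambda>z. g (\<Phi> z)) z (\<Sum>j\<in>UNIV. d $ j *s e j)"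
proof -
  have "(\<Phi> has_derivative (\<lambda>h. \<chi> j. \<Sum>i\<in>UNIV. h $ i * e j $ i)) (at z)"
  proof -
    have "((\<lambda>z. \<Sum>j\<in>UNIV. axis j (\<Phi> z $ j)) has_derivative
        (\<lambda>h. \<Sum>j\<in>UNIV. axis j (\<Sum>i\<in>UNIV. h $ i * e j $ i))) (at z)"
      by (intro has_derivative_sum bounded_linear.has_derivative[OF bounded_linear_axis] assms(2)[unfolded cderiv_def])
    moreover have "(\<Sum>j\<in>UNIV. axis j (x j)) = (\<chi> j. x j)" for x :: "'k \<Rightarrow> complex"
      by (simp add: vec_eq_iff axis_def)
    ultimately show ?thesis by simp
  qed
  from has_derivative_compose[OF this assms(1)[unfolded cderiv_def]]
  have "((\<lambda>z. g (\<Phi> z)) has_derivative (\<lambda>h. \<Sum>j\<in>UNIV. (\<Sum>i\<in>UNIV. h $ i * e j $ i) * d $ j)) (at z)"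
    by simp
  moreover have "(\<Sum>j\<in>UNIV. (\<Sum>i\<in>UNIV. h $ i * e j $ i) * d $ j) = (\<Sum>i\<in>UNIV. h $ i * (\<Sum>j\<in>UNIV. d $ j *s e j) $ i)" for h
  proof -
    have "(\<Sum>j\<in>UNIV. (\<Sum>i\<in>UNIV. h $ i * e j $ i) * d $ j) = (\<Sum>j\<in>UNIV. \<Sum>i\<in>UNIV. h $ i * (d $ j * e j $ i))"
      by (simp only: sum_distrib_right mult.assoc mult.commute[of "e _ $ _"])
    also have "\<dots> = (\<Sum>i\<in>UNIV. \<Sum>j\<in>UNIV. h $ i * (d $ j * e j $ i))" by (rule sum.swap)
    finally show ?thesis by (simp add: sum_distrib_left)
  qed
  ultimately show ?thesis unfolding cderiv_def by simp
qed

lemma holo_on_subset: "holo_on f U \<Longrightarrow> V \<subseteq> U \<Longrightarrow> holo_on f V"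
  unfolding holo_on_def by blast

lemma holo_on_cong: "holo_on f U \<Longrightarrow> open U \<Longrightarrow> (\<And>z. z \<in> U \<Longrightarrow> f z = g z) \<Longrightarrow> holo_on g U"
  by (rule holo_onI) (blast intro: cderiv_cong_open holo_on_cderiv)

lemma holo_on_const: "holo_on (\<lambda>z. c) U" by (rule holo_onI) (blast intro: cderiv_const)
lemma holo_on_add: "holo_on f U \<Longrightarrow> holo_on g U \<Longrightarrow> holo_on (\<lambda>z. f z + g z) U"
  by (rule holo_onI) (blast intro: cderiv_add holo_on_cderiv)
lemma holo_on_mult: "holo_on f U \<Longrightarrow> holo_on g U \<Longrightarrow> holo_on (\<lambda>z. f z * g z) U"
  by (rule holo_onI) (blast intro: cderiv_mult holo_on_cderiv)
lemma holo_on_minus: "holo_on f U \<Longrightarrow> holo_on (\<lambda>z. - f z) U"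
  using holo_on_mult[OF holo_on_const[of "-1"]] by simp
lemma holo_on_diff: "holo_on f U \<Longrightarrow> holo_on g U \<Longrightarrow> holo_on (\<lambda>z. f z - g z) U"
  using holo_on_add[OF _ holo_on_minus] by simp
lemma holo_on_sum: "(\<And>i. i \<in> I \<Longrightarrow> holo_on (f i) U) \<Longrightarrow> holo_on (\<lambda>z. \<Sum>i\<in>I. f i z) U"
  by (induction I rule: infinite_finite_induct) (auto simp: holo_on_const holo_on_add)
lemma holo_on_inverse:
  assumes "holo_on f U" "\<And>z. z \<in> U \<Longrightarrow> f z \<noteq> 0" shows "holo_on (\<lambda>z. inverse (f z)) U"
proof (rule holo_onI)
  fix z assume "z \<in> U"
  from cderiv_chain1[OF holo_on_cderiv[OF assms(1) this] DERIV_inverse[OF assms(2)[OF this]]]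
  show "\<exists>d. cderiv (\<lambda>z. inverse (f z)) z d" by blast
qed
lemma holo_on_divide:
  assumes "holo_on g U" "holo_on f U" "\<And>z. z \<in> U \<Longrightarrow> f z \<noteq> 0" shows "holo_on (\<lambda>z. g z / f z) U"
  unfolding divide_inverse by (intro holo_on_mult holo_on_inverse assms)

lemma holo_on_imp_continuous_on: "holo_on f U \<Longrightarrow> continuous_on U f"
  unfolding holo_on_def by (meson continuous_at_imp_continuous_on has_derivative_continuous)

lemma holo_on_line:
  assumes "holo_on f U" shows "(\<lambda>t. f (z + t *s h)) holomorphic_on {t. z + t *s h \<in> U}"
proof -
  have "(\<lambda>t. f (z + t *s h)) field_differentiable at t within {t. z + t *s h \<in> U}"
    if "t \<in> {t. z + t *s h \<in> U}" for t
    using cderiv_line[OF holo_on_cderiv[OF assms, of "z + t *s h"]] that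
     field_differentiable_def field_differentiable_at_within by blast
  then show ?thesis unfolding holomorphic_on_def by blast
qed

lemma holo_on_axis_line:
  fixes z :: "complex ^ 'n"
  assumes "holo_on f U" shows "(\<lambda>t. f (z + axis i t)) holomorphic_on {t. z + axis i t \<in> U}"
proof -
  have *: "t *s axis i 1 = (axis i t :: complex ^ 'n)" for t by (simp add: vec_eq_iff axis_def)
  show ?thesis using holo_on_line[OF assms, of z "axis i 1"] unfolding * .
qed

lemma pd_cong_open:
  assumes "open W" "z \<in> W" "\<And>w. w \<in> W \<Longrightarrow> f w = g w"
  shows "pd i f z = pd i g z"
proof -
  have "isCont (\<lambda>t::complex. z + axis i t) 0"
    by (intro continuous_intros linear_continuous_at bounded_linear_axis)
  moreover have z: "z + axis i 0 = z" by (simp add: vec_eq_iff axis_def)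
  ultimately have "\<forall>\<^sub>F t in at 0. z + axis i t \<in> W"
    using assms(1,2) by (auto simp: isCont_def intro: topological_tendstoD)
  then have "\<forall>\<^sub>F t in nhds 0. z + axis i t \<in> W"
    unfolding eventually_nhds_conv_at z using assms(2) by simp
  then have "\<forall>\<^sub>F t in nhds 0. f (z + axis i t) = g (z + axis i t)"
    by eventually_elim (use assms(3) in auto)
  then show ?thesis unfolding pd_def by (intro deriv_cong_ev refl)
qed


text \<open>Representing a partial derivative by an integral over a circle in the corresponding direction reduces its regularity to
the dependence of such integrals on the parameter \<open>z\<close>. Continuity comes first, since differentiation under
the integral needs a continuous derivative.\<close>

lemma pd_circle:
  fixes q :: "complex ^ 'n \<Rightarrow> complex"
  assumes q: "holo_on q Q" and "open Q" and r: "0 < r" and cb: "cball z r \<subseteq> Q"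
  shows "pd i q z = integral {0..1} (\<lambda>\<theta>. q (z + axis i (circlepath 0 r \<theta>)) / circlepath 0 r \<theta>)"
proof -
  define \<phi> where "\<phi> = (\<lambda>t. q (z + axis i t))"
  have inQ: "z + axis i t \<in> Q" if "norm t \<le> r" for t
    using cb that by (auto simp: dist_norm norm_axis_complex)
  have h: "\<phi> holomorphic_on cball 0 r" unfolding \<phi>_def
    by (rule holomorphic_on_subset[OF holo_on_axis_line[OF q]]) (auto simp: inQ)
  have "pd i q z = 1 / (2 * of_real pi * \<i>) * contour_integral (circlepath 0 r) (\<lambda>u. \<phi> u / (u - 0)\<^sup>2)"
    unfolding pd_def \<phi>_def[symmetric]
    by (intro DERIV_imp_deriv Cauchy_derivative_integral_circlepath(2))
       (use r h in \<open>auto intro: holomorphic_on_imp_continuous_on holomorphic_on_subset\<close>)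
  also have "\<dots> = 1 / (2 * of_real pi * \<i>) * integral {0..1} (\<lambda>\<theta>. (2 * of_real pi * \<i>) * (\<phi> (circlepath 0 r \<theta>) / circlepath 0 r \<theta>))"
    unfolding contour_integral_integral
    by (rule arg_cong, rule integral_cong)
      (use r in \<open>simp add: vector_derivative_circlepath circlepath[of 0 r, THEN fun_cong] power2_eq_square field_simps\<close>)
  also have "\<dots> = integral {0..1} (\<lambda>\<theta>. \<phi> (circlepath 0 r \<theta>) / circlepath 0 r \<theta>)"
    unfolding integral_mult_right by simp
  finally show ?thesis by (simp add: \<phi>_def)
qed

lemma circle_integrand_continuous:
  fixes q :: "complex ^ 'n \<Rightarrow> complex"
  assumes q: "continuous_on Q q" and k: "continuous_on {0..1} k"
    and V: "\<And>z \<theta>. z \<in> V \<Longrightarrow> \<theta> \<in> {0..1} \<Longrightarrow> z + axis i (circlepath 0 r \<theta>) \<in> Q"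
  shows "continuous_on (V \<times> {0..1}) (\<lambda>(z, \<theta>). q (z + axis i (circlepath 0 r \<theta>)) * k \<theta>)"
proof -
  have c: "continuous_on {0..1} (circlepath 0 r)"
    unfolding circlepath by (intro continuous_intros)
  have "continuous_on (V \<times> {0..1}) (\<lambda>p. q (fst p + axis i (circlepath 0 r (snd p))) * k (snd p))"
    by (intro continuous_intros continuous_on_compose2[OF q] continuous_on_compose2[OF k]
       bounded_linear.continuous_on[OF bounded_linear_axis] continuous_on_compose2[OF c]) (auto simp: V)
  then show ?thesis by (simp add: case_prod_unfold)
qed

lemma pd_locally_circle_integral:
  fixes q :: "complex ^ 'n \<Rightarrow> complex"
  assumes q: "holo_on q Q" and "open Q" "z \<in> Q"
  obtains r where "0 < r" "continuous_on {0..1} (\<lambda>\<theta>. inverse (circlepath 0 r \<theta>))"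
    "\<And>y \<theta>. y \<in> ball z r \<Longrightarrow> y + axis i (circlepath 0 r \<theta>) \<in> Q"
    "\<And>y. y \<in> ball z r \<Longrightarrow> pd i q y =
      integral {0..1} (\<lambda>\<theta>. q (y + axis i (circlepath 0 r \<theta>)) * inverse (circlepath 0 r \<theta>))"
proof -
  obtain e where e: "e > 0" "cball z e \<subseteq> Q" using assms open_contains_cball by blast
  define r where "r = e / 2"
  have r: "0 < r" using e by (simp add: r_def)
  have cb: "cball y r \<subseteq> Q" if "y \<in> ball z r" for y
    by (rule order_trans[OF _ e(2)]) (use that in \<open>auto simp: cball_subset_cball_iff dist_commute r_def\<close>)
  show ?thesis
  proof (rule that[OF r])
    show "continuous_on {0..1} (\<lambda>\<theta>. inverse (circlepath 0 r \<theta>))"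
      unfolding circlepath by (intro continuous_intros) (use r in auto)
    show "y + axis i (circlepath 0 r \<theta>) \<in> Q" if "y \<in> ball z r" for y \<theta>
      using cb[OF that] r by (force simp: norm_axis_complex dist_norm circlepath norm_mult)
  qed (simp add: pd_circle[OF q \<open>open Q\<close> r cb] divide_inverse)
qed

lemma pd_continuous:
  fixes q :: "complex ^ 'n \<Rightarrow> complex"
  assumes q: "holo_on q Q" and "open Q" shows "continuous_on Q (pd i q)"
  unfolding continuous_on_eq_continuous_at[OF \<open>open Q\<close>]
proof
  fix z assume "z \<in> Q"
  from pd_locally_circle_integral[OF assms this, where i = i]
  obtain r where r: "0 < r" "continuous_on {0..1} (\<lambda>\<theta>. inverse (circlepath 0 r \<theta>))"
    "\<And>y \<theta>. y \<in> ball z r \<Longrightarrow> y + axis i (circlepath 0 r \<theta>) \<in> Q"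
    "\<And>y. y \<in> ball z r \<Longrightarrow> pd i q y =
      integral {0..1} (\<lambda>\<theta>. q (y + axis i (circlepath 0 r \<theta>)) * inverse (circlepath 0 r \<theta>))"
    by blast
  have "continuous_on (ball z r \<times> {0..1}) (\<lambda>(y, \<theta>). q (y + axis i (circlepath 0 r \<theta>)) * inverse (circlepath 0 r \<theta>))"
    by (rule circle_integrand_continuous[OF holo_on_imp_continuous_on[OF q] r(2,3)])
  then have "continuous_on (ball z r) (\<lambda>y. integral {0..1} (\<lambda>\<theta>. q (y + axis i (circlepath 0 r \<theta>)) * inverse (circlepath 0 r \<theta>)))"
    using integral_continuous_on_param[of "ball z r" 0 "1::real"] by simp
  then have "continuous_on (ball z r) (pd i q)"
    by (rule continuous_on_eq) (simp add: r(4))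
  then show "isCont (pd i q) z" using r(1)
    by (simp add: continuous_on_eq_continuous_at)
qed

text \<open>Used both for partial derivatives (\<open>k = 1/\<zeta>\<close>) and, with \<open>k = 1\<close>, for the quotient in
\<open>holo_divide_by_defining\<close>.\<close>

lemma holo_circle_integral:
  fixes q :: "complex ^ 'n \<Rightarrow> complex"
  assumes q: "holo_on q Q" "open Q" and k: "continuous_on {0..1} k"
    and V: "\<And>z \<theta>. z \<in> V \<Longrightarrow> \<theta> \<in> {0..1} \<Longrightarrow> z + axis i (circlepath 0 r \<theta>) \<in> Q"
    and "open V"
  shows "holo_on (\<lambda>z. integral {0..1} (\<lambda>\<theta>. q (z + axis i (circlepath 0 r \<theta>)) * k \<theta>)) V"
  unfolding holo_on_def
proof
  fix z0 assume "z0 \<in> V"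
  then obtain e where e: "e > 0" "ball z0 e \<subseteq> V" using \<open>open V\<close> open_contains_ball by blast
  define pr where "pr = (\<lambda>j. Blinfun (\<lambda>h::complex ^ 'n. h $ j))"
  have pr: "blinfun_apply (pr j) h = h $ j" for j h
    unfolding pr_def by (simp add: bounded_linear_Blinfun_apply bounded_linear_vec_nth)
  \<comment> \<open>the derivative of the integrand, as a bounded linear map built from the partial derivatives so that its continuity is visible\<close>
  define fx where "fx = (\<lambda>x \<theta>. \<Sum>j\<in>UNIV. blinfun_mult_left (pd j q (x + axis i (circlepath 0 r \<theta>)) * k \<theta>) o\<^sub>L pr j)"
  have fx: "blinfun_apply (fx x \<theta>) h = (\<Sum>j\<in>UNIV. h $ j * (pd j q (x + axis i (circlepath 0 r \<theta>)) * k \<theta>))" for x \<theta> h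
    by (simp add: fx_def blinfun.sum_left pr)
  have Vb: "\<And>z \<theta>. z \<in> ball z0 e \<Longrightarrow> \<theta> \<in> {0..1} \<Longrightarrow> z + axis i (circlepath 0 r \<theta>) \<in> Q"
    using V e by blast
  have cont: "continuous_on (ball z0 e \<times> {0..1}) (\<lambda>(x, \<theta>). fx x \<theta>)"
  proof -
    have "continuous_on (ball z0 e \<times> {0..1}) (\<lambda>p. fx (fst p) (snd p))"
      unfolding fx_def
      by (intro continuous_intros continuous_on_sum bounded_linear.continuous_on[OF bounded_linear_blinfun_mult_left]
        circle_integrand_continuous[OF pd_continuous[OF q] k Vb, unfolded case_prod_unfold]) auto
    then show ?thesis by (simp add: case_prod_unfold)
  qed
  have P: "continuous_on {0..1::real} (Pair x)" for x :: "complex ^ 'n"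
    by (intro continuous_intros)
  have der: "((\<lambda>z. integral (cbox 0 1) (\<lambda>\<theta>. q (z + axis i (circlepath 0 r \<theta>)) * k \<theta>)) has_derivative
     integral (cbox 0 1) (fx z0)) (at z0 within ball z0 e)"
  proof (rule leibniz_rule)
    fix x and t :: real assume x: "x \<in> ball z0 e" "t \<in> cbox 0 1"
    have "((\<lambda>x. x + axis i (circlepath 0 r t)) has_derivative (\<lambda>h. h)) (at x)"
      by (auto intro!: derivative_eq_intros)
    from has_derivative_mult_right[OF has_derivative_compose[OF this cderiv_pd[OF q(1), unfolded cderiv_def]], of "k t"] x
    have "((\<lambda>x. k t * q (x + axis i (circlepath 0 r t))) has_derivative
      (\<lambda>h. k t * (\<Sum>j\<in>UNIV. h $ j * pd j q (x + axis i (circlepath 0 r t))))) (at x)"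
      using Vb by simp
    moreover have "(\<lambda>h. k t * (\<Sum>j\<in>UNIV. h $ j * pd j q (x + axis i (circlepath 0 r t)))) = blinfun_apply (fx x t)"
      by (simp add: fun_eq_iff fx sum_distrib_left mult_ac)
    ultimately show "((\<lambda>x. q (x + axis i (circlepath 0 r t)) * k t) has_derivative blinfun_apply (fx x t)) (at x within ball z0 e)"
      by (simp add: has_derivative_at_withinI mult.commute)
  next
    fix x assume x: "x \<in> ball z0 e"
    have "continuous_on {0..1} (\<lambda>\<theta>. q (x + axis i (circlepath 0 r \<theta>)) * k \<theta>)"
      using continuous_on_compose2[OF circle_integrand_continuous[OF holo_on_imp_continuous_on[OF q(1)] k Vb, unfolded case_prod_unfold] P, of "ball z0 e" x] x
      by (auto simp: image_subset_iff)
    then show "(\<lambda>\<theta>. q (x + axis i (circlepath 0 r \<theta>)) * k \<theta>) integrable_on cbox 0 1"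
      by (simp add: integrable_continuous_interval)
  qed (use cont e in auto)
  have fxint: "fx z0 integrable_on cbox 0 1"
    using continuous_on_compose2[OF cont[unfolded case_prod_unfold] P, of z0] e
    by (auto intro!: integrable_continuous_interval simp: image_subset_iff)
  show "\<exists>D. ((\<lambda>z. integral {0..1} (\<lambda>\<theta>. q (z + axis i (circlepath 0 r \<theta>)) * k \<theta>)) has_derivative D) (at z0) \<and>
      (\<forall>c h. D (c *s h) = c * D h)"
  proof (intro exI conjI allI)
    show "((\<lambda>z. integral {0..1} (\<lambda>\<theta>. q (z + axis i (circlepath 0 r \<theta>)) * k \<theta>)) has_derivative blinfun_apply (integral (cbox 0 1) (fx z0))) (at z0)"
      using der e by (simp add: at_within_open[of z0 "ball z0 e"])
    fix c :: complex and h
    show "blinfun_apply (integral (cbox 0 1) (fx z0)) (c *s h) = c * blinfun_apply (integral (cbox 0 1) (fx z0)) h"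
      unfolding blinfun_apply_integral[OF fxint] fx by (simp add: mult.assoc flip: sum_distrib_left)
  qed
qed

lemma pd_holo_on:
  fixes q :: "complex ^ 'n \<Rightarrow> complex"
  assumes q: "holo_on q Q" and "open Q" shows "holo_on (pd i q) Q"
  unfolding holo_on_def
proof
  fix z assume "z \<in> Q"
  from pd_locally_circle_integral[OF assms this, where i = i]
  obtain r where r: "0 < r" "continuous_on {0..1} (\<lambda>\<theta>. inverse (circlepath 0 r \<theta>))"
    "\<And>y \<theta>. y \<in> ball z r \<Longrightarrow> y + axis i (circlepath 0 r \<theta>) \<in> Q"
    "\<And>y. y \<in> ball z r \<Longrightarrow> pd i q y =
      integral {0..1} (\<lambda>\<theta>. q (y + axis i (circlepath 0 r \<theta>)) * inverse (circlepath 0 r \<theta>))"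
    by blast
  have "holo_on (pd i q) (ball z r)"
    by (rule holo_on_cong[OF holo_circle_integral[OF assms r(2,3) open_ball] open_ball]) (simp_all add: r(4))
  then show "\<exists>D. (pd i q has_derivative D) (at z) \<and> (\<forall>c h. D (c *s h) = c * D h)"
    using r(1) unfolding holo_on_def by simp
qed

section \<open>Division by a defining function and the identity theorem\<close>

lemma holomorphic_quotient_simple_zeros:
  fixes a b :: "complex \<Rightarrow> complex"
  assumes a: "a holomorphic_on T" and b: "b holomorphic_on T" and T: "open T"
    and z: "\<And>t. t \<in> T \<Longrightarrow> b t = 0 \<Longrightarrow> a t = 0 \<and> deriv b t \<noteq> 0"
  shows "(\<lambda>t. if b t = 0 then deriv a t / deriv b t else a t / b t) holomorphic_on T"
    (is "?\<psi> holomorphic_on T")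
proof -
  have "?\<psi> field_differentiable at t0" if t0: "t0 \<in> T" for t0
  proof (cases "b t0 = 0")
    case True
    define q where "q = (\<lambda>g t. if t = t0 then deriv g t0 else (g t - g t0) / (t - t0) :: complex)"
    have qa: "q a holomorphic_on T" and qb: "q b holomorphic_on T"
      unfolding q_def using pole_lemma_open[OF a T] pole_lemma_open[OF b T] by auto
    have "q b t0 \<noteq> 0" using z[OF t0 True] by (simp add: q_def)
    then obtain e where e: "e > 0" "ball t0 e \<subseteq> T" "\<And>t. t \<in> ball t0 e \<Longrightarrow> q b t \<noteq> 0"
    proof -
      have "open (T \<inter> q b -` (- {0}))"
        using continuous_open_preimage[OF holomorphic_on_imp_continuous_on[OF qb] T, of "- {0}"] by auto
      moreover have "t0 \<in> T \<inter> q b -` (- {0})" using t0 \<open>q b t0 \<noteq> 0\<close> by auto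
      ultimately obtain e where "e > 0" "ball t0 e \<subseteq> T \<inter> q b -` (- {0})"
        using open_contains_ball by blast
      then show ?thesis using that by blast
    qed
    have "(\<lambda>t. q a t / q b t) holomorphic_on ball t0 e"
      by (intro holomorphic_on_divide holomorphic_on_subset[OF qa] holomorphic_on_subset[OF qb]) (use e in auto)
    moreover have "q a t / q b t = ?\<psi> t" if "t \<in> ball t0 e" for t
      using e(3)[OF that] z[OF t0 True] True by (auto simp: q_def)
    ultimately have "?\<psi> holomorphic_on ball t0 e" by (rule holomorphic_transform)
    then show ?thesis using e(1) holomorphic_on_imp_differentiable_at by fastforce
  next
    case False
    have "open (T \<inter> b -` (- {0}))"
      using continuous_open_preimage[OF holomorphic_on_imp_continuous_on[OF b] T, of "- {0}"] by auto
    moreover have "?\<psi> holomorphic_on (T \<inter> b -` (- {0}))"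
    proof (rule holomorphic_transform)
      show "(\<lambda>t. a t / b t) holomorphic_on (T \<inter> b -` (- {0}))"
        by (intro holomorphic_on_divide holomorphic_on_subset[OF a] holomorphic_on_subset[OF b]) auto
    qed auto
    ultimately show ?thesis using False t0 holomorphic_on_imp_differentiable_at by fastforce
  qed
  then show ?thesis by (auto simp: holomorphic_on_def field_differentiable_at_within)
qed

lemma isolated_zero_of_deriv:
  assumes "((\<phi>::complex \<Rightarrow> complex) has_field_derivative d) (at 0)" "\<phi> 0 = 0" "d \<noteq> 0"
  shows "\<forall>\<^sub>F t in at 0. \<phi> t \<noteq> 0"
proof -
  have "((\<lambda>t. \<phi> t / t) \<longlongrightarrow> d) (at 0)"
    using assms by (simp add: has_field_derivative_iff)
  from tendsto_imp_eventually_ne[OF this assms(3)] show ?thesis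
    by eventually_elim auto
qed

lemma axis_line_deriv:
  assumes "holo_on f U" "z + axis i t \<in> U"
  shows "((\<lambda>t. f (z + axis i t)) has_field_derivative pd i f (z + axis i t)) (at t)"
proof -
  have *: "t *s axis i 1 = axis i t" for t :: complex by (simp add: vec_eq_iff axis_def)
  have "(\<Sum>j\<in>UNIV. axis i 1 $ j * grad f (z + axis i t) $ j) = grad f (z + axis i t) $ i"
    by (simp add: axis_def if_distrib[of "\<lambda>x. x * _"] cong: if_cong)
  with cderiv_line[OF holo_on_cderiv[OF assms(1)], of z t "axis i 1"] assms(2)
  show ?thesis by (simp add: * grad_def)
qed

text \<open>Near \<open>0\<close> the zeros of \<open>f\<close> on each line in direction \<open>i\<close> are simple, so \<open>A/f\<close> extends
holomorphically over them on that line, and its value at \<open>z\<close> is the mean of \<open>A/f\<close> over a circle around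
\<open>z\<close> on which \<open>f\<close> has no zero. The mean depends holomorphically on all of \<open>z\<close>.\<close>

lemma holo_divide_by_defining:
  fixes f A :: "complex ^ 'n \<Rightarrow> complex"
  assumes A: "holo_on A U" and f: "holo_on f U" and U: "open U" "0 \<in> U"
    and f0: "f 0 = 0" "pd i f 0 \<noteq> 0" and van: "\<And>z. z \<in> U \<Longrightarrow> f z = 0 \<Longrightarrow> A z = 0"
  obtains V h where "open V" "0 \<in> V" "V \<subseteq> U" "holo_on h V" "\<And>z. z \<in> V \<Longrightarrow> A z = f z * h z"
proof -
  have "open (U \<inter> pd i f -` (- {0}))"
    using continuous_open_preimage[OF pd_continuous[OF f U(1)] U(1), of "- {0}" i] by auto
  moreover have "0 \<in> U \<inter> pd i f -` (- {0})" using U f0 by auto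
  ultimately obtain e where e: "e > 0" "ball 0 e \<subseteq> U \<inter> pd i f -` (- {0})"
    using open_contains_ball by blast
  then have eU: "ball 0 e \<subseteq> U" and epd: "\<And>z. z \<in> ball 0 e \<Longrightarrow> pd i f z \<noteq> 0" by auto
  have ax0: "axis i 0 = (0::complex ^ 'n)" by (simp add: vec_eq_iff axis_def)
  have "\<forall>\<^sub>F t in at 0. f (0 + axis i t) \<noteq> 0"
    by (rule isolated_zero_of_deriv[OF axis_line_deriv[OF f]]) (use U f0 in \<open>auto simp: ax0\<close>)
  then obtain d where d: "d > 0" "\<And>t. t \<noteq> 0 \<Longrightarrow> norm t < d \<Longrightarrow> f (axis i t) \<noteq> 0"
    by (auto simp: eventually_at dist_norm)
  define r where "r = min (d / 2) (e / 3)"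
  have r: "0 < r" "r < d" "r < e / 2" using d e by (auto simp: r_def)
  define Q where "Q = U \<inter> f -` (- {0})"
  have Q: "open Q" unfolding Q_def
    using continuous_open_preimage[OF holo_on_imp_continuous_on[OF f] U(1), of "- {0}"] by auto
  \<comment> \<open>a circle in the coordinate line through \<open>0\<close>, together with a \<open>\<delta>\<close>-neighbourhood, avoids the zeros of \<open>f\<close>; so do its translates by small \<open>z\<close>\<close>
  define K where "K = (axis i ` sphere 0 r :: (complex ^ 'n) set)"
  have "compact K" unfolding K_def
    by (intro compact_continuous_image linear_continuous_on bounded_linear_axis) simp
  moreover have "K \<subseteq> Q"
  proof -
    have "(axis i t :: complex ^ 'n) \<in> ball 0 e" if "norm t = r" for t
      using that r by (auto simp: norm_axis_complex)
    then show ?thesis using d r eU by (fastforce simp: K_def Q_def)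
  qed
  ultimately obtain \<delta> where \<delta>: "\<delta> > 0" "(\<Union>x\<in>K. ball x \<delta>) \<subseteq> Q"
    using compact_subset_open_imp_ball_epsilon_subset[OF _ Q] by blast
  define V where "V = ball (0::complex ^ 'n) (min \<delta> (e / 2))"
  have circ: "norm (circlepath 0 r \<theta>) = r" for \<theta> using r by (simp add: circlepath norm_mult)
  have VQ: "z + axis i (circlepath 0 r \<theta>) \<in> Q" if "z \<in> V" for z \<theta>
  proof -
    have "z + axis i (circlepath 0 r \<theta>) \<in> ball (axis i (circlepath 0 r \<theta>)) \<delta>"
      using that by (simp add: V_def dist_norm)
    moreover have "axis i (circlepath 0 r \<theta>) \<in> K" unfolding K_def using circ by auto
    ultimately show ?thesis using \<delta> by blast
  qed
  have q: "holo_on (\<lambda>z. A z / f z) Q"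
    by (intro holo_on_divide holo_on_subset[OF A] holo_on_subset[OF f]) (auto simp: Q_def)
  define h where "h = (\<lambda>z. integral {0..1} (\<lambda>\<theta>. A (z + axis i (circlepath 0 r \<theta>)) / f (z + axis i (circlepath 0 r \<theta>))))"
  have "holo_on h V" unfolding h_def
    using holo_circle_integral[OF q Q, of "\<lambda>_. 1" V i r] VQ by (simp add: V_def)
  moreover have "A z = f z * h z" if z: "z \<in> V" for z
  proof (cases "f z = 0")
    case True
    moreover have "z \<in> U" using eU z e(1) by (auto simp: V_def)
    ultimately show ?thesis using van by simp
  next
    case False
    define T where "T = {t. z + axis i t \<in> ball 0 e}"
    have "T = (\<lambda>t. z + axis i t) -` ball 0 e" by (auto simp: T_def)
    then have T: "open T"
      by (simp only:) (intro open_vimage continuous_intros bounded_linear.continuous_on[OF bounded_linear_axis] open_ball)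
    define a b where "a = (\<lambda>t. A (z + axis i t))" and "b = (\<lambda>t. f (z + axis i t))"
    have a: "a holomorphic_on T" and b: "b holomorphic_on T"
      unfolding a_def b_def by (rule holomorphic_on_subset[OF holo_on_axis_line], rule A f, use eU in \<open>auto simp: T_def\<close>)+
    define \<psi> where "\<psi> = (\<lambda>t. if b t = 0 then deriv a t / deriv b t else a t / b t)"
    have db: "deriv b t = pd i f (z + axis i t)" if "t \<in> T" for t
      unfolding b_def by (rule DERIV_imp_deriv, rule axis_line_deriv[OF f]) (use that eU in \<open>auto simp: T_def\<close>)
    have \<psi>: "\<psi> holomorphic_on T" unfolding \<psi>_def
      by (rule holomorphic_quotient_simple_zeros[OF a b T])
         (use van eU epd db in \<open>auto simp: T_def a_def b_def subset_iff\<close>)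
    have "cball 0 r \<subseteq> T"
    proof
      fix t :: complex assume "t \<in> cball 0 r"
      then have "norm z + norm (axis i t :: complex ^ 'n) < e" using z r e by (auto simp: V_def norm_axis_complex)
      then show "t \<in> T" using norm_triangle_ineq[of z "axis i t"] by (simp add: T_def)
    qed
    then have "((\<lambda>u. \<psi> u / (u - 0)) has_contour_integral (2 * of_real pi * \<i> * \<psi> 0)) (circlepath 0 r)"
      by (intro Cauchy_integral_circlepath_simple holomorphic_on_subset[OF \<psi>]) (use r in auto)
    then have "2 * of_real pi * \<i> * \<psi> 0 = contour_integral (circlepath 0 r) (\<lambda>u. \<psi> u / (u - 0))"
      by (simp add: contour_integral_unique)
    also have "\<dots> = integral {0..1} (\<lambda>\<theta>. (2 * of_real pi * \<i>) * (A (z + axis i (circlepath 0 r \<theta>)) / f (z + axis i (circlepath 0 r \<theta>))))"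
      unfolding contour_integral_integral
    proof (rule integral_cong)
      fix x :: real
      have "\<psi> (circlepath 0 r x) = A (z + axis i (circlepath 0 r x)) / f (z + axis i (circlepath 0 r x))"
        using VQ[OF z, of x] by (simp add: \<psi>_def a_def b_def Q_def)
      then show "\<psi> (circlepath 0 r x) / (circlepath 0 r x - 0) * vector_derivative (circlepath 0 r) (at x) =
         (2 * of_real pi * \<i>) * (A (z + axis i (circlepath 0 r x)) / f (z + axis i (circlepath 0 r x)))"
        using r by (simp add: vector_derivative_circlepath circlepath[of 0 r, THEN fun_cong])
    qed
    also have "\<dots> = 2 * of_real pi * \<i> * h z" unfolding integral_mult_right h_def ..
    finally have "\<psi> 0 = h z" by simp
    moreover have "\<psi> 0 = A z / f z" using False by (simp add: \<psi>_def a_def b_def ax0)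
    ultimately show ?thesis using False by (simp add: field_simps)
  qed
  ultimately show ?thesis using that[of V h] \<delta> e eU by (auto simp: V_def subset_iff)
qed

text \<open>Two points of a ball are joined by a complex line, on which the identity theorem in one variable applies. So the set of
points near which \<open>F\<close> vanishes is closed in \<open>N\<close>.\<close>

lemma holo_on_identity:
  fixes F :: "complex ^ 'n \<Rightarrow> complex"
  assumes F: "holo_on F N" and N: "open N" "connected N"
    and W: "open W" "W \<noteq> {}" "W \<subseteq> N" "\<And>z. z \<in> W \<Longrightarrow> F z = 0"
    and z: "z \<in> N"
  shows "F z = 0"
proof -
  define E where "E = {z\<in>N. \<exists>e>0. \<forall>w\<in>ball z e. w \<in> N \<and> F w = 0}"
  have key: "y \<in> E" if e: "ball x e \<subseteq> N" and y: "y \<in> ball x e" and y1: "y1 \<in> ball x e \<inter> E" for x y y1 e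
  proof -
    have "F w = 0" if w: "w \<in> ball x e" for w
    proof -
      define T where "T = (\<lambda>t. y1 + t *s (w - y1)) -` ball x e"
      have cont: "continuous_on UNIV (\<lambda>t. y1 + t *s (w - y1))"
        by (intro continuous_intros linear_continuous_on bounded_linear_smult)
      have T: "open T" unfolding T_def by (intro open_vimage cont open_ball)
      have cT: "convex T"
      proof (rule convexI)
        fix a b :: complex and u v :: real
        assume ab: "a \<in> T" "b \<in> T" and uv: "0 \<le> u" "0 \<le> v" "u + v = 1"
        have "u *\<^sub>R (y1 + a *s (w - y1)) + v *\<^sub>R (y1 + b *s (w - y1)) \<in> ball x e"
          using ab uv by (intro convexD[OF convex_ball]) (auto simp: T_def)
        moreover have "u *\<^sub>R (y1 + a *s (w - y1)) + v *\<^sub>R (y1 + b *s (w - y1))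
          = (u + v) *\<^sub>R y1 + (u *\<^sub>R a + v *\<^sub>R b) *s (w - y1)"
          by (simp add: vec_eq_iff algebra_simps)
        ultimately show "u *\<^sub>R a + v *\<^sub>R b \<in> T" using uv by (simp add: T_def)
      qed
      obtain d where d: "d > 0" "\<And>w. w \<in> ball y1 d \<Longrightarrow> F w = 0" using y1 by (auto simp: E_def)
      define T0 where "T0 = T \<inter> (\<lambda>t. y1 + t *s (w - y1)) -` ball y1 d"
      have T0: "open T0" unfolding T0_def using T cont open_ball by (blast intro: open_vimage)
      have "F (y1 + 1 *s (w - y1)) = 0"
      proof (rule analytic_continuation_open[OF T0 T _ convex_connected[OF cT], where f = "\<lambda>t. F (y1 + t *s (w - y1))" and g = "\<lambda>_. 0"])
        have "0 \<in> T0" using y1 d by (simp add: T0_def T_def)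
        then show "T0 \<noteq> {}" by blast
        show "(\<lambda>t. F (y1 + t *s (w - y1))) holomorphic_on T"
          by (rule holomorphic_on_subset[OF holo_on_line[OF F]]) (use e in \<open>auto simp: T_def\<close>)
        show "1 \<in> T" using w by (simp add: T_def)
      qed (use d in \<open>auto simp: T0_def\<close>)
      then show ?thesis by simp
    qed
    moreover obtain d where "d > 0" "ball y d \<subseteq> ball x e" using y open_contains_ball open_ball by metis
    ultimately show ?thesis using e y unfolding E_def by blast
  qed
  have "open E" unfolding open_contains_ball
  proof
    fix x assume x: "x \<in> E"
    then have "x \<in> N" by (simp add: E_def)
    then obtain e where e: "e > 0" "ball x e \<subseteq> N" using N(1) open_contains_ball by blast
    then have "ball x e \<subseteq> E" using key[of x e _ x] x by auto
    with e show "\<exists>e>0. ball x e \<subseteq> E" by blast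
  qed
  moreover have "open (N - E)" unfolding open_contains_ball
  proof
    fix x assume x: "x \<in> N - E"
    then obtain e where e: "e > 0" "ball x e \<subseteq> N" using N(1) open_contains_ball by blast
    have "y \<notin> E" if "y \<in> ball x e" for y using key[of x e x y] e x that by auto
    then have "ball x e \<subseteq> N - E" using e by blast
    with e show "\<exists>e>0. ball x e \<subseteq> N - E" by blast
  qed
  ultimately have "E \<inter> N = {} \<or> (N - E) \<inter> N = {}"
    by (intro connectedD[OF N(2)]) auto
  moreover have "W \<subseteq> E"
  proof
    fix w assume "w \<in> W"
    with W(1) obtain e where "e > 0" "ball w e \<subseteq> W" using open_contains_ball by blast
    then show "w \<in> E" using W(3,4) \<open>w \<in> W\<close> unfolding E_def by blast
  qed
  ultimately have "z \<in> E" using W(2,3) z by auto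
  then show "F z = 0" unfolding E_def by force
qed

section \<open>Power series in several variables\<close>

text \<open>A power series is given by its coefficients and summed by homogeneous parts. The real power series with coefficients
\<open>coeff_size c k\<close> majorizes it on polydiscs; \<open>conv \<rho> c\<close> says that its radius of convergence is at
least \<open>\<rho>\<close>. All closure properties then follow from facts on power series in one real variable, with the
same \<open>\<rho>\<close>. The functions \<open>dcoeff\<close> and \<open>conv_prod\<close> are the derivative and the Cauchy product
on coefficients.\<close>

definition homog :: "(nat ^ 'k \<Rightarrow> complex) \<Rightarrow> nat \<Rightarrow> complex ^ 'k \<Rightarrow> complex" where
  "homog c k z = (\<Sum>\<gamma> | mdeg \<gamma> = k. c \<gamma> * mpower z \<gamma>)"
definition coeff_size :: "(nat ^ 'k \<Rightarrow> complex) \<Rightarrow> nat \<Rightarrow> real" where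
  "coeff_size c k = (\<Sum>\<gamma> | mdeg \<gamma> = k. norm (c \<gamma>))"
definition series :: "(nat ^ 'k \<Rightarrow> complex) \<Rightarrow> complex ^ 'k \<Rightarrow> complex" where
  "series c z = (\<Sum>k. homog c k z)"
definition conv :: "real \<Rightarrow> (nat ^ 'k \<Rightarrow> complex) \<Rightarrow> bool" where
  "conv \<rho> c \<longleftrightarrow> (\<forall>r. 0 < r \<and> r < \<rho> \<longrightarrow> summable (\<lambda>k. coeff_size c k * r ^ k))"
definition polydisc :: "real \<Rightarrow> (complex ^ 'k) set" where
  "polydisc \<rho> = {z. \<forall>i. norm (z $ i) < \<rho>}"
definition dcoeff :: "'k \<Rightarrow> (nat ^ 'k \<Rightarrow> complex) \<Rightarrow> nat ^ 'k \<Rightarrow> complex" where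
  "dcoeff i c \<gamma> = of_nat (\<gamma> $ i + 1) * c (\<gamma> + axis i 1)"
definition conv_prod :: "(nat ^ 'k \<Rightarrow> complex) \<Rightarrow> (nat ^ 'k \<Rightarrow> complex) \<Rightarrow> nat ^ 'k \<Rightarrow> complex" where
  "conv_prod a c \<gamma> = (\<Sum>\<delta> | \<delta> \<le> \<gamma>. a \<delta> * c (\<gamma> - \<delta>))"

lemma finite_mdeg_eq [simp]: "finite {\<gamma> :: nat ^ 'k. mdeg \<gamma> = k}"
  by (rule finite_subset[OF _ finite_mdeg_le[of k]]) auto

lemma axis_zero [simp]: "axis i 0 = 0"
  by (simp add: vec_eq_iff axis_def)

lemma mdeg_add [simp]: "mdeg (\<gamma> + \<delta>) = mdeg \<gamma> + mdeg \<delta>"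
  by (simp add: mdeg_def sum.distrib)
lemma mdeg_axis [simp]: "mdeg (axis i k) = k"
  by (simp add: mdeg_def axis_def)
lemma mdeg_0 [simp]: "mdeg 0 = 0"
  by (simp add: mdeg_def)
lemma mdeg_eq_0 [simp]: "mdeg \<gamma> = 0 \<longleftrightarrow> \<gamma> = 0"
  by (auto simp: mdeg_def vec_eq_iff)
lemma component_le_mdeg: "\<gamma> $ i \<le> mdeg \<gamma>"
  unfolding mdeg_def by (rule member_le_sum) auto
lemma mdeg_mono: "\<delta> \<le> \<gamma> \<Longrightarrow> mdeg \<delta> \<le> mdeg \<gamma>"
  unfolding mdeg_def less_eq_vec_def by (intro sum_mono) auto
lemma finite_mle [simp]: "finite {\<delta> :: nat ^ 'k. \<delta> \<le> \<gamma>}"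
  by (rule finite_subset[OF _ finite_mdeg_le[of "mdeg \<gamma>"]]) (auto intro: mdeg_mono)
lemma mle_diff_add [simp]: "(\<delta> :: nat ^ 'k) \<le> \<gamma> \<Longrightarrow> \<gamma> - \<delta> + \<delta> = \<gamma>" "(\<delta> :: nat ^ 'k) \<le> \<gamma> \<Longrightarrow> \<delta> + (\<gamma> - \<delta>) = \<gamma>"
  by (auto simp: vec_eq_iff less_eq_vec_def)
lemma axis_mle: "axis i (Suc 0) \<le> (\<gamma> :: nat ^ 'k) \<longleftrightarrow> 0 < \<gamma> $ i"
  by (auto simp: less_eq_vec_def axis_def)
lemma mle_add [simp]: "(\<gamma> :: nat ^ 'k) \<le> \<gamma> + \<delta>" "(\<gamma> :: nat ^ 'k) \<le> \<delta> + \<gamma>"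
  by (auto simp: less_eq_vec_def)

lemma mpower_0 [simp]: "mpower z 0 = 1" by (simp add: mpower_def)
lemma mpower_axis [simp]: "mpower z (axis i k) = z $ i ^ k"
proof -
  have "z $ j ^ (axis i k $ j) = (if j = i then z $ i ^ k else 1)" for j by (simp add: axis_def)
  then show ?thesis by (simp add: mpower_def)
qed
lemma mpower_add: "mpower z (\<gamma> + \<delta>) = mpower z \<gamma> * mpower z \<delta>"
  by (simp add: mpower_def power_add prod.distrib)

lemma norm_mpower_le:
  assumes "\<And>i. norm (z $ i) \<le> r" shows "norm (mpower z \<gamma>) \<le> r ^ mdeg \<gamma>"
  unfolding mpower_def mdeg_def prod_norm[symmetric] power_sum norm_power
  by (intro prod_mono) (simp add: power_mono assms)

lemma norm_homog_le:
  assumes "\<And>i. norm (z $ i) \<le> r" shows "norm (homog c k z) \<le> coeff_size c k * r ^ k"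
  unfolding homog_def coeff_size_def sum_distrib_right
  by (rule order_trans[OF norm_sum sum_mono])
     (auto simp: norm_mult intro!: mult_left_mono norm_mpower_le assms)

lemma coeff_size_nonneg [simp]: "0 \<le> coeff_size c k" by (simp add: coeff_size_def sum_nonneg)

lemma polydisc_radius:
  fixes z :: "complex ^ 'k"
  assumes "z \<in> polydisc \<rho>" obtains r where "0 < r" "r < \<rho>" "\<And>i. norm (z $ i) < r"
proof -
  define M where "M = Max (range (\<lambda>i. norm (z $ i)))"
  have M: "norm (z $ i) \<le> M" for i unfolding M_def by (rule Max_ge) auto
  have "M \<in> range (\<lambda>i. norm (z $ i))" unfolding M_def by (rule Max_in) auto
  then have "0 \<le> M" "M < \<rho>" using assms by (auto simp: polydisc_def)
  then have "0 < (M + \<rho>) / 2" "(M + \<rho>) / 2 < \<rho>" "M < (M + \<rho>) / 2" by auto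
  then show ?thesis using M by (meson that le_less_trans)
qed

lemma open_polydisc: "open (polydisc \<rho> :: (complex ^ 'k) set)"
proof -
  have "polydisc \<rho> = (\<Inter>i. {z :: complex ^ 'k. norm (z $ i) < \<rho>})" by (auto simp: polydisc_def)
  moreover have "open {z :: complex ^ 'k. norm (z $ i) < \<rho>}" for i
    by (intro open_Collect_less continuous_intros)
  ultimately show ?thesis by (simp add: open_INT)
qed

lemma convex_polydisc: "convex (polydisc \<rho> :: (complex ^ 'k) set)"
proof -
  have "polydisc \<rho> = (\<Inter>i. (\<lambda>z :: complex ^ 'k. z $ i) -` ball 0 \<rho>)" by (auto simp: polydisc_def)
  moreover have "convex ((\<lambda>z :: complex ^ 'k. z $ i) -` ball 0 \<rho>)" for i
    by (rule convex_linear_vimage) (auto intro: bounded_linear.linear bounded_linear_vec_nth)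
  ultimately show ?thesis by (simp add: convex_INT)
qed

lemma conv_summable: assumes "conv \<rho> c" "\<bar>x\<bar> < \<rho>" shows "summable (\<lambda>k. coeff_size c k * x ^ k)"
proof -
  define r where "r = (\<bar>x\<bar> + \<rho>) / 2"
  have "0 < r" "r < \<rho>" "\<bar>x\<bar> \<le> r" using assms(2) by (auto simp: r_def)
  have *: "norm (coeff_size c k * x ^ k) \<le> coeff_size c k * r ^ k" for k
    using power_mono[OF \<open>\<bar>x\<bar> \<le> r\<close>, of k] by (simp add: abs_mult power_abs mult_left_mono)
  have "summable (\<lambda>k. coeff_size c k * r ^ k)"
    using assms(1) \<open>0 < r\<close> \<open>r < \<rho>\<close> unfolding conv_def by blast
  show ?thesis by (rule summable_comparison_test'[of "\<lambda>k. coeff_size c k * r ^ k" 0]) (fact+, rule *)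
qed

lemma conv_le:
  assumes "conv \<rho> c" "\<And>k. coeff_size d k \<le> coeff_size c k" shows "conv \<rho> d"
  unfolding conv_def
proof (intro allI impI)
  fix r :: real assume r: "0 < r \<and> r < \<rho>"
  show "summable (\<lambda>k. coeff_size d k * r ^ k)"
    by (rule summable_comparison_test'[OF conv_summable[OF assms(1), of r]])
       (use r assms(2) in \<open>auto simp: abs_mult intro!: mult_right_mono\<close>)
qed

lemma conv_geometric:
  assumes \<rho>: "0 < \<rho>" and le: "\<And>k. coeff_size c k \<le> M * (1 / \<rho>) ^ k"
  shows "conv \<rho> c"
  unfolding conv_def
proof (intro allI impI)
  fix r :: real assume r: "0 < r \<and> r < \<rho>"
  have "summable (\<lambda>k. M * (r / \<rho>) ^ k)" using r by (intro summable_mult summable_geometric) auto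
  then show "summable (\<lambda>k. coeff_size c k * r ^ k)"
  proof (rule summable_comparison_test')
    fix k
    have "coeff_size c k * r ^ k \<le> M * (1 / \<rho>) ^ k * r ^ k" using r le by (intro mult_right_mono) auto
    then show "norm (coeff_size c k * r ^ k) \<le> M * (r / \<rho>) ^ k"
      using r by (simp add: abs_mult power_divide)
  qed
qed

lemma conv_antimono: "conv \<rho> c \<Longrightarrow> \<rho>' \<le> \<rho> \<Longrightarrow> conv \<rho>' c"
  by (auto simp: conv_def)

lemma polydisc_mono: "\<rho>' \<le> \<rho> \<Longrightarrow> polydisc \<rho>' \<subseteq> polydisc \<rho>"
  unfolding polydisc_def by (auto intro: less_le_trans)

lemma series_sums:
  assumes "conv \<rho> c" "z \<in> polydisc \<rho>"
  shows "(\<lambda>k. homog c k z) sums series c z" "summable (\<lambda>k. norm (homog c k z))"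
proof -
  obtain r where r: "0 < r" "r < \<rho>" "\<And>i. norm (z $ i) < r" using polydisc_radius[OF assms(2)] by blast
  have "summable (\<lambda>k. coeff_size c k * r ^ k)" using conv_summable[OF assms(1)] r by simp
  then show "summable (\<lambda>k. norm (homog c k z))"
    by (rule summable_comparison_test') (use r norm_homog_le[of z r] in \<open>auto simp: less_imp_le\<close>)
  then have "summable (\<lambda>k. homog c k z)" by (rule summable_norm_cancel)
  then show "(\<lambda>k. homog c k z) sums series c z" unfolding series_def by (rule summable_sums)
qed

lemma series_0 [simp]: "series c 0 = c 0"
proof -
  have 0: "homog c k 0 = (if k = 0 then c 0 else 0)" for k
  proof (cases "k = 0")
    case False
    have "mpower 0 \<gamma> = 0" if "mdeg \<gamma> = k" for \<gamma> :: "nat ^ 'a"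
    proof -
      have "\<gamma> \<noteq> 0" using that False by auto
      then obtain i where "\<gamma> $ i \<noteq> 0" by (auto simp: vec_eq_iff)
      then show ?thesis unfolding mpower_def by (intro prod_zero) auto
    qed
    then show ?thesis using False by (simp add: homog_def)
  qed (simp add: homog_def)
  show ?thesis unfolding series_def 0 using suminf_finite[of "{0}" "\<lambda>k. if k = 0 then c 0 else 0"] by simp
qed


lemma homog_add: "homog (\<lambda>\<gamma>. c \<gamma> + d \<gamma>) k z = homog c k z + homog d k z"
  by (simp add: homog_def algebra_simps sum.distrib)
lemma homog_cmult: "homog (\<lambda>\<gamma>. x * c \<gamma>) k z = x * homog c k z"
  by (simp add: homog_def sum_distrib_left mult_ac)
lemma coeff_size_cmult: "coeff_size (\<lambda>\<gamma>. x * c \<gamma>) k = norm x * coeff_size c k"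
  by (simp add: coeff_size_def sum_distrib_left norm_mult)
lemma coeff_size_add: "coeff_size (\<lambda>\<gamma>. c \<gamma> + d \<gamma>) k \<le> coeff_size c k + coeff_size d k"
  by (simp add: coeff_size_def sum.distrib[symmetric] sum_mono norm_triangle_ineq)

lemma conv_cmult: assumes "conv \<rho> c" shows "conv \<rho> (\<lambda>\<gamma>. x * c \<gamma>)"
  using assms unfolding conv_def coeff_size_cmult by (simp add: mult.assoc summable_mult)
lemma conv_add: assumes "conv \<rho> c" "conv \<rho> d" shows "conv \<rho> (\<lambda>\<gamma>. c \<gamma> + d \<gamma>)"
  unfolding conv_def
proof (intro allI impI)
  fix r :: real assume r: "0 < r \<and> r < \<rho>"
  have "summable (\<lambda>k. coeff_size c k * r ^ k + coeff_size d k * r ^ k)"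
    using assms r unfolding conv_def by (intro summable_add) auto
  then show "summable (\<lambda>k. coeff_size (\<lambda>\<gamma>. c \<gamma> + d \<gamma>) k * r ^ k)"
    by (rule summable_comparison_test')
       (use r coeff_size_add[of c d] in \<open>auto simp: abs_mult distrib_right[symmetric] intro!: mult_right_mono\<close>)
qed
lemma conv_0: "conv \<rho> (\<lambda>\<gamma>. 0)" by (simp add: conv_def coeff_size_def)
lemma conv_sum: "(\<And>i. i \<in> I \<Longrightarrow> conv \<rho> (c i)) \<Longrightarrow> conv \<rho> (\<lambda>\<gamma>. \<Sum>i\<in>I. c i \<gamma>)"
  by (induction I rule: infinite_finite_induct) (auto simp: conv_0 conv_add)
lemma series_cmult: assumes "conv \<rho> c" "z \<in> polydisc \<rho>" shows "series (\<lambda>\<gamma>. x * c \<gamma>) z = x * series c z"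
  using sums_mult[OF series_sums(1)[OF assms], of x] unfolding homog_cmult[symmetric]
  by (simp add: series_def sums_iff)
lemma series_add: assumes "conv \<rho> c" "conv \<rho> d" "z \<in> polydisc \<rho>"
  shows "series (\<lambda>\<gamma>. c \<gamma> + d \<gamma>) z = series c z + series d z"
  using sums_add[OF series_sums(1)[OF assms(1,3)] series_sums(1)[OF assms(2,3)]] unfolding homog_add[symmetric]
  by (simp add: series_def sums_iff)
lemma series_zero: "series (\<lambda>\<gamma>. 0) z = 0" by (simp add: series_def homog_def)
lemma series_sum: "(\<And>i. i \<in> I \<Longrightarrow> conv \<rho> (c i)) \<Longrightarrow> z \<in> polydisc \<rho> \<Longrightarrow> series (\<lambda>\<gamma>. \<Sum>i\<in>I. c i \<gamma>) z = (\<Sum>i\<in>I. series (c i) z)"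
proof (induction I rule: infinite_finite_induct)
  case (insert x F)
  then show ?case using series_add[of \<rho> "c x" "\<lambda>\<gamma>. \<Sum>i\<in>F. c i \<gamma>"] by (simp add: conv_sum)
qed (auto simp: series_zero)


lemma sum_convolution:
  fixes T :: "nat ^ 'k \<Rightarrow> nat ^ 'k \<Rightarrow> 'a::comm_monoid_add"
  shows "(\<Sum>\<gamma> | mdeg \<gamma> = k. \<Sum>\<delta> | \<delta> \<le> \<gamma>. T \<delta> (\<gamma> - \<delta>)) =
    (\<Sum>j\<le>k. \<Sum>\<delta> | mdeg \<delta> = j. \<Sum>\<epsilon> | mdeg \<epsilon> = k - j. T \<delta> \<epsilon>)"
proof -
  have "(\<Sum>\<gamma> | mdeg \<gamma> = k. \<Sum>\<delta> | \<delta> \<le> \<gamma>. T \<delta> (\<gamma> - \<delta>)) =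
    (\<Sum>(\<gamma>, \<delta>) \<in> Sigma {\<gamma>. mdeg \<gamma> = k} (\<lambda>\<gamma>. {\<delta>. \<delta> \<le> \<gamma>}). T \<delta> (\<gamma> - \<delta>))"
    by (rule sum.Sigma) auto
  also have "\<dots> = (\<Sum>(j, \<delta>, \<epsilon>) \<in> Sigma {..k} (\<lambda>j. Sigma {\<delta>. mdeg \<delta> = j} (\<lambda>\<delta>. {\<epsilon>. mdeg \<epsilon> = k - j})). T \<delta> \<epsilon>)"
    by (rule sum.reindex_bij_witness[where i = "\<lambda>(j, \<delta>, \<epsilon>). (\<delta> + \<epsilon>, \<delta>)" and j = "\<lambda>(\<gamma>, \<delta>). (mdeg \<delta>, \<delta>, \<gamma> - \<delta>)"])
       (auto simp: mdeg_mono dest!: mdeg_add[of "_ - _" , symmetric, THEN trans] ,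
        (metis mdeg_add mle_diff_add(1) add_diff_cancel_right')+)
  also have "\<dots> = (\<Sum>j\<le>k. \<Sum>(\<delta>, \<epsilon>) \<in> Sigma {\<delta>. mdeg \<delta> = j} (\<lambda>\<delta>. {\<epsilon>. mdeg \<epsilon> = k - j}). T \<delta> \<epsilon>)"
    by (subst sum.Sigma) auto
  also have "\<dots> = (\<Sum>j\<le>k. \<Sum>\<delta> | mdeg \<delta> = j. \<Sum>\<epsilon> | mdeg \<epsilon> = k - j. T \<delta> \<epsilon>)"
    by (intro sum.cong refl sum.Sigma[symmetric]) auto
  finally show ?thesis .
qed

lemma homog_conv_prod: "homog (conv_prod a c) k z = (\<Sum>j\<le>k. homog a j z * homog c (k - j) z)"
proof -
  have "homog (conv_prod a c) k z = (\<Sum>\<gamma> | mdeg \<gamma> = k. \<Sum>\<delta> | \<delta> \<le> \<gamma>. (a \<delta> * mpower z \<delta>) * (c (\<gamma> - \<delta>) * mpower z (\<gamma> - \<delta>)))"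
  proof -
    have "mpower z \<gamma> = mpower z \<delta> * mpower z (\<gamma> - \<delta>)" if "\<delta> \<le> \<gamma>" for \<gamma> \<delta>
      using mpower_add[of z \<delta> "\<gamma> - \<delta>"] that by simp
    then show ?thesis unfolding homog_def conv_prod_def sum_distrib_right
      by (intro sum.cong refl) (simp add: mult_ac)
  qed
  also have "\<dots> = (\<Sum>j\<le>k. homog a j z * homog c (k - j) z)"
    unfolding sum_convolution[of "\<lambda>\<delta> \<epsilon>. (a \<delta> * mpower z \<delta>) * (c \<epsilon> * mpower z \<epsilon>)"] homog_def
    by (simp add: sum_product)
  finally show ?thesis .
qed

lemma coeff_size_conv_prod: "coeff_size (conv_prod a c) k \<le> (\<Sum>j\<le>k. coeff_size a j * coeff_size c (k - j))"
proof -
  have "coeff_size (conv_prod a c) k \<le> (\<Sum>\<gamma> | mdeg \<gamma> = k. \<Sum>\<delta> | \<delta> \<le> \<gamma>. norm (a \<delta>) * norm (c (\<gamma> - \<delta>)))"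
    unfolding coeff_size_def conv_prod_def by (intro sum_mono order_trans[OF norm_sum]) (simp add: norm_mult)
  also have "\<dots> = (\<Sum>j\<le>k. coeff_size a j * coeff_size c (k - j))"
    unfolding sum_convolution[of "\<lambda>\<delta> \<epsilon>. norm (a \<delta>) * norm (c \<epsilon>)"] coeff_size_def
    by (simp add: sum_product)
  finally show ?thesis .
qed

lemma conv_conv_prod: assumes "conv \<rho> a" "conv \<rho> c" shows "conv \<rho> (conv_prod a c)"
  unfolding conv_def
proof (intro allI impI)
  fix r :: real assume r: "0 < r \<and> r < \<rho>"
  have "summable (\<lambda>k. \<Sum>j\<le>k. (coeff_size a j * r ^ j) * (coeff_size c (k - j) * r ^ (k - j)))"
    using assms r unfolding conv_def by (intro summable_Cauchy_product) auto
  moreover have "(\<Sum>j\<le>k. (coeff_size a j * r ^ j) * (coeff_size c (k - j) * r ^ (k - j))) = (\<Sum>j\<le>k. coeff_size a j * coeff_size c (k - j)) * r ^ k" for k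
    unfolding sum_distrib_right
    by (intro sum.cong refl) (simp add: power_add[symmetric] mult.assoc mult.left_commute[of "_ ^ _"])
  ultimately have "summable (\<lambda>k. (\<Sum>j\<le>k. coeff_size a j * coeff_size c (k - j)) * r ^ k)" by simp
  then show "summable (\<lambda>k. coeff_size (conv_prod a c) k * r ^ k)"
    by (rule summable_comparison_test')
       (use r coeff_size_conv_prod in \<open>auto simp: abs_mult intro!: mult_right_mono\<close>)
qed

lemma series_conv_prod: assumes "conv \<rho> a" "conv \<rho> c" "z \<in> polydisc \<rho>"
  shows "series (conv_prod a c) z = series a z * series c z"
  using Cauchy_product_sums[OF series_sums(2)[OF assms(1,3)] series_sums(2)[OF assms(2,3)]]
  unfolding homog_conv_prod[symmetric] by (simp add: series_def sums_iff)


lemma sum_shift_axis_degree: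
  fixes T :: "nat ^ 'k \<Rightarrow> 'a::comm_monoid_add"
  shows "(\<Sum>\<gamma> | P (mdeg \<gamma>) \<and> 0 < \<gamma> $ i. T \<gamma>) = (\<Sum>\<gamma> | P (Suc (mdeg \<gamma>)). T (\<gamma> + axis i 1))"
proof (rule sum.reindex_bij_witness[where i = "\<lambda>\<gamma>. \<gamma> + axis i 1" and j = "\<lambda>\<gamma>. \<gamma> - axis i 1"])
  fix \<gamma> :: "nat ^ 'k" assume "\<gamma> \<in> {\<gamma>. P (mdeg \<gamma>) \<and> 0 < \<gamma> $ i}"
  then have g: "\<gamma> - axis i 1 + axis i 1 = \<gamma>" and m: "P (mdeg \<gamma>)" by (auto simp: axis_mle)
  show "\<gamma> - axis i 1 + axis i 1 = \<gamma>" "T (\<gamma> - axis i 1 + axis i 1) = T \<gamma>" using g by auto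
  have "Suc (mdeg (\<gamma> - axis i 1)) = mdeg \<gamma>" using arg_cong[OF g, of mdeg] by simp
  then show "\<gamma> - axis i 1 \<in> {\<gamma>. P (Suc (mdeg \<gamma>))}" using m by simp
qed (auto simp: vec_eq_iff)

lemma sum_shift_axis:
  "(\<Sum>\<gamma> | mdeg \<gamma> = Suc k \<and> 0 < \<gamma> $ i. T \<gamma>) = (\<Sum>\<gamma> | mdeg \<gamma> = k. T (\<gamma> + axis i 1))"
  using sum_shift_axis_degree[where P = "\<lambda>n. n = Suc k"] by simp

lemma coeff_size_dcoeff: "coeff_size (dcoeff i c) k \<le> real (Suc k) * coeff_size c (Suc k)"
proof -
  have "coeff_size (dcoeff i c) k \<le> (\<Sum>\<gamma> | mdeg \<gamma> = k. real (Suc k) * norm (c (\<gamma> + axis i 1)))"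
    unfolding coeff_size_def dcoeff_def norm_mult norm_of_nat using component_le_mdeg
    by (intro sum_mono mult_right_mono) auto
  also have "\<dots> = real (Suc k) * (\<Sum>\<gamma> | mdeg \<gamma> = Suc k \<and> 0 < \<gamma> $ i. norm (c \<gamma>))"
    by (simp add: sum_shift_axis sum_distrib_left)
  also have "\<dots> \<le> real (Suc k) * coeff_size c (Suc k)"
    unfolding coeff_size_def by (intro mult_left_mono sum_mono2) auto
  finally show ?thesis .
qed

lemma conv_dcoeff: assumes "conv \<rho> c" shows "conv \<rho> (dcoeff i c)"
  unfolding conv_def
proof (intro allI impI)
  fix r :: real assume r: "0 < r \<and> r < \<rho>"
  have "summable (\<lambda>k. diffs (coeff_size c) k * r ^ k)"
    by (rule termdiff_converges[of r \<rho>]) (use r conv_summable[OF assms] in auto)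
  then show "summable (\<lambda>k. coeff_size (dcoeff i c) k * r ^ k)"
    by (rule summable_comparison_test')
       (use r coeff_size_dcoeff in \<open>auto simp: abs_mult diffs_def intro!: mult_right_mono\<close>)
qed

lemma cderiv_mpower: "cderiv (\<lambda>z. mpower z \<gamma>) z (\<chi> i. of_nat (\<gamma> $ i) * mpower z (\<gamma> - axis i 1))"
proof -
  have "((\<lambda>z. \<Prod>i\<in>UNIV. z $ i ^ (\<gamma> $ i)) has_derivative
      (\<lambda>h. \<Sum>i\<in>UNIV. (of_nat (\<gamma> $ i) * h $ i * z $ i ^ (\<gamma> $ i - 1)) * (\<Prod>j\<in>UNIV - {i}. z $ j ^ (\<gamma> $ j)))) (at z)"
    by (intro has_derivative_prod has_derivative_power bounded_linear_imp_has_derivative bounded_linear_vec_nth)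
  moreover have "mpower z (\<gamma> - axis i 1) = z $ i ^ (\<gamma> $ i - 1) * (\<Prod>j\<in>UNIV - {i}. z $ j ^ (\<gamma> $ j))" for i
    unfolding mpower_def by (subst prod.remove[of UNIV i]) (auto simp: axis_def intro!: prod.cong)
  ultimately show ?thesis unfolding cderiv_def mpower_def[symmetric] by (simp add: mult_ac)
qed

lemma cderiv_homog: "cderiv (homog c (Suc k)) z (\<chi> i. homog (dcoeff i c) k z)"
proof -
  have "cderiv (\<lambda>z. \<Sum>\<gamma> | mdeg \<gamma> = Suc k. c \<gamma> * mpower z \<gamma>) z
    (\<Sum>\<gamma> | mdeg \<gamma> = Suc k. c \<gamma> *s (\<chi> i. of_nat (\<gamma> $ i) * mpower z (\<gamma> - axis i 1)) + mpower z \<gamma> *s 0)"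
    by (intro cderiv_sum cderiv_mult cderiv_const cderiv_mpower)
  moreover have "(\<Sum>\<gamma> | mdeg \<gamma> = Suc k. c \<gamma> *s (\<chi> i. of_nat (\<gamma> $ i) * mpower z (\<gamma> - axis i 1)) + mpower z \<gamma> *s 0) = (\<chi> i. homog (dcoeff i c) k z)"
  proof -
    have "(\<Sum>\<gamma> | mdeg \<gamma> = Suc k. c \<gamma> * (of_nat (\<gamma> $ i) * mpower z (\<gamma> - axis i 1))) = homog (dcoeff i c) k z" for i
    proof -
      have "(\<Sum>\<gamma> | mdeg \<gamma> = Suc k. c \<gamma> * (of_nat (\<gamma> $ i) * mpower z (\<gamma> - axis i 1))) =
         (\<Sum>\<gamma> | mdeg \<gamma> = Suc k \<and> 0 < \<gamma> $ i. c \<gamma> * (of_nat (\<gamma> $ i) * mpower z (\<gamma> - axis i 1)))"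
        by (rule sum.mono_neutral_right) auto
      also have "\<dots> = homog (dcoeff i c) k z"
        unfolding sum_shift_axis homog_def dcoeff_def by (intro sum.cong refl) (simp add: axis_def mult_ac)
      finally show ?thesis .
    qed
    then show ?thesis by (simp add: vec_eq_iff)
  qed
  ultimately show ?thesis unfolding homog_def[abs_def] by simp
qed

lemma cderiv_homog_0: "cderiv (homog c 0) z 0"
proof -
  have "homog c 0 = (\<lambda>z. c 0)" by (simp add: homog_def fun_eq_iff)
  then show ?thesis by (simp add: cderiv_const)
qed

text \<open>Termwise differentiation, justified by the uniform convergence of the differentiated series on smaller polydiscs.\<close>

lemma cderiv_series:
  fixes z :: "complex ^ 'k"
  assumes c: "conv \<rho> c" and z: "z \<in> polydisc \<rho>"
  shows "cderiv (series c) z (\<chi> i. series (dcoeff i c) z)"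
proof -
  obtain r where r: "0 < r" "r < \<rho>" "\<And>i. norm (z $ i) < r" using polydisc_radius[OF z] by blast
  define f' where "f' = (\<lambda>n x (h::complex ^ 'k). \<Sum>i\<in>UNIV. h $ i * (case n of 0 \<Rightarrow> 0 | Suc k \<Rightarrow> homog (dcoeff i c) k x))"
  define g' where "g' = (\<lambda>x (h::complex ^ 'k). \<Sum>i\<in>UNIV. h $ i * series (dcoeff i c) x)"
  have sub: "x \<in> polydisc \<rho>" if "x \<in> polydisc r" for x :: "complex ^ 'k"
    using polydisc_mono[of r \<rho>] r that by auto
  have ul: "uniform_limit (polydisc r) (\<lambda>n x. \<Sum>k<n. homog (dcoeff i c) k x) (series (dcoeff i c)) sequentially" for i
    unfolding series_def[abs_def]
  proof (rule Weierstrass_m_test)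
    show "norm (homog (dcoeff i c) k x) \<le> coeff_size (dcoeff i c) k * r ^ k" if "x \<in> polydisc r" for k x
      using that by (intro norm_homog_le) (auto simp: polydisc_def less_imp_le)
    show "summable (\<lambda>k. coeff_size (dcoeff i c) k * r ^ k)" using conv_dcoeff[OF c] r by (simp add: conv_def)
  qed
  have "\<exists>g. \<forall>x\<in>polydisc r. (\<lambda>n. homog c n x) sums g x \<and> (g has_derivative g' x) (at x within polydisc r)"
  proof (rule has_derivative_series)
    show "convex (polydisc r :: (complex ^ 'k) set)" by (rule convex_polydisc)
    show "(homog c n has_derivative f' n x) (at x within polydisc r)" for n x
      using cderiv_homog[of c _ x] cderiv_homog_0[of c x] unfolding f'_def cderiv_def
      by (cases n) (auto intro: has_derivative_at_withinI)
    show "z \<in> polydisc r" using r by (simp add: polydisc_def)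
    show "(\<lambda>n. homog c n z) sums series c z" by (rule series_sums[OF c z])
    fix e :: real assume e: "e > 0"
    define e' where "e' = e / real (CARD('k))"
    have e': "e' > 0" using e by (simp add: e'_def)
    have "\<forall>\<^sub>F n in sequentially. \<forall>i. \<forall>x\<in>polydisc r. dist (\<Sum>k<n. homog (dcoeff i c) k x) (series (dcoeff i c) x) < e'"
      using ul e' unfolding uniform_limit_iff by (simp add: eventually_all_finite)
    then have "\<forall>\<^sub>F n in sequentially. \<forall>i. \<forall>x\<in>polydisc r. dist (\<Sum>k<n - 1. homog (dcoeff i c) k x) (series (dcoeff i c) x) < e'"
      by (rule eventually_compose_filterlim) (rule filterlim_minus_const_nat_at_top)
    then show "\<forall>\<^sub>F n in sequentially. \<forall>x\<in>polydisc r. \<forall>h. norm ((\<Sum>i<n. f' i x h) - g' x h) \<le> e * norm h"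
    proof (rule eventually_mono, intro ballI allI)
      fix n and x h :: "complex ^ 'k"
      assume *: "\<forall>i. \<forall>x\<in>polydisc r. dist (\<Sum>k<n - 1. homog (dcoeff i c) k x) (series (dcoeff i c) x) < e'" and x: "x \<in> polydisc r"
      have s: "(\<Sum>k<n. case k of 0 \<Rightarrow> 0 | Suc k \<Rightarrow> homog (dcoeff i c) k x) = (\<Sum>k<n - 1. homog (dcoeff i c) k x)" for i
        by (cases n) (auto simp: sum.lessThan_Suc_shift simp del: sum.lessThan_Suc)
      have "(\<Sum>i<n. f' i x h) - g' x h = (\<Sum>i\<in>UNIV. h $ i * ((\<Sum>k<n - 1. homog (dcoeff i c) k x) - series (dcoeff i c) x))"
        unfolding f'_def g'_def s[symmetric]
        by (subst sum.swap) (simp add: sum_subtractf[symmetric] sum_distrib_left[symmetric] right_diff_distrib)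
      also have "norm \<dots> \<le> (\<Sum>i\<in>(UNIV::'k set). norm h * e')"
      proof (rule order_trans[OF norm_sum sum_mono])
        fix i
        have "norm ((\<Sum>k<n - 1. homog (dcoeff i c) k x) - series (dcoeff i c) x) \<le> e'"
          using * x by (auto simp: dist_norm less_imp_le)
        then show "norm (h $ i * ((\<Sum>k<n - 1. homog (dcoeff i c) k x) - series (dcoeff i c) x)) \<le> norm h * e'"
          unfolding norm_mult by (intro mult_mono Finite_Cartesian_Product.norm_nth_le) auto
      qed
      also have "\<dots> = e * norm h" by (simp add: e'_def)
      finally show "norm ((\<Sum>i<n. f' i x h) - g' x h) \<le> e * norm h" .
    qed
  qed
  then obtain g where g: "\<And>x. x \<in> polydisc r \<Longrightarrow> (\<lambda>n. homog c n x) sums g x" "\<And>x. x \<in> polydisc r \<Longrightarrow> (g has_derivative g' x) (at x within polydisc r)"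
    by blast
  have zr: "z \<in> polydisc r" using r by (simp add: polydisc_def)
  have "g x = series c x" if "x \<in> polydisc r" for x
    using sums_unique2[OF g(1)[OF that] series_sums(1)[OF c sub[OF that]]] .
  moreover have "cderiv g z (\<chi> i. series (dcoeff i c) z)"
    using g(2)[OF zr] unfolding cderiv_def g'_def at_within_open[OF zr open_polydisc] by simp
  ultimately show ?thesis using cderiv_cong_open[OF _ open_polydisc zr] by blast
qed


section \<open>Taylor expansion of holomorphic functions\<close>

text \<open>Iterated derivatives are indexed by words in the coordinate directions: on a line \<open>t \<mapsto> t z\<close> the derivative of
order \<open>k\<close> is a sum over all words of length \<open>k\<close>. The Taylor coefficient of a multi-index collects
the words with these letter counts.\<close>

definition wcount :: "'k list \<Rightarrow> nat ^ 'k" where "wcount w = (\<chi> i. count_list w i)"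

abbreviation pdw :: "'k list \<Rightarrow> (complex ^ 'k \<Rightarrow> complex) \<Rightarrow> complex ^ 'k \<Rightarrow> complex" where
  "pdw w F \<equiv> foldr pd w F"

lemma wcount_Nil [simp]: "wcount [] = 0" by (simp add: wcount_def vec_eq_iff)
lemma wcount_Cons [simp]: "wcount (i # w) = axis i 1 + wcount w"
  by (simp add: wcount_def vec_eq_iff axis_def)
lemma mdeg_wcount [simp]: "mdeg (wcount w) = length w"
  by (induction w) auto
lemma mpower_wcount: "mpower z (wcount w) = prod_list (map (($) z) w)"
  by (induction w) (auto simp: mpower_add)

lemma finite_words [simp]: "finite {w :: 'k::finite list. length w = k}"
  using finite_lists_length_eq[of "UNIV :: 'k set" k] by simp
lemma card_words: "card {w :: 'k::finite list. length w = k} = CARD('k) ^ k"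
  using card_lists_length_eq[of "UNIV :: 'k set" k] by simp
lemma words_Suc: "{w. length w = Suc k} = (\<lambda>(i, w). i # w) ` (UNIV \<times> {w. length w = k})"
  by (auto simp: length_Suc_conv image_iff)
lemma sum_words_Suc:
  "(\<Sum>w | length w = Suc k. T w) = (\<Sum>w | length w = k. \<Sum>i\<in>UNIV. T (i # w :: 'k::finite list))"
proof -
  have "(\<Sum>w | length w = Suc k. T w) = (\<Sum>(i, w) \<in> UNIV \<times> {w. length w = k}. T (i # w))"
    unfolding words_Suc by (subst sum.reindex) (auto simp: inj_on_def case_prod_unfold)
  also have "\<dots> = (\<Sum>i\<in>UNIV. \<Sum>w | length w = k. T (i # w))" by (rule sum.cartesian_product[symmetric])
  also have "\<dots> = (\<Sum>w | length w = k. \<Sum>i\<in>UNIV. T (i # w))" by (rule sum.swap)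
  finally show ?thesis .
qed

lemma pdw_holo_on: "holo_on F U \<Longrightarrow> open U \<Longrightarrow> holo_on (pdw w F) U"
  by (induction w) (auto simp: pd_holo_on)

lemma cauchy_pd:
  fixes q :: "complex ^ 'k \<Rightarrow> complex"
  assumes q: "holo_on q U" and cb: "cball z \<delta> \<subseteq> U" and "0 < \<delta>" and M: "\<And>x. x \<in> cball z \<delta> \<Longrightarrow> norm (q x) \<le> M"
  shows "norm (pd i q z) \<le> M / \<delta>"
proof -
  have sub: "z + axis i t \<in> cball z \<delta>" if "norm t \<le> \<delta>" for t
    using that by (auto simp: dist_norm norm_axis_complex)
  have h: "(\<lambda>t. q (z + axis i t)) holomorphic_on cball 0 \<delta>"
    by (rule holomorphic_on_subset[OF holo_on_axis_line[OF q]]) (use sub cb in auto)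
  have "norm ((deriv ^^ 1) (\<lambda>t. q (z + axis i t)) 0) \<le> fact 1 * M / \<delta> ^ 1"
    by (rule Cauchy_inequality)
       (use h \<open>0 < \<delta>\<close> sub M in \<open>auto intro: holomorphic_on_imp_continuous_on holomorphic_on_subset\<close>)
  then show ?thesis by (simp add: pd_def)
qed

text \<open>Each letter costs one Cauchy estimate on a disc of radius \<open>\<delta>\<close>, and moves the point by at most
\<open>\<delta>\<close>.\<close>

lemma cauchy_pdw:
  fixes F :: "complex ^ 'k \<Rightarrow> complex"
  assumes F: "holo_on F U" "open U" and cb: "cball 0 R \<subseteq> U" and \<delta>: "0 < \<delta>" and M: "\<And>x. x \<in> cball 0 R \<Longrightarrow> norm (F x) \<le> M"
  shows "norm z \<le> R - real (length w) * \<delta> \<Longrightarrow> norm (pdw w F z) \<le> M / \<delta> ^ length w"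
proof (induction w arbitrary: z)
  case (Cons i w)
  have in1: "norm x \<le> R - real (length w) * \<delta>" if "x \<in> cball z \<delta>" for x
    using Cons.prems norm_triangle_ineq2[of x z] that by (auto simp: dist_norm algebra_simps norm_minus_commute)
  have "norm (pd i (pdw w F) z) \<le> (M / \<delta> ^ length w) / \<delta>"
  proof (rule cauchy_pd[OF pdw_holo_on[OF F] _ \<delta>])
    show "cball z \<delta> \<subseteq> U"
    proof
      fix x assume "x \<in> cball z \<delta>"
      from in1[OF this] have "norm x \<le> R" using mult_nonneg_nonneg[of "real (length w)" \<delta>] \<delta> by linarith
      then show "x \<in> U" using cb by auto
    qed
  qed (use Cons.IH in1 in auto)
  then show ?case by (simp add: mult.commute)
qed (use M in auto)

lemma pow_le_fact_exp: "real k ^ k \<le> fact k * exp (real k)"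
proof -
  have "(\<lambda>n. real k ^ n /\<^sub>R fact n) sums exp (real k)" by (rule exp_converges)
  then have s: "summable (\<lambda>n. real k ^ n /\<^sub>R fact n)" "exp (real k) = (\<Sum>n. real k ^ n /\<^sub>R fact n)"
    by (auto simp: sums_iff)
  have "(\<Sum>n\<in>{k}. real k ^ n /\<^sub>R fact n) \<le> (\<Sum>n. real k ^ n /\<^sub>R fact n)"
    by (rule sum_le_suminf[OF s(1)]) auto
  then have "fact k * (real k ^ k /\<^sub>R fact k) \<le> fact k * exp (real k)"
    unfolding s(2)[symmetric] by (intro mult_left_mono) auto
  then show ?thesis by (simp add: field_simps)
qed

lemma line_derivs:
  fixes F :: "complex ^ 'k \<Rightarrow> complex"
  assumes F: "holo_on F U" "open U"
  shows "t *s z \<in> U \<Longrightarrow> (deriv ^^ k) (\<lambda>t. F (t *s z)) t = (\<Sum>w | length w = k. prod_list (map (($) z) w) * pdw w F (t *s z))"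
proof (induction k arbitrary: t)
  case (Suc k)
  define G where "G = (\<lambda>t. \<Sum>w | length w = k. prod_list (map (($) z) w) * pdw w F (t *s z))"
  have op: "open {t. t *s z \<in> U}"
  proof -
    have "{t. t *s z \<in> U} = (\<lambda>t. t *s z) -` U" by auto
    then show ?thesis by (simp add: open_vimage F(2) linear_continuous_on bounded_linear_smult)
  qed
  have "(G has_field_derivative (\<Sum>w | length w = k. prod_list (map (($) z) w) * (\<Sum>i\<in>UNIV. z $ i * pdw (i # w) F (t *s z)))) (at t)"
    unfolding G_def
  proof (intro DERIV_sum DERIV_cmult)
    fix w :: "'k list"
    show "((\<lambda>t. pdw w F (t *s z)) has_field_derivative (\<Sum>i\<in>UNIV. z $ i * pdw (i # w) F (t *s z))) (at t)"
      using cderiv_line[OF cderiv_pd[OF pdw_holo_on[OF F, of w]], of 0 t z] Suc.prems by simp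
  qed
  also have "(\<Sum>w | length w = k. prod_list (map (($) z) w) * (\<Sum>i\<in>UNIV. z $ i * pdw (i # w) F (t *s z)))
     = (\<Sum>w | length w = Suc k. prod_list (map (($) z) w) * pdw w F (t *s z))"
    unfolding sum_words_Suc by (simp add: sum_distrib_left mult_ac)
  finally have "deriv G t = (\<Sum>w | length w = Suc k. prod_list (map (($) z) w) * pdw w F (t *s z))"
    by (rule DERIV_imp_deriv)
  moreover have "deriv ((deriv ^^ k) (\<lambda>t. F (t *s z))) t = deriv G t"
  proof (rule deriv_cong_ev)
    have "\<forall>\<^sub>F t in nhds t. t \<in> {t. t *s z \<in> U}" using op Suc.prems by (intro eventually_nhds_in_open) auto
    then show "\<forall>\<^sub>F x in nhds t. (deriv ^^ k) (\<lambda>t. F (t *s z)) x = G x"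
      by eventually_elim (use Suc.IH in \<open>auto simp: G_def\<close>)
  qed simp
  ultimately show ?case by simp
qed simp

definition taylor :: "(complex ^ 'k \<Rightarrow> complex) \<Rightarrow> nat ^ 'k \<Rightarrow> complex" where
  "taylor F \<gamma> = (\<Sum>w | length w = mdeg \<gamma> \<and> wcount w = \<gamma>. pdw w F 0) / fact (mdeg \<gamma>)"

lemma sum_words_by_count:
  fixes T :: "'k::finite list \<Rightarrow> 'a::comm_monoid_add"
  shows "(\<Sum>\<gamma> | mdeg \<gamma> = k. \<Sum>w | length w = mdeg \<gamma> \<and> wcount w = \<gamma>. T w) = (\<Sum>w | length w = k. T w)"
proof -
  have "(\<Sum>\<gamma> | mdeg \<gamma> = k. \<Sum>w | length w = mdeg \<gamma> \<and> wcount w = \<gamma>. T w) =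
      (\<Sum>\<gamma> \<in> {\<gamma>. mdeg \<gamma> = k}. \<Sum>w | w \<in> {w. length w = k} \<and> wcount w = \<gamma>. T w)"
    by (intro sum.cong refl) auto
  also have "\<dots> = (\<Sum>w | length w = k. T w)"
    by (rule sum.group) auto
  finally show ?thesis .
qed

lemma norm_le_sum_components: "norm (z :: complex ^ 'k) \<le> (\<Sum>i\<in>UNIV. norm (z $ i))"
  unfolding norm_vec_def by (rule L2_set_le_sum) auto

lemma holo_on_taylor:
  fixes F :: "complex ^ 'k \<Rightarrow> complex"
  assumes F: "holo_on F U" "open U" "0 \<in> U"
  obtains \<rho> where "0 < \<rho>" "conv \<rho> (taylor F)" "polydisc \<rho> \<subseteq> U" "\<And>z. z \<in> polydisc \<rho> \<Longrightarrow> F z = series (taylor F) z"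
proof -
  obtain R where R: "R > 0" "cball 0 R \<subseteq> U" using F open_contains_cball by blast
  define n where "n = real (CARD('k))"
  have n: "n \<ge> 1" by (simp add: n_def Suc_leI)
  have "compact (F ` cball 0 R)"
    by (intro compact_continuous_image continuous_on_subset[OF holo_on_imp_continuous_on[OF F(1)]] R) simp
  then obtain M where M: "\<And>x. x \<in> cball 0 R \<Longrightarrow> norm (F x) \<le> M"
    using compact_imp_bounded bounded_iff by (metis imageI)
  then have M0: "0 \<le> M" using R(1) norm_ge_zero order_trans by (metis centre_in_cball less_imp_le)
  \<comment> \<open>there are \<open>n\<^sup>k\<close> words of length \<open>k\<close>, each contributing at most \<open>M (e/R)\<^sup>k\<close>\<close>
  define \<rho> where "\<rho> = R / (n * exp 1)"
  have \<rho>: "0 < \<rho>" using R n by (simp add: \<rho>_def)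
  have word: "norm (pdw w F 0) \<le> fact k * M * (exp 1 / R) ^ k" if "length w = k" for w k
  proof (cases "k = 0")
    case True
    then show ?thesis using M[of 0] R that by simp
  next
    case False
    \<comment> \<open>the \<open>k\<close> steps share the radius \<open>R\<close>; the resulting \<open>k\<^sup>k\<close> is absorbed by \<open>k! e\<^sup>k\<close>\<close>
    have "norm (pdw w F 0) \<le> M / (R / k) ^ length w"
      by (rule cauchy_pdw[OF F(1,2) R(2) _ M]) (use that False R in auto)
    also have "\<dots> = M * real k ^ k / R ^ k" using that False by (simp add: power_divide field_simps)
    also have "\<dots> \<le> M * (fact k * exp (real k)) / R ^ k"
      using R M0 pow_le_fact_exp by (intro divide_right_mono mult_left_mono) auto
    also have "\<dots> = fact k * M * (exp 1 / R) ^ k"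
      by (simp add: power_divide exp_of_nat_mult[symmetric] field_simps)
    finally show ?thesis .
  qed
  have cs: "coeff_size (taylor F) k \<le> M * (1 / \<rho>) ^ k" for k
  proof -
    have "coeff_size (taylor F) k \<le> (\<Sum>\<gamma> | mdeg \<gamma> = k. \<Sum>w | length w = mdeg \<gamma> \<and> wcount w = \<gamma>. norm (pdw w F 0) / fact k)"
      unfolding coeff_size_def taylor_def
      by (intro sum_mono) (auto simp: norm_divide sum_divide_distrib[symmetric] intro!: divide_right_mono norm_sum)
    also have "\<dots> = (\<Sum>w | length w = k. norm (pdw w F 0) / fact k)" by (rule sum_words_by_count)
    also have "\<dots> \<le> (\<Sum>w :: 'k list | length w = k. M * (exp 1 / R) ^ k)"
      using word by (intro sum_mono) (auto simp: field_simps)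
    also have "\<dots> = M * (1 / \<rho>) ^ k" using R n
      by (simp add: card_words n_def \<rho>_def power_divide power_mult_distrib field_simps)
    finally show ?thesis .
  qed
  have conv: "conv \<rho> (taylor F)" by (rule conv_geometric[OF \<rho> cs])
  have small: "norm z \<le> R / 2" if "z \<in> polydisc \<rho>" for z :: "complex ^ 'k"
  proof -
    have "norm z \<le> (\<Sum>i\<in>UNIV. norm (z $ i))" by (rule norm_le_sum_components)
    also have "\<dots> \<le> (\<Sum>i\<in>(UNIV::'k set). \<rho>)" using that by (intro sum_mono) (auto simp: polydisc_def less_imp_le)
    also have "\<dots> = R / exp 1" using n by (simp add: n_def \<rho>_def)
    also have "\<dots> \<le> R / 2" using R exp_ge_add_one_self[of 1] by (intro divide_left_mono) auto
    finally show ?thesis .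
  qed
  have "F z = series (taylor F) z" if z: "z \<in> polydisc \<rho>" for z
  proof -
    have TU: "t *s z \<in> U" if "norm t < 2" for t
    proof -
      have "norm (t *s z) = norm t * norm z"
        by (simp add: norm_vec_def L2_set_def norm_mult power_mult_distrib sum_distrib_left[symmetric] real_sqrt_mult)
      also have "\<dots> \<le> 2 * (R / 2)" using that small[OF z] by (intro mult_mono) auto
      finally show ?thesis using R by auto
    qed
    have hol: "(\<lambda>t. F (t *s z)) holomorphic_on ball 0 2"
      using holomorphic_on_subset[OF holo_on_line[OF F(1), of 0 z], of "ball 0 2"] TU by (auto simp: subset_iff)
    have "(\<lambda>k. (deriv ^^ k) (\<lambda>t. F (t *s z)) 0 / fact k * (1 - 0) ^ k) sums F (1 *s z)"
      by (rule holomorphic_power_series[OF hol]) simp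
    moreover have "(deriv ^^ k) (\<lambda>t. F (t *s z)) 0 / fact k = homog (taylor F) k z" for k
    proof -
      have "homog (taylor F) k z = (\<Sum>\<gamma> | mdeg \<gamma> = k. \<Sum>w | length w = mdeg \<gamma> \<and> wcount w = \<gamma>. prod_list (map (($) z) w) * pdw w F 0 / fact k)"
        unfolding homog_def
      proof (intro sum.cong refl)
        fix \<gamma> :: "nat ^ 'k" assume "\<gamma> \<in> {\<gamma>. mdeg \<gamma> = k}"
        then have "taylor F \<gamma> * mpower z \<gamma> = (\<Sum>w | length w = mdeg \<gamma> \<and> wcount w = \<gamma>. mpower z \<gamma> * pdw w F 0 / fact k)"
          by (simp add: taylor_def sum_divide_distrib sum_distrib_left mult.commute)
        also have "\<dots> = (\<Sum>w | length w = mdeg \<gamma> \<and> wcount w = \<gamma>. prod_list (map (($) z) w) * pdw w F 0 / fact k)"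
          by (intro sum.cong refl) (auto simp: mpower_wcount)
        finally show "taylor F \<gamma> * mpower z \<gamma> = (\<Sum>w | length w = mdeg \<gamma> \<and> wcount w = \<gamma>. prod_list (map (($) z) w) * pdw w F 0 / fact k)" .
      qed
      also have "\<dots> = (\<Sum>w | length w = k. prod_list (map (($) z) w) * pdw w F 0 / fact k)" by (rule sum_words_by_count)
      also have "\<dots> = (deriv ^^ k) (\<lambda>t. F (t *s z)) 0 / fact k"
        using line_derivs[OF F(1,2), of 0 z k] F(3) by (simp add: sum_divide_distrib)
      finally show ?thesis ..
    qed
    ultimately have "(\<lambda>k. homog (taylor F) k z) sums F z" by simp
    then show ?thesis using series_sums(1)[OF conv z] sums_unique2 by blast
  qed
  moreover have "polydisc \<rho> \<subseteq> U" using small R by (force simp: subset_iff)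
  ultimately show ?thesis using that \<rho> conv by blast
qed

section \<open>The formal Goursat problem\<close>

definition word :: "nat ^ 'k \<Rightarrow> 'k list" where
  "word \<gamma> = concat (map (\<lambda>i. replicate (\<gamma> $ i) i) index_enum)"

lemma count_list_replicate: "count_list (replicate n x) y = (if y = x then n else 0)"
  by (induction n) auto

lemma wcount_word [simp]: "wcount (word \<gamma>) = \<gamma>"
proof -
  have "count_list (concat (map (\<lambda>i. replicate (\<gamma> $ i) i) xs)) j = (if j \<in> set xs then \<gamma> $ j else 0)"
    if "distinct xs" for xs j using that by (induction xs) (auto simp: count_list_0_iff count_list_replicate)
  from this[OF index_enum(1)] show ?thesis by (simp add: word_def wcount_def vec_eq_iff index_enum(2))
qed

lemma length_word [simp]: "length (word \<gamma>) = mdeg \<gamma>"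
  using mdeg_wcount[of "word \<gamma>"] by simp

lemma foldr_funpow: "foldr f (replicate n i) x = (f i ^^ n) x"
  by (induction n) auto

lemma mpd_eq_pdw: "mpd \<alpha> u = pdw (word \<alpha>) u"
proof -
  have "foldr (\<lambda>i. pd i ^^ (\<alpha> $ i)) xs u = foldr pd (concat (map (\<lambda>i. replicate (\<alpha> $ i) i) xs)) u" for xs
    by (induction xs) (auto simp: foldr_funpow)
  then show ?thesis by (simp add: mpd_def word_def)
qed

lemma card_mdeg_le: "card {\<gamma> :: nat ^ 'k. mdeg \<gamma> = k} \<le> CARD('k) ^ k"
proof -
  have "{\<gamma> :: nat ^ 'k. mdeg \<gamma> = k} \<subseteq> wcount ` {w. length w = k}"
    using wcount_word length_word by (metis (mono_tags, lifting) image_eqI mem_Collect_eq subsetI)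
  then have "card {\<gamma> :: nat ^ 'k. mdeg \<gamma> = k} \<le> card {w :: 'k list. length w = k}"
    using card_image_le[OF finite_words] card_mono[OF finite_imageI[OF finite_words]] le_trans by blast
  then show ?thesis by (simp add: card_words)
qed

definition mfact :: "nat ^ 'k \<Rightarrow> nat" where "mfact \<gamma> = (\<Prod>i\<in>UNIV. fact (\<gamma> $ i))"

lemma mfact_pos [simp]: "0 < mfact \<gamma>" by (simp add: mfact_def prod_pos)
lemma mfact_neq0 [simp]: "mfact \<gamma> \<noteq> 0" using mfact_pos[of \<gamma>] by linarith
lemma mfact_0 [simp]: "mfact 0 = 1" by (simp add: mfact_def)

lemma mfact_Suc: "mfact (\<gamma> + axis i (Suc 0)) = Suc (\<gamma> $ i) * mfact \<gamma>"
proof -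
  have "mfact (\<gamma> + axis i (Suc 0)) = (\<Prod>j\<in>UNIV. (if j = i then Suc (\<gamma> $ i) else 1) * fact (\<gamma> $ j))"
    unfolding mfact_def by (intro prod.cong refl) (auto simp: axis_def)
  then show ?thesis by (simp add: prod.distrib mfact_def)
qed

lemma mfact_add_le: "mfact \<gamma> \<le> mfact (\<gamma> + \<delta>)"
  unfolding mfact_def by (intro prod_mono) (auto intro: fact_mono)

lemma mi_decompose: assumes "0 < (\<gamma> :: nat ^ 'k) $ i" obtains \<delta> where "\<gamma> = \<delta> + axis i (Suc 0)"
  using mle_diff_add(1)[of "axis i (Suc 0)" \<gamma>] axis_mle[of i \<gamma>] assms by metis

lemma mi_induct [case_names zero add]:
  fixes \<gamma> :: "nat ^ 'k"
  assumes "P 0" "\<And>\<delta> i. P \<delta> \<Longrightarrow> P (\<delta> + axis i (Suc 0))" shows "P \<gamma>"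
proof (induction "mdeg \<gamma>" arbitrary: \<gamma>)
  case 0 then show ?case using assms(1) by simp
next
  case (Suc k)
  then have "\<gamma> \<noteq> 0" by auto
  then obtain i where "0 < \<gamma> $ i" by (auto simp: vec_eq_iff)
  then obtain \<delta> where "\<gamma> = \<delta> + axis i (Suc 0)" by (rule mi_decompose)
  then show ?case using Suc assms(2)[of \<delta> i] by simp
qed

lemma fact_mdeg_le: "fact (mdeg (\<gamma> :: nat ^ 'k)) \<le> CARD('k) ^ mdeg \<gamma> * mfact \<gamma>"
proof (induction "mdeg \<gamma>" arbitrary: \<gamma>)
  case (Suc k)
  have "fact (mdeg \<gamma>) = (\<Sum>i\<in>UNIV. \<gamma> $ i * fact k)"
    unfolding Suc(2)[symmetric] by (simp add: sum_distrib_right[symmetric] mdeg_def[symmetric] Suc(2)[symmetric])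
  also have "\<dots> \<le> (\<Sum>i\<in>(UNIV :: 'k set). CARD('k) ^ k * mfact \<gamma>)"
  proof (rule sum_mono)
    fix i
    show "\<gamma> $ i * fact k \<le> CARD('k) ^ k * mfact \<gamma>"
    proof (cases "0 < \<gamma> $ i")
      case True
      then obtain \<delta> where d: "\<gamma> = \<delta> + axis i (Suc 0)" by (rule mi_decompose)
      then have "k = mdeg \<delta>" using Suc(2) by simp
      from Suc(1)[OF this] have "\<gamma> $ i * fact k \<le> \<gamma> $ i * (CARD('k) ^ k * mfact \<delta>)"
        using \<open>k = mdeg \<delta>\<close> by (intro mult_left_mono) auto
      also have "\<dots> = CARD('k) ^ k * mfact \<gamma>" unfolding d mfact_Suc by (simp add: axis_def algebra_simps)
      finally show ?thesis .
    qed simp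
  qed
  also have "\<dots> = CARD('k) ^ mdeg \<gamma> * mfact \<gamma>" by (simp flip: Suc(2))
  finally show ?case .
qed simp

text \<open>\<open>mderiv \<beta>\<close> is \<open>\<partial>\<^sup>\<beta>\<close> on coefficients; \<open>mintegral \<alpha>\<close> is the right inverse of
\<open>\<partial>\<^sup>\<alpha>\<close> whose values are divisible by \<open>z\<^sup>\<alpha>\<close>.\<close>

definition mderiv :: "nat ^ 'k \<Rightarrow> (nat ^ 'k \<Rightarrow> complex) \<Rightarrow> nat ^ 'k \<Rightarrow> complex" where
  "mderiv \<beta> c \<gamma> = of_nat (mfact (\<gamma> + \<beta>)) / of_nat (mfact \<gamma>) * c (\<gamma> + \<beta>)"
definition mintegral :: "nat ^ 'k \<Rightarrow> (nat ^ 'k \<Rightarrow> complex) \<Rightarrow> nat ^ 'k \<Rightarrow> complex" where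
  "mintegral \<alpha> v \<gamma> = (if \<alpha> \<le> \<gamma> then of_nat (mfact (\<gamma> - \<alpha>)) / of_nat (mfact \<gamma>) * v (\<gamma> - \<alpha>) else 0)"

lemma mderiv_0 [simp]: "mderiv 0 c = c" by (simp add: mderiv_def fun_eq_iff)

lemma mderiv_Suc: "mderiv (\<beta> + axis i (Suc 0)) c = dcoeff i (mderiv \<beta> c)"
proof
  fix \<gamma>
  have e: "\<gamma> + (\<beta> + axis i (Suc 0)) = \<gamma> + axis i (Suc 0) + \<beta>" by (simp add: vec_eq_iff)
  show "mderiv (\<beta> + axis i (Suc 0)) c \<gamma> = dcoeff i (mderiv \<beta> c) \<gamma>"
    unfolding dcoeff_def mderiv_def e One_nat_def mfact_Suc[of \<gamma>] by (simp del: of_nat_Suc mult_Suc)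
qed

lemma conv_mderiv: "conv \<rho> c \<Longrightarrow> conv \<rho> (mderiv \<beta> c)"
  by (induction \<beta> rule: mi_induct) (auto simp: mderiv_Suc conv_dcoeff)

lemma mderiv_mintegral: "mderiv \<beta> (mintegral \<alpha> v) \<gamma> = (if \<alpha> \<le> \<gamma> + \<beta> then of_nat (mfact (\<gamma> + \<beta> - \<alpha>)) / of_nat (mfact \<gamma>) * v (\<gamma> + \<beta> - \<alpha>) else 0)"
  by (simp add: mderiv_def mintegral_def)

lemma mderiv_mintegral_same [simp]: "mderiv \<alpha> (mintegral \<alpha> v) = v"
  by (simp add: mderiv_mintegral fun_eq_iff)

text \<open>The norm is \<open>sup |v\<^sub>\<gamma>| mweight \<gamma> rpow r \<gamma>\<close>. The factor \<open>\<gamma>! / |\<gamma>|!\<close> turns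
coefficients into derivatives at \<open>0\<close> divided by \<open>|\<gamma>|!\<close>; on these, \<open>\<partial>\<^sup>\<beta> \<partial>\<^sup>-\<^sup>\<alpha>\<close>
is a shift of the index, and does not increase the norm apart from the power \<open>r\<^sup>\<alpha>\<^sup>-\<^sup>\<beta>\<close> as long as
\<open>|\<beta>| \<le> |\<alpha>|\<close>. As the factor decreases in \<open>\<gamma>\<close>, multiplication by a series is bounded by its
absolute sum at the radii \<open>r\<close>.\<close>

definition rpow :: "('k \<Rightarrow> real) \<Rightarrow> nat ^ 'k \<Rightarrow> real" where "rpow r \<gamma> = (\<Prod>i\<in>UNIV. r i ^ (\<gamma> $ i))"
definition mweight :: "nat ^ 'k \<Rightarrow> real" where "mweight \<gamma> = real (mfact \<gamma>) / fact (mdeg \<gamma>)"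

lemma rpow_add: "rpow r (\<gamma> + \<delta>) = rpow r \<gamma> * rpow r \<delta>"
  by (simp add: rpow_def power_add prod.distrib)
lemma rpow_0 [simp]: "rpow r 0 = 1" by (simp add: rpow_def)
lemma rpow_pos: "(\<And>i. 0 < r i) \<Longrightarrow> 0 < rpow r \<gamma>" by (simp add: rpow_def prod_pos)
lemma mweight_pos [simp]: "0 < mweight \<gamma>" by (simp add: mweight_def)

lemma mweight_Suc: "mweight (\<eta> + axis i (Suc 0)) = mweight \<eta> * (real (Suc (\<eta> $ i)) / real (Suc (mdeg \<eta>)))"
  unfolding mweight_def mfact_Suc by (simp add: field_simps)

lemma mweight_add_le: "mweight (\<delta> + \<epsilon>) \<le> mweight \<delta>"
proof (induction \<epsilon> rule: mi_induct)
  case (add \<epsilon> i)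
  have "mweight (\<delta> + \<epsilon> + axis i (Suc 0)) = mweight (\<delta> + \<epsilon>) * (real (Suc ((\<delta> + \<epsilon>) $ i)) / real (Suc (mdeg (\<delta> + \<epsilon>))))"
    by (rule mweight_Suc)
  also have "\<dots> \<le> mweight (\<delta> + \<epsilon>) * 1"
    using component_le_mdeg[of "\<delta> + \<epsilon>" i] by (intro mult_left_mono) (auto simp: less_imp_le)
  finally show ?case using add by (simp add: add.assoc)
qed simp

lemma mweight_antimono: "\<delta> \<le> \<gamma> \<Longrightarrow> mweight \<gamma> \<le> mweight \<delta>"
  using mweight_add_le[of \<delta> "\<gamma> - \<delta>"] by simp

text \<open>A series of finite norm converges, since \<open>|\<gamma>|! / \<gamma>! \<le> n\<^sup>|\<^sup>\<gamma>\<^sup>|\<close> and there are at most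
\<open>n\<^sup>k\<close> multi-indices of degree \<open>k\<close>.\<close>

lemma conv_weight_bound:
  fixes v :: "nat ^ 'k \<Rightarrow> complex"
  assumes b: "\<And>\<gamma>. norm (v \<gamma>) * mweight \<gamma> * rpow r \<gamma> \<le> M" and r: "\<And>i. x \<le> r i" and x: "0 < x"
  obtains \<rho> where "0 < \<rho>" "conv \<rho> v"
proof -
  define n where "n = real (CARD('k))"
  have n: "n \<ge> 1" by (simp add: n_def Suc_leI)
  have r0: "0 < r i" for i using r[of i] x by linarith
  have M: "0 \<le> M" using b[of 0] order_trans[OF _ b[of 0]] by (simp add: mweight_def)
  have v: "norm (v \<gamma>) \<le> M * (n / x) ^ mdeg \<gamma>" for \<gamma>
  proof -
    have "x ^ mdeg \<gamma> \<le> rpow r \<gamma>" unfolding rpow_def mdeg_def power_sum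
      using r x by (intro prod_mono) (auto intro: power_mono)
    moreover have "1 / n ^ mdeg \<gamma> \<le> mweight \<gamma>"
    proof -
      have "real (fact (mdeg \<gamma>)) \<le> real (CARD('k) ^ mdeg \<gamma> * mfact \<gamma>)"
        by (rule of_nat_mono[OF fact_mdeg_le])
      then show ?thesis using n by (simp add: mweight_def n_def field_simps)
    qed
    ultimately have "norm (v \<gamma>) * (1 / n ^ mdeg \<gamma>) * x ^ mdeg \<gamma> \<le> norm (v \<gamma>) * mweight \<gamma> * rpow r \<gamma>"
      using x n mweight_pos[of \<gamma>] by (intro mult_mono mult_nonneg_nonneg) (auto simp: less_imp_le)
    also have "\<dots> \<le> M" by (rule b)
    finally show ?thesis using n x by (simp add: power_divide field_simps)
  qed
  define \<rho> where "\<rho> = x / (n * n)"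
  have \<rho>: "0 < \<rho>" using x n by (simp add: \<rho>_def)
  have cs: "coeff_size v k \<le> M * (1 / \<rho>) ^ k" for k
  proof -
    have "coeff_size v k \<le> (\<Sum>\<gamma> :: nat ^ 'k | mdeg \<gamma> = k. M * (n / x) ^ k)"
      unfolding coeff_size_def using v by (intro sum_mono) auto
    also have "\<dots> \<le> n ^ k * (M * (n / x) ^ k)"
    proof -
      have "real (card {\<gamma> :: nat ^ 'k. mdeg \<gamma> = k}) \<le> real (CARD('k) ^ k)"
        by (rule of_nat_mono[OF card_mdeg_le])
      then show ?thesis using M x n by (simp add: n_def mult_right_mono)
    qed
    also have "\<dots> = M * (1 / \<rho>) ^ k"
      by (simp add: \<rho>_def power_divide power_mult_distrib)
    finally show ?thesis .
  qed
  have "conv \<rho> v" by (rule conv_geometric[OF \<rho> cs])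
  then show ?thesis using that \<rho> by blast
qed

lemma conv_mintegral: assumes "conv \<rho> v" shows "conv \<rho> (mintegral \<alpha> v)"
  unfolding conv_def
proof (intro allI impI)
  fix r :: real assume r: "0 < r \<and> r < \<rho>"
  have cs: "coeff_size (mintegral \<alpha> v) (k + mdeg \<alpha>) \<le> coeff_size v k" for k
  proof -
    have "coeff_size (mintegral \<alpha> v) (k + mdeg \<alpha>) = (\<Sum>\<gamma> | mdeg \<gamma> = k + mdeg \<alpha> \<and> \<alpha> \<le> \<gamma>. norm (mintegral \<alpha> v \<gamma>))"
      unfolding coeff_size_def by (rule sum.mono_neutral_right) (auto simp: mintegral_def)
    also have "\<dots> = (\<Sum>\<gamma> | mdeg \<gamma> = k. norm (mintegral \<alpha> v (\<gamma> + \<alpha>)))"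
    proof (rule sum.reindex_bij_witness[where i = "\<lambda>\<gamma>. \<gamma> + \<alpha>" and j = "\<lambda>\<gamma>. \<gamma> - \<alpha>"])
      fix \<gamma> assume "\<gamma> \<in> {\<gamma>. mdeg \<gamma> = k + mdeg \<alpha> \<and> \<alpha> \<le> \<gamma>}"
      then have m: "mdeg \<gamma> = k + mdeg \<alpha>" and g: "\<gamma> - \<alpha> + \<alpha> = \<gamma>" by auto
      show "\<gamma> - \<alpha> + \<alpha> = \<gamma>" "norm (mintegral \<alpha> v (\<gamma> - \<alpha> + \<alpha>)) = norm (mintegral \<alpha> v \<gamma>)" using g by auto
      show "\<gamma> - \<alpha> \<in> {\<gamma>. mdeg \<gamma> = k}" using arg_cong[OF g, of mdeg] m by simp
    qed auto
    also have "\<dots> \<le> (\<Sum>\<gamma> | mdeg \<gamma> = k. norm (v \<gamma>))"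
    proof (rule sum_mono)
      fix \<gamma>
      have "real (mfact \<gamma>) / real (mfact (\<gamma> + \<alpha>)) \<le> 1" using mfact_add_le[of \<gamma> \<alpha>] by simp
      then have "real (mfact \<gamma>) / real (mfact (\<gamma> + \<alpha>)) * norm (v \<gamma>) \<le> 1 * norm (v \<gamma>)"
        by (intro mult_right_mono) auto
      then show "norm (mintegral \<alpha> v (\<gamma> + \<alpha>)) \<le> norm (v \<gamma>)"
        by (simp add: mintegral_def norm_mult norm_divide)
    qed
    finally show ?thesis by (simp add: coeff_size_def)
  qed
  have "summable (\<lambda>k. coeff_size v k * r ^ k * r ^ mdeg \<alpha>)"
    using assms r unfolding conv_def by (intro summable_mult2) auto
  then have "summable (\<lambda>k. coeff_size (mintegral \<alpha> v) (k + mdeg \<alpha>) * r ^ (k + mdeg \<alpha>))"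
  proof (rule summable_comparison_test')
    fix k
    show "norm (coeff_size (mintegral \<alpha> v) (k + mdeg \<alpha>) * r ^ (k + mdeg \<alpha>)) \<le> coeff_size v k * r ^ k * r ^ mdeg \<alpha>"
      using r cs[of k] by (simp add: abs_mult power_add mult.assoc mult_right_mono)
  qed
  then show "summable (\<lambda>k. coeff_size (mintegral \<alpha> v) k * r ^ k)" by (subst (asm) summable_iff_shift)
qed

lemma goursat_step:
  fixes v :: "nat ^ 'k \<Rightarrow> complex"
  assumes r: "\<And>i. 0 < r i" and deg: "\<And>\<beta>. \<beta> \<in> B \<Longrightarrow> mdeg \<beta> \<le> mdeg \<alpha>"
    and nb: "\<And>\<beta> X. \<beta> \<in> B \<Longrightarrow> finite X \<Longrightarrow> (\<Sum>\<delta>\<in>X. norm (b \<beta> \<delta>) * rpow r \<delta>) \<le> nb \<beta>"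
    and q: "(\<Sum>\<beta>\<in>B. nb \<beta> * (rpow r \<alpha> / rpow r \<beta>)) \<le> q"
    and v: "\<And>\<gamma>. norm (v \<gamma>) * mweight \<gamma> * rpow r \<gamma> \<le> N"
  shows "norm (\<Sum>\<beta>\<in>B. conv_prod (b \<beta>) (mderiv \<beta> (mintegral \<alpha> v)) \<gamma>) * mweight \<gamma> * rpow r \<gamma> \<le> q * N"
proof -
  have rpp: "0 < rpow r \<delta>" for \<delta> using r by (rule rpow_pos)
  have N: "0 \<le> N" using order_trans[OF _ v[of 0]] by (simp add: mweight_def)
  have shift: "norm (mderiv \<beta> (mintegral \<alpha> v) \<gamma>) * mweight \<gamma> * rpow r \<gamma> \<le> N * (rpow r \<alpha> / rpow r \<beta>)" if "\<beta> \<in> B" for \<beta> \<gamma>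
  proof (cases "\<alpha> \<le> \<gamma> + \<beta>")
    case True
    define \<delta> where "\<delta> = \<gamma> + \<beta> - \<alpha>"
    have d: "\<delta> + \<alpha> = \<gamma> + \<beta>" using True by (simp add: \<delta>_def)
    have "mdeg \<delta> \<le> mdeg \<gamma>" using arg_cong[OF d, of mdeg] deg[OF that] by simp
    then have f: "fact (mdeg \<delta>) \<le> (fact (mdeg \<gamma>) :: real)" by (rule fact_mono)
    have rr: "rpow r \<gamma> = rpow r \<delta> * (rpow r \<alpha> / rpow r \<beta>)"
      using arg_cong[OF d, of "rpow r"] rpp[of \<beta>] by (simp add: rpow_add field_simps)
    have "norm (mderiv \<beta> (mintegral \<alpha> v) \<gamma>) * mweight \<gamma> * rpow r \<gamma> = norm (v \<delta>) * (real (mfact \<delta>) / fact (mdeg \<gamma>)) * rpow r \<gamma>"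
      using True by (simp add: mderiv_mintegral \<delta>_def norm_mult norm_divide mweight_def)
    also have "\<dots> \<le> norm (v \<delta>) * mweight \<delta> * rpow r \<gamma>"
      using f rpp[of \<gamma>] unfolding mweight_def
      by (intro mult_right_mono mult_left_mono divide_left_mono) auto
    also have "\<dots> = (norm (v \<delta>) * mweight \<delta> * rpow r \<delta>) * (rpow r \<alpha> / rpow r \<beta>)" by (simp add: rr)
    also have "\<dots> \<le> N * (rpow r \<alpha> / rpow r \<beta>)"
      using v[of \<delta>] rpp[of \<alpha>] rpp[of \<beta>] by (intro mult_right_mono) auto
    finally show ?thesis .
  next
    case False
    then show ?thesis using N rpp[of \<alpha>] rpp[of \<beta>] by (simp add: mderiv_mintegral)
  qed
  have mul: "norm (conv_prod (b \<beta>) (mderiv \<beta> (mintegral \<alpha> v)) \<gamma>) * mweight \<gamma> * rpow r \<gamma> \<le> nb \<beta> * (rpow r \<alpha> / rpow r \<beta>) * N" if B: "\<beta> \<in> B" for \<beta>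
  proof -
    define u where "u = mderiv \<beta> (mintegral \<alpha> v)"
    have "norm (conv_prod (b \<beta>) u \<gamma>) * mweight \<gamma> * rpow r \<gamma> \<le> (\<Sum>\<delta> | \<delta> \<le> \<gamma>. norm (b \<beta> \<delta>) * norm (u (\<gamma> - \<delta>))) * mweight \<gamma> * rpow r \<gamma>"
      unfolding conv_prod_def using rpp[of \<gamma>]
      by (intro mult_right_mono order_trans[OF norm_sum]) (auto simp: norm_mult less_imp_le)
    also have "\<dots> = (\<Sum>\<delta> | \<delta> \<le> \<gamma>. norm (b \<beta> \<delta>) * (norm (u (\<gamma> - \<delta>)) * mweight \<gamma> * rpow r \<gamma>))"
      by (simp add: sum_distrib_right mult.assoc)
    also have "\<dots> \<le> (\<Sum>\<delta> | \<delta> \<le> \<gamma>. norm (b \<beta> \<delta>) * (rpow r \<delta> * (N * (rpow r \<alpha> / rpow r \<beta>))))"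
    proof (intro sum_mono mult_left_mono norm_ge_zero)
      fix \<delta> assume "\<delta> \<in> {\<delta>. \<delta> \<le> \<gamma>}"
      then have d: "\<delta> \<le> \<gamma>" by simp
      have "mweight \<gamma> \<le> mweight (\<gamma> - \<delta>)" by (rule mweight_antimono) (auto simp: less_eq_vec_def)
      then have "norm (u (\<gamma> - \<delta>)) * mweight \<gamma> * rpow r \<gamma> \<le> norm (u (\<gamma> - \<delta>)) * mweight (\<gamma> - \<delta>) * rpow r \<gamma>"
        using rpp[of \<gamma>] by (intro mult_right_mono mult_left_mono) auto
      also have "rpow r \<gamma> = rpow r (\<gamma> - \<delta>) * rpow r \<delta>" using rpow_add[of r "\<gamma> - \<delta>" \<delta>] d by simp
      also have "norm (u (\<gamma> - \<delta>)) * mweight (\<gamma> - \<delta>) * (rpow r (\<gamma> - \<delta>) * rpow r \<delta>) = rpow r \<delta> * (norm (u (\<gamma> - \<delta>)) * mweight (\<gamma> - \<delta>) * rpow r (\<gamma> - \<delta>))"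
        by (simp add: mult_ac)
      also have "\<dots> \<le> rpow r \<delta> * (N * (rpow r \<alpha> / rpow r \<beta>))"
        using shift[OF B] rpp[of \<delta>] unfolding u_def by (intro mult_left_mono) auto
      finally show "norm (u (\<gamma> - \<delta>)) * mweight \<gamma> * rpow r \<gamma> \<le> rpow r \<delta> * (N * (rpow r \<alpha> / rpow r \<beta>))"
        using rpow_add[of r "\<gamma> - \<delta>" \<delta>] d by simp
    qed
    also have "\<dots> = (\<Sum>\<delta> | \<delta> \<le> \<gamma>. norm (b \<beta> \<delta>) * rpow r \<delta>) * (N * (rpow r \<alpha> / rpow r \<beta>))"
      by (simp only: sum_distrib_right mult.assoc)
    also have "\<dots> \<le> nb \<beta> * (N * (rpow r \<alpha> / rpow r \<beta>))"
      using nb[OF B finite_mle] N rpp[of \<alpha>] rpp[of \<beta>] by (intro mult_right_mono) auto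
    finally show ?thesis by (simp add: u_def mult_ac)
  qed
  have "norm (\<Sum>\<beta>\<in>B. conv_prod (b \<beta>) (mderiv \<beta> (mintegral \<alpha> v)) \<gamma>) * mweight \<gamma> * rpow r \<gamma> \<le> (\<Sum>\<beta>\<in>B. norm (conv_prod (b \<beta>) (mderiv \<beta> (mintegral \<alpha> v)) \<gamma>)) * mweight \<gamma> * rpow r \<gamma>"
    using rpp[of \<gamma>] by (intro mult_right_mono norm_sum) (auto simp: less_imp_le)
  also have "\<dots> \<le> (\<Sum>\<beta>\<in>B. nb \<beta> * (rpow r \<alpha> / rpow r \<beta>) * N)"
    unfolding sum_distrib_right by (rule sum_mono) (rule mul)
  also have "\<dots> \<le> q * N" unfolding sum_distrib_right[symmetric] using q N by (rule mult_right_mono)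
  finally show ?thesis .
qed

text \<open>The Neumann series of \<open>v \<mapsto> \<Sum>\<^sub>\<beta> b\<^sub>\<beta> \<partial>\<^sup>\<beta> \<partial>\<^sup>-\<^sup>\<alpha> v\<close>, whose norm is at most \<open>q < 1\<close> by
\<open>goursat_step\<close>. Every coefficient of the image is a finite combination of coefficients of \<open>v\<close>, so the
equation passes to the coefficientwise limit.\<close>

lemma goursat_formal:
  fixes g :: "nat ^ 'k \<Rightarrow> complex"
  assumes r: "\<And>i. 0 < r i" and deg: "\<And>\<beta>. \<beta> \<in> B \<Longrightarrow> mdeg \<beta> \<le> mdeg \<alpha>"
    and nb: "\<And>\<beta> X. \<beta> \<in> B \<Longrightarrow> finite X \<Longrightarrow> (\<Sum>\<delta>\<in>X. norm (b \<beta> \<delta>) * rpow r \<delta>) \<le> nb \<beta>"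
    and q: "(\<Sum>\<beta>\<in>B. nb \<beta> * (rpow r \<alpha> / rpow r \<beta>)) \<le> q" "q < 1" "0 \<le> q"
    and g: "\<And>\<gamma>. norm (g \<gamma>) * mweight \<gamma> * rpow r \<gamma> \<le> M"
  obtains v where "\<And>\<gamma>. norm (v \<gamma>) * mweight \<gamma> * rpow r \<gamma> \<le> M / (1 - q)"
    "\<And>\<gamma>. v \<gamma> = g \<gamma> + (\<Sum>\<beta>\<in>B. conv_prod (b \<beta>) (mderiv \<beta> (mintegral \<alpha> v)) \<gamma>)"
proof -
  define T where "T = (\<lambda>v \<gamma>. \<Sum>\<beta>\<in>B. conv_prod (b \<beta>) (mderiv \<beta> (mintegral \<alpha> v)) \<gamma>)"
  define V where "V = (\<lambda>j. (T ^^ j) g)"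
  have rpp: "0 < rpow r \<delta>" for \<delta> using r by (rule rpow_pos)
  have V: "norm (V j \<gamma>) * mweight \<gamma> * rpow r \<gamma> \<le> q ^ j * M" for j \<gamma>
  proof (induction j arbitrary: \<gamma>)
    case (Suc j)
    have "norm (T (V j) \<gamma>) * mweight \<gamma> * rpow r \<gamma> \<le> q * (q ^ j * M)"
      unfolding T_def by (rule goursat_step[OF r deg nb q(1) Suc])
    then show ?case by (simp add: V_def mult.assoc)
  qed (simp add: V_def g)
  have Vb: "norm (V j \<gamma>) \<le> M / (mweight \<gamma> * rpow r \<gamma>) * q ^ j" for j \<gamma>
    using V[of j \<gamma>] rpp[of \<gamma>] mweight_pos[of \<gamma>] by (simp add: field_simps)
  have geo: "summable (\<lambda>j. x * q ^ j)" "(\<Sum>j. x * q ^ j) = x / (1 - q)" for x :: real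
    using q by (auto simp: suminf_mult suminf_geometric summable_geometric intro!: summable_mult)
  have sn: "summable (\<lambda>j. norm (V j \<gamma>))" for \<gamma>
    by (rule summable_comparison_test'[OF geo(1)[of "M / (mweight \<gamma> * rpow r \<gamma>)"]]) (simp only: real_norm_def abs_norm_cancel Vb)
  define v where "v = (\<lambda>\<gamma>. \<Sum>j. V j \<gamma>)"
  have sv: "(\<lambda>j. V j \<gamma>) sums v \<gamma>" for \<gamma>
    unfolding v_def by (rule summable_sums[OF summable_norm_cancel[OF sn]])
  have nv: "norm (v \<gamma>) * mweight \<gamma> * rpow r \<gamma> \<le> M / (1 - q)" for \<gamma>
  proof -
    have "norm (v \<gamma>) \<le> (\<Sum>j. norm (V j \<gamma>))" unfolding v_def by (rule summable_norm[OF sn])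
    also have "\<dots> \<le> (\<Sum>j. M / (mweight \<gamma> * rpow r \<gamma>) * q ^ j)" by (rule suminf_le[OF Vb sn geo(1)])
    also have "\<dots> = M / (mweight \<gamma> * rpow r \<gamma>) / (1 - q)" by (rule geo(2))
    finally show ?thesis using rpp[of \<gamma>] mweight_pos[of \<gamma>] q by (simp add: field_simps)
  qed
  have "(\<lambda>j. T (V j) \<gamma>) sums T v \<gamma>" for \<gamma>
  proof -
    have "(\<lambda>j. mderiv \<beta> (mintegral \<alpha> (V j)) \<delta>) sums mderiv \<beta> (mintegral \<alpha> v) \<delta>" for \<beta> \<delta>
      unfolding mderiv_mintegral by (cases "\<alpha> \<le> \<delta> + \<beta>"; simp only: if_True if_False; intro sums_mult sv sums_zero)
    then show ?thesis unfolding T_def conv_prod_def by (intro sums_sum sums_mult)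
  qed
  moreover have "(\<lambda>j. T (V j) \<gamma>) sums (v \<gamma> - g \<gamma>)" for \<gamma>
    using sv[of \<gamma>] sums_Suc_iff[of "\<lambda>j. V j \<gamma>" "v \<gamma> - g \<gamma>"] by (simp add: V_def)
  ultimately have "v \<gamma> - g \<gamma> = T v \<gamma>" for \<gamma> using sums_unique2 by blast
  then have "v \<gamma> = g \<gamma> + T v \<gamma>" for \<gamma> by (metis add.commute diff_add_cancel)
  then show ?thesis using that nv unfolding T_def by blast
qed


section \<open>The operator in one more variable\<close>

text \<open>Points \<open>(s, z)\<close> are indexed by the option type, with \<open>None\<close> for \<open>s\<close>.\<close>

lemma sum_option: "(\<Sum>j\<in>UNIV. T (j :: 'n::finite option)) = T None + (\<Sum>i\<in>UNIV. T (Some i))"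
  unfolding UNIV_option_conv by (subst sum.insert) (auto simp: sum.reindex)

definition graph_pt :: "(complex ^ 'n \<Rightarrow> complex) \<Rightarrow> complex ^ 'n \<Rightarrow> complex ^ 'n option" where
  "graph_pt f z = (\<chi> j. case j of None \<Rightarrow> f z | Some i \<Rightarrow> z $ i)"

lemma graph_pt_None [simp]: "graph_pt f z $ None = f z" and graph_pt_Some [simp]: "graph_pt f z $ Some i = z $ i"
  by (simp_all add: graph_pt_def)

lemma graph_pt_in_polydisc: "graph_pt f z \<in> polydisc \<rho> \<longleftrightarrow> norm (f z) < \<rho> \<and> z \<in> polydisc \<rho>"
  by (auto simp: polydisc_def split_option_all)

lemma cderiv_series_graph_pt:
  fixes f :: "complex ^ 'n \<Rightarrow> complex"
  assumes c: "conv \<rho> c" and z: "graph_pt f z \<in> polydisc \<rho>" and f: "cderiv f z d"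
  shows "cderiv (\<lambda>z. series c (graph_pt f z)) z
    (\<chi> i. series (dcoeff (Some i) c) (graph_pt f z) + d $ i * series (dcoeff None c) (graph_pt f z))"
proof -
  have "cderiv (\<lambda>z. graph_pt f z $ j) z (case j of None \<Rightarrow> d | Some i \<Rightarrow> axis i 1)" for j
    by (cases j) (simp_all add: f cderiv_coord)
  from cderiv_prod_sum[OF cderiv_series[OF c z] this]
  have "cderiv (\<lambda>z. series c (graph_pt f z)) z (\<Sum>j\<in>UNIV. series (dcoeff j c) (graph_pt f z) *s (case j of None \<Rightarrow> d | Some i \<Rightarrow> axis i 1))"
    by simp
  moreover have "(\<Sum>j\<in>UNIV. series (dcoeff j c) (graph_pt f z) *s (case j of None \<Rightarrow> d | Some i \<Rightarrow> axis i 1))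
     = (\<chi> i. series (dcoeff (Some i) c) (graph_pt f z) + d $ i * series (dcoeff None c) (graph_pt f z))"
    by (simp add: sum_option vec_eq_iff axis_def if_distrib mult.commute cong: if_cong)
  ultimately show ?thesis by simp
qed

text \<open>A series in \<open>z\<close>, viewed as a series in \<open>(s, z)\<close> that does not contain \<open>s\<close>.\<close>

definition lift_coeff :: "(nat ^ 'n \<Rightarrow> complex) \<Rightarrow> nat ^ 'n option \<Rightarrow> complex" where
  "lift_coeff c \<gamma> = (if \<gamma> $ None = 0 then c (\<chi> i. \<gamma> $ Some i) else 0)"

lemma sum_None_zero:
  fixes T :: "nat ^ ('n::finite) option \<Rightarrow> 'a::comm_monoid_add"
  shows "(\<Sum>\<gamma> | mdeg \<gamma> = k \<and> \<gamma> $ None = 0. T \<gamma>) = (\<Sum>\<gamma> | mdeg \<gamma> = k. T (\<chi> j. case j of None \<Rightarrow> 0 | Some i \<Rightarrow> \<gamma> $ i))"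
  by (rule sum.reindex_bij_witness[where i = "\<lambda>\<gamma>. \<chi> j. case j of None \<Rightarrow> 0 | Some i \<Rightarrow> \<gamma> $ i" and j = "\<lambda>\<gamma>. \<chi> i. \<gamma> $ Some i"])
     (auto simp: mdeg_def sum_option vec_eq_iff split: option.splits intro: arg_cong[of _ _ T])

lemma homog_lift_coeff: "homog (lift_coeff c) k y = homog c k (\<chi> i. y $ Some i)"
proof -
  have "homog (lift_coeff c) k y = (\<Sum>\<gamma> | mdeg \<gamma> = k \<and> \<gamma> $ None = 0. lift_coeff c \<gamma> * mpower y \<gamma>)"
    unfolding homog_def by (rule sum.mono_neutral_right) (auto simp: lift_coeff_def)
  also have "\<dots> = homog c k (\<chi> i. y $ Some i)"
    unfolding sum_None_zero homog_def
    by (intro sum.cong refl) (simp add: lift_coeff_def mpower_def UNIV_option_conv prod.reindex)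
  finally show ?thesis .
qed

lemma coeff_size_lift_coeff: "coeff_size (lift_coeff c) k = coeff_size c k"
proof -
  have "coeff_size (lift_coeff c) k = (\<Sum>\<gamma> | mdeg \<gamma> = k \<and> \<gamma> $ None = 0. norm (lift_coeff c \<gamma>))"
    unfolding coeff_size_def by (rule sum.mono_neutral_right) (auto simp: lift_coeff_def)
  also have "\<dots> = coeff_size c k" unfolding sum_None_zero coeff_size_def by (simp add: lift_coeff_def)
  finally show ?thesis .
qed

lemma conv_lift_coeff: "conv \<rho> c \<Longrightarrow> conv \<rho> (lift_coeff c)"
  by (simp add: conv_def coeff_size_lift_coeff)

lemma series_lift_coeff: "series (lift_coeff c) (graph_pt f z) = series c z"
  by (simp add: series_def homog_lift_coeff)


text \<open>The coefficient of \<open>\<partial>\<^sup>\<beta>\<close> in the product of the operators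
\<open>\<partial>/\<partial>z\<^sub>i + (\<partial>f/\<partial>z\<^sub>i) \<partial>/\<partial>s\<close> over the letters of the word.\<close>

primrec chain_coeff :: "(complex ^ 'n \<Rightarrow> complex) \<Rightarrow> 'n list \<Rightarrow> nat ^ 'n option \<Rightarrow> complex ^ 'n \<Rightarrow> complex" where
  "chain_coeff f [] \<beta> = (\<lambda>z. if \<beta> = 0 then 1 else 0)"
| "chain_coeff f (i # w) \<beta> = (\<lambda>z. pd i (chain_coeff f w \<beta>) z
      + (if 0 < \<beta> $ Some i then chain_coeff f w (\<beta> - axis (Some i) 1) z else 0)
      + (if 0 < \<beta> $ None then pd i f z * chain_coeff f w (\<beta> - axis None 1) z else 0))"

lemma pd_const [simp]: "pd i (\<lambda>z. c) z = 0"
  using pd_eqI[OF cderiv_const] by simp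

lemma chain_coeff_holo_on: assumes f: "holo_on f U" "open U" shows "holo_on (chain_coeff f w \<beta>) U"
proof (induction w arbitrary: \<beta>)
  case (Cons i w)
  have 1: "holo_on (\<lambda>z. if 0 < \<beta> $ Some i then chain_coeff f w (\<beta> - axis (Some i) 1) z else 0) U"
    by (cases "0 < \<beta> $ Some i") (auto simp: Cons holo_on_const)
  have 2: "holo_on (\<lambda>z. if 0 < \<beta> $ None then pd i f z * chain_coeff f w (\<beta> - axis None 1) z else 0) U"
    by (cases "0 < \<beta> $ None") (auto simp: Cons holo_on_const intro!: holo_on_mult pd_holo_on f)
  show ?case unfolding chain_coeff.simps by (intro holo_on_add pd_holo_on Cons f 1 2)
qed (simp add: holo_on_const)

lemma mdeg_diff_axis: "0 < \<beta> $ j \<Longrightarrow> mdeg (\<beta> - axis j (Suc 0)) = mdeg \<beta> - 1"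
  by (erule mi_decompose) simp

lemma chain_coeff_zero: "length w < mdeg \<beta> \<Longrightarrow> chain_coeff f w \<beta> = (\<lambda>z. 0)"
proof (induction w arbitrary: \<beta>)
  case (Cons i w)
  then have "chain_coeff f w \<beta> = (\<lambda>z. 0)" by simp
  moreover have "chain_coeff f w (\<beta> - axis j 1) = (\<lambda>z. 0)" if "0 < \<beta> $ j" for j
    using Cons mdeg_diff_axis[OF that] by (intro Cons.IH) simp
  ultimately show ?case by (simp cong: if_cong del: One_nat_def)
qed auto

text \<open>The functions \<open>K \<beta>\<close> are specified by how they are differentiated into each other, in order to cover both
\<open>K \<beta> = (\<partial>\<^sup>\<beta> g)(f(z), z)\<close> and the logarithmic functions of \<open>log_family\<close>.\<close>

lemma chain_rule:
  fixes f :: "complex ^ 'n \<Rightarrow> complex"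
  assumes f: "holo_on f W" "open W"
    and K: "\<And>\<beta> z. mdeg \<beta> < m \<Longrightarrow> z \<in> W \<Longrightarrow>
       cderiv (K \<beta>) z (\<chi> i. K (\<beta> + axis (Some i) 1) z + pd i f z * K (\<beta> + axis None 1) z)"
  shows "length w \<le> m \<Longrightarrow> z \<in> W \<Longrightarrow>
    pdw w (K 0) z = (\<Sum>\<beta> | mdeg \<beta> \<le> length w. chain_coeff f w \<beta> z * K \<beta> z)"
proof (induction w arbitrary: z)
  case Nil
  have "{\<beta> :: nat ^ 'n option. mdeg \<beta> \<le> 0} = {0}" by auto
  then show ?case by simp
next
  case (Cons i w)
  let ?S = "{\<beta> :: nat ^ 'n option. mdeg \<beta> \<le> length w}"
  let ?S' = "{\<beta> :: nat ^ 'n option. mdeg \<beta> \<le> Suc (length w)}"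
  have fin: "finite ?S" "finite ?S'" by (rule finite_mdeg_le)+
  have shift: "(\<Sum>\<beta>\<in>?S. h \<beta> * K (\<beta> + axis j 1) z) =
      (\<Sum>\<beta>\<in>?S'. (if 0 < \<beta> $ j then h (\<beta> - axis j 1) else 0) * K \<beta> z)" for h j
  proof -
    have "(\<Sum>\<beta>\<in>?S'. (if 0 < \<beta> $ j then h (\<beta> - axis j 1) else 0) * K \<beta> z) =
        (\<Sum>\<beta> | mdeg \<beta> \<le> Suc (length w) \<and> 0 < \<beta> $ j. h (\<beta> - axis j 1) * K \<beta> z)"
      by (rule sum.mono_neutral_cong_right) (use fin in auto)
    then show ?thesis by (simp add: sum_shift_axis_degree[where P = "\<lambda>n. n \<le> Suc (length w)"])
  qed
  have "pdw (i # w) (K 0) z = pd i (\<lambda>z. \<Sum>\<beta>\<in>?S. chain_coeff f w \<beta> z * K \<beta> z) z"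
    using pd_cong_open[OF f(2) Cons.prems(2), of "pdw w (K 0)" _ i] Cons by simp
  also have "\<dots> = (\<Sum>\<beta>\<in>?S. chain_coeff f w \<beta> z * (K (\<beta> + axis (Some i) 1) z + pd i f z * K (\<beta> + axis None 1) z) + K \<beta> z * pd i (chain_coeff f w \<beta>) z)"
  proof -
    have "cderiv (\<lambda>z. \<Sum>\<beta>\<in>?S. chain_coeff f w \<beta> z * K \<beta> z) z (\<Sum>\<beta>\<in>?S.
      chain_coeff f w \<beta> z *s (\<chi> i. K (\<beta> + axis (Some i) 1) z + pd i f z * K (\<beta> + axis None 1) z) + K \<beta> z *s (\<chi> i. pd i (chain_coeff f w \<beta>) z))"
      by (intro cderiv_sum cderiv_mult cderiv_pd[OF chain_coeff_holo_on[OF f]] K) (use Cons.prems in auto)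
    from pd_eqI[OF this, of i] show ?thesis by simp
  qed
  also have "\<dots> = (\<Sum>\<beta>\<in>?S. pd i (chain_coeff f w \<beta>) z * K \<beta> z) + (\<Sum>\<beta>\<in>?S. chain_coeff f w \<beta> z * K (\<beta> + axis (Some i) 1) z)
     + (\<Sum>\<beta>\<in>?S. pd i f z * chain_coeff f w \<beta> z * K (\<beta> + axis None 1) z)"
    by (simp add: sum.distrib[symmetric] algebra_simps)
  also have "(\<Sum>\<beta>\<in>?S. pd i (chain_coeff f w \<beta>) z * K \<beta> z) = (\<Sum>\<beta>\<in>?S'. pd i (chain_coeff f w \<beta>) z * K \<beta> z)"
    by (rule sum.mono_neutral_left) (use fin chain_coeff_zero[of w] in \<open>auto\<close>)
  also have "(\<Sum>\<beta>\<in>?S. chain_coeff f w \<beta> z * K (\<beta> + axis (Some i) 1) z)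
     = (\<Sum>\<beta>\<in>?S'. (if 0 < \<beta> $ Some i then chain_coeff f w (\<beta> - axis (Some i) 1) z else 0) * K \<beta> z)"
    by (rule shift)
  also have "(\<Sum>\<beta>\<in>?S. pd i f z * chain_coeff f w \<beta> z * K (\<beta> + axis None 1) z)
     = (\<Sum>\<beta>\<in>?S'. (if 0 < \<beta> $ None then pd i f z * chain_coeff f w (\<beta> - axis None 1) z else 0) * K \<beta> z)"
    by (rule shift)
  finally show ?case by (simp add: sum.distrib[symmetric] distrib_right)
qed

text \<open>The coefficient \<open>p\<^sub>\<beta>\<close> of \<open>\<partial>\<^sup>\<beta>\<close> in \<open>P'\<close>.\<close>

definition op_coeff :: "nat \<Rightarrow> (nat ^ 'n \<Rightarrow> complex ^ 'n \<Rightarrow> complex) \<Rightarrow> (complex ^ 'n \<Rightarrow> complex) \<Rightarrow>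
    nat ^ 'n option \<Rightarrow> complex ^ 'n \<Rightarrow> complex" where
  "op_coeff m a f \<beta> z = (\<Sum>\<alpha> | mdeg \<alpha> \<le> m. a \<alpha> z * chain_coeff f (word \<alpha>) \<beta> z)"

lemma op_coeff_holo_on:
  assumes "holo_on f U" "open U" "\<And>\<alpha>. mdeg \<alpha> \<le> m \<Longrightarrow> holo_on (a \<alpha>) U" shows "holo_on (op_coeff m a f \<beta>) U"
  unfolding op_coeff_def[abs_def] by (intro holo_on_sum holo_on_mult chain_coeff_holo_on) (use assms in auto)

lemma diff_op_chain:
  fixes f :: "complex ^ 'n \<Rightarrow> complex"
  assumes f: "holo_on f W" "open W"
    and K: "\<And>\<beta> z. mdeg \<beta> < m \<Longrightarrow> z \<in> W \<Longrightarrow>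
       cderiv (K \<beta>) z (\<chi> i. K (\<beta> + axis (Some i) 1) z + pd i f z * K (\<beta> + axis None 1) z)"
    and z: "z \<in> W"
  shows "diff_op m a (K 0) z = (\<Sum>\<beta> | mdeg \<beta> \<le> m. op_coeff m a f \<beta> z * K \<beta> z)"
proof -
  have "mpd \<alpha> (K 0) z = (\<Sum>\<beta> | mdeg \<beta> \<le> m. chain_coeff f (word \<alpha>) \<beta> z * K \<beta> z)" if "mdeg \<alpha> \<le> m" for \<alpha>
  proof -
    have "mpd \<alpha> (K 0) z = (\<Sum>\<beta> | mdeg \<beta> \<le> mdeg \<alpha>. chain_coeff f (word \<alpha>) \<beta> z * K \<beta> z)"
      using chain_rule[OF f K, of m "word \<alpha>" z] that z by (simp add: mpd_eq_pdw)
    also have "\<dots> = (\<Sum>\<beta> | mdeg \<beta> \<le> m. chain_coeff f (word \<alpha>) \<beta> z * K \<beta> z)"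
      by (rule sum.mono_neutral_left) (use that chain_coeff_zero[of "word \<alpha>"] in \<open>auto simp: finite_mdeg_le\<close>)
    finally show ?thesis .
  qed
  then have "diff_op m a (K 0) z = (\<Sum>\<alpha> | mdeg \<alpha> \<le> m. \<Sum>\<beta> | mdeg \<beta> \<le> m. a \<alpha> z * chain_coeff f (word \<alpha>) \<beta> z * K \<beta> z)"
    unfolding diff_op_def by (intro sum.cong refl) (simp add: sum_distrib_left mult.assoc)
  also have "\<dots> = (\<Sum>\<beta> | mdeg \<beta> \<le> m. op_coeff m a f \<beta> z * K \<beta> z)"
    unfolding op_coeff_def sum_distrib_right by (rule sum.swap)
  finally show ?thesis .
qed

lemma diff_op_cong_open:
  assumes "open W" "z \<in> W" "\<And>z. z \<in> W \<Longrightarrow> u z = v z" shows "diff_op m a u z = diff_op m a v z"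
proof -
  have "\<forall>z\<in>W. pdw w u z = pdw w v z" for w
  proof (induction w)
    case (Cons i w)
    then show ?case using pd_cong_open[OF assms(1), of _ "pdw w u" "pdw w v"] by simp
  qed (use assms(3) in simp)
  then show ?thesis using assms(2) by (simp add: diff_op_def mpd_eq_pdw)
qed

lemma axis_Suc_diff: "axis j (Suc k) - axis j (Suc 0) = (axis j k :: nat ^ 'k)"
  by (simp add: vec_eq_iff axis_def)

text \<open>In top degree no coefficient has been differentiated, so the coefficients are those of the polynomial
\<open>\<Prod>\<^sub>i (\<zeta>\<^sub>i + (\<partial>f/\<partial>z\<^sub>i) \<sigma>)\<close> over the letters \<open>i\<close> of the word. The terms of degree \<open>0\<close> and
\<open>1\<close> in \<open>\<zeta>\<close> are needed, here and in \<open>chain_coeff_None_Some\<close>.\<close>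

lemma chain_coeff_None_power: "length w = k \<Longrightarrow> chain_coeff f w (axis None k) z = prod_list (map (($) (grad f z)) w)"
proof (induction w arbitrary: k)
  case Nil
  then show ?case by (simp add: vec_eq_iff axis_def)
next
  case (Cons i w)
  then obtain k' where k: "k = Suc k'" "length w = k'" by auto
  then have "chain_coeff f w (axis None k) = (\<lambda>z. 0)" by (intro chain_coeff_zero) simp
  then show ?case using Cons.IH[OF k(2)] k
    by (simp add: axis_Suc_diff) (simp add: axis_def grad_def)
qed

text \<open>The derivative with respect to \<open>\<zeta>\<^sub>t\<close> of the product of \<open>\<zeta>\<^sub>i\<close> over the letters \<open>i\<close> of the word.\<close>

primrec word_pderiv :: "'n list \<Rightarrow> 'n \<Rightarrow> complex ^ 'n \<Rightarrow> complex" where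
  "word_pderiv [] t \<zeta> = 0"
| "word_pderiv (i # w) t \<zeta> = (if i = t then prod_list (map (($) \<zeta>) w) else 0) + \<zeta> $ i * word_pderiv w t \<zeta>"

lemma cderiv_prod_list: "cderiv (\<lambda>\<zeta>. prod_list (map (($) \<zeta>) w)) \<zeta> (\<chi> t. word_pderiv w t \<zeta>)"
proof (induction w)
  case Nil
  then show ?case using cderiv_const[of 1 \<zeta>] by (simp add: zero_vec_def)
next
  case (Cons i w)
  have "cderiv (\<lambda>\<zeta>. \<zeta> $ i * prod_list (map (($) \<zeta>) w)) \<zeta>
     (\<zeta> $ i *s (\<chi> t. word_pderiv w t \<zeta>) + prod_list (map (($) \<zeta>) w) *s axis i 1)"
    by (intro cderiv_mult cderiv_coord Cons)
  moreover have "\<zeta> $ i *s (\<chi> t. word_pderiv w t \<zeta>) + prod_list (map (($) \<zeta>) w) *s axis i 1 = (\<chi> t. word_pderiv (i # w) t \<zeta>)"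
    by (auto simp: vec_eq_iff axis_def)
  ultimately show ?case by simp
qed

lemma chain_coeff_None_Some:
  "length w = Suc k \<Longrightarrow> chain_coeff f w (axis None k + axis (Some t) 1) z = word_pderiv w t (grad f z)"
proof (induction w arbitrary: k)
  case (Cons i w)
  then have k: "length w = k" by simp
  let ?\<beta> = "axis None k + axis (Some t) 1 :: nat ^ 'a option"
  have 0: "chain_coeff f w ?\<beta> = (\<lambda>z. 0)" by (rule chain_coeff_zero) (use k in simp)
  have 1: "(if 0 < ?\<beta> $ Some i then chain_coeff f w (?\<beta> - axis (Some i) 1) z else 0) = (if i = t then prod_list (map (($) (grad f z)) w) else 0)"
    using chain_coeff_None_power[OF k, of f z] by (auto simp: axis_def)
  have 2: "(if 0 < ?\<beta> $ None then pd i f z * chain_coeff f w (?\<beta> - axis None 1) z else 0) = grad f z $ i * word_pderiv w t (grad f z)"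
  proof (cases k)
    case 0
    then show ?thesis using k by (simp add: axis_def)
  next
    case (Suc k')
    have "?\<beta> - axis None 1 = axis None k' + axis (Some t) 1" by (auto simp: vec_eq_iff axis_def Suc)
    then show ?thesis using Cons.IH[of k'] k Suc by (simp add: axis_def[of None] grad_def)
  qed
  show ?case unfolding chain_coeff.simps 1 2 0 by simp
qed simp

lemma mpower_eq_prod_list: "mpower \<zeta> \<alpha> = prod_list (map (($) \<zeta>) (word \<alpha>))"
  using mpower_wcount[of \<zeta> "word \<alpha>"] by simp

lemma sum_top_degree:
  assumes "\<And>\<alpha>. mdeg \<alpha> < m \<Longrightarrow> T \<alpha> = (0 :: complex)"
  shows "(\<Sum>\<alpha> | mdeg \<alpha> \<le> m. T \<alpha>) = (\<Sum>\<alpha> :: nat ^ 'n | mdeg \<alpha> = m. T \<alpha>)"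
  by (rule sum.mono_neutral_right) (use assms in \<open>auto simp: finite_mdeg_le\<close>)

lemma op_coeff_top: "op_coeff m a f (axis None m) z = principal_symbol m a z (grad f z)"
proof -
  have "op_coeff m a f (axis None m) z = (\<Sum>\<alpha> | mdeg \<alpha> = m. a \<alpha> z * chain_coeff f (word \<alpha>) (axis None m) z)"
    unfolding op_coeff_def by (rule sum_top_degree) (simp add: chain_coeff_zero)
  then show ?thesis unfolding principal_symbol_def by (simp add: chain_coeff_None_power mpower_eq_prod_list)
qed

lemma cderiv_principal_symbol:
  "cderiv (principal_symbol m a z) \<zeta> (\<chi> t. \<Sum>\<alpha> | mdeg \<alpha> = m. a \<alpha> z * word_pderiv (word \<alpha>) t \<zeta>)"
proof -
  have "cderiv (principal_symbol m a z) \<zeta> (\<Sum>\<alpha> | mdeg \<alpha> = m. a \<alpha> z *s (\<chi> t. word_pderiv (word \<alpha>) t \<zeta>) + prod_list (map (($) \<zeta>) (word \<alpha>)) *s 0)"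
    unfolding principal_symbol_def[abs_def] mpower_eq_prod_list
    by (intro cderiv_sum cderiv_mult cderiv_const cderiv_prod_list)
  moreover have "(\<Sum>\<alpha> | mdeg \<alpha> = m. a \<alpha> z *s (\<chi> t. word_pderiv (word \<alpha>) t \<zeta>) + prod_list (map (($) \<zeta>) (word \<alpha>)) *s 0)
    = (\<chi> t. \<Sum>\<alpha> | mdeg \<alpha> = m. a \<alpha> z * word_pderiv (word \<alpha>) t \<zeta>)"
    by (simp add: vec_eq_iff)
  ultimately show ?thesis by simp
qed

lemma op_coeff_subtop:
  "op_coeff (Suc k) a f (axis None k + axis (Some t) 1) z = grad (principal_symbol (Suc k) a z) (grad f z) $ t"
proof -
  have "op_coeff (Suc k) a f (axis None k + axis (Some t) 1) z = (\<Sum>\<alpha> | mdeg \<alpha> = Suc k. a \<alpha> z * chain_coeff f (word \<alpha>) (axis None k + axis (Some t) 1) z)"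
    unfolding op_coeff_def by (rule sum_top_degree) (simp add: chain_coeff_zero)
  then show ?thesis using chain_coeff_None_Some[of _ k f t z]
    by (simp add: grad_eqI[OF cderiv_principal_symbol])
qed


section \<open>Series with a logarithm\<close>

text \<open>\<open>log_series f L c\<close> replaces \<open>s\<^sup>p\<close> in the series \<open>c\<close> by \<open>s\<^sup>p (log s - H\<^sub>p)\<close> at
\<open>s = f(z)\<close>. The harmonic numbers are chosen so that \<open>\<partial>/\<partial>s\<close> maps this to \<open>p s\<^sup>p\<^sup>-\<^sup>1 (log s - H\<^sub>p\<^sub>-\<^sub>1)\<close> for
\<open>p > 0\<close>.\<close>

definition log_coeff :: "(nat ^ ('n::finite) option \<Rightarrow> complex) \<Rightarrow> nat ^ 'n option \<Rightarrow> complex" where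
  "log_coeff c \<gamma> = - harm (\<gamma> $ None) * c \<gamma>"
definition shift_coeff :: "(nat ^ ('n::finite) option \<Rightarrow> complex) \<Rightarrow> nat ^ 'n option \<Rightarrow> complex" where
  "shift_coeff c \<gamma> = c (\<gamma> + axis None 1)"

lemma harm_le_n: "norm (harm n :: complex) \<le> real n"
proof (induction n)
  case (Suc n)
  have "norm (harm (Suc n) :: complex) \<le> norm (harm n :: complex) + norm (inverse (of_nat (Suc n)) :: complex)"
    unfolding harm_Suc by (rule norm_triangle_ineq)
  also have "norm (inverse (of_nat (Suc n)) :: complex) \<le> 1"
    unfolding norm_inverse norm_of_nat by (simp add: field_simps)
  finally show ?case using Suc by simp
qed (simp add: harm_def)

lemma conv_log_coeff: assumes "conv \<rho> c" shows "conv \<rho> (log_coeff c)"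
  unfolding conv_def
proof (intro allI impI)
  fix r :: real assume r: "0 < r \<and> r < \<rho>"
  have "summable (\<lambda>k. diffs (coeff_size c) k * r ^ k)"
    by (rule termdiff_converges[of r \<rho>]) (use r conv_summable[OF assms] in auto)
  then have "summable (\<lambda>k. diffs (coeff_size c) k * r ^ k * r)" by (rule summable_mult2)
  then have "summable (\<lambda>k. coeff_size (log_coeff c) (Suc k) * r ^ Suc k)"
  proof (rule summable_comparison_test')
    fix k
    have "coeff_size (log_coeff c) (Suc k) \<le> real (Suc k) * coeff_size c (Suc k)"
      unfolding coeff_size_def log_coeff_def sum_distrib_left norm_mult
    proof (intro sum_mono mult_right_mono norm_ge_zero)
      fix \<gamma> :: "nat ^ 'a option" assume "\<gamma> \<in> {\<gamma>. mdeg \<gamma> = Suc k}"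
      then show "norm (- harm (\<gamma> $ None) :: complex) \<le> real (Suc k)"
        using harm_le_n[of "\<gamma> $ None"] component_le_mdeg[of \<gamma> None] by simp
    qed
    then have "coeff_size (log_coeff c) (Suc k) * r ^ Suc k \<le> real (Suc k) * coeff_size c (Suc k) * r ^ Suc k"
      using r by (intro mult_right_mono) auto
    then show "norm (coeff_size (log_coeff c) (Suc k) * r ^ Suc k) \<le> diffs (coeff_size c) k * r ^ k * r"
      using r by (simp add: abs_mult diffs_def mult_ac)
  qed
  then show "summable (\<lambda>k. coeff_size (log_coeff c) k * r ^ k)" by (subst (asm) summable_Suc_iff)
qed

lemma conv_shift_coeff: assumes "conv \<rho> c" shows "conv \<rho> (shift_coeff c)"
proof (rule conv_le[OF conv_dcoeff[OF assms, of None]])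
  fix k
  show "coeff_size (shift_coeff c) k \<le> coeff_size (dcoeff None c) k" unfolding coeff_size_def
  proof (rule sum_mono)
    fix \<gamma> :: "nat ^ 'a option"
    have "1 * norm (c (\<gamma> + axis None 1)) \<le> real (\<gamma> $ None + 1) * norm (c (\<gamma> + axis None 1))"
      by (intro mult_right_mono) auto
    then show "norm (shift_coeff c \<gamma>) \<le> norm (dcoeff None c \<gamma>)"
      unfolding shift_coeff_def dcoeff_def norm_mult norm_of_nat by simp
  qed
qed

lemma mpower_zero_None: "y $ None = 0 \<Longrightarrow> 0 < \<gamma> $ None \<Longrightarrow> mpower y \<gamma> = 0"
  unfolding mpower_def by (rule prod_zero) (auto intro!: bexI[of _ None])

lemma series_split_None:
  assumes c: "conv \<rho> c" and y: "graph_pt f z \<in> polydisc \<rho>"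
  shows "series c (graph_pt f z) = series c (graph_pt (\<lambda>_. 0) z) + f z * series (shift_coeff c) (graph_pt f z)"
proof -
  have y0: "graph_pt (\<lambda>_. 0) z \<in> polydisc \<rho>" using y by (auto simp: graph_pt_in_polydisc intro: le_less_trans[OF norm_ge_zero])
  have split: "homog c k (graph_pt f z) = (\<Sum>\<gamma> | mdeg \<gamma> = k \<and> 0 < \<gamma> $ None. c \<gamma> * mpower (graph_pt f z) \<gamma>) + homog c k (graph_pt (\<lambda>_. 0) z)" for k
  proof -
    have "homog c k (graph_pt f z) = (\<Sum>\<gamma> | mdeg \<gamma> = k \<and> 0 < \<gamma> $ None. c \<gamma> * mpower (graph_pt f z) \<gamma>) + (\<Sum>\<gamma> | mdeg \<gamma> = k \<and> \<gamma> $ None = 0. c \<gamma> * mpower (graph_pt f z) \<gamma>)"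
      unfolding homog_def by (subst sum.union_disjoint[symmetric]) (auto intro: finite_subset[OF _ finite_mdeg_eq[of k]] intro!: sum.cong)
    also have "(\<Sum>\<gamma> | mdeg \<gamma> = k \<and> \<gamma> $ None = 0. c \<gamma> * mpower (graph_pt f z) \<gamma>) = (\<Sum>\<gamma> | mdeg \<gamma> = k \<and> \<gamma> $ None = 0. c \<gamma> * mpower (graph_pt (\<lambda>_. 0) z) \<gamma>)"
      by (intro sum.cong refl) (simp add: mpower_def UNIV_option_conv prod.reindex)
    also have "\<dots> = homog c k (graph_pt (\<lambda>_. 0) z)"
      unfolding homog_def by (rule sum.mono_neutral_left) (auto simp: mpower_zero_None)
    finally show ?thesis .
  qed
  have Suc: "homog c (Suc k) (graph_pt f z) = f z * homog (shift_coeff c) k (graph_pt f z) + homog c (Suc k) (graph_pt (\<lambda>_. 0) z)" for k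
    unfolding split[of "Suc k"] sum_shift_axis homog_def[of "shift_coeff c"] sum_distrib_left
    by (simp add: shift_coeff_def mpower_add mult_ac)
  have z: "homog c 0 (graph_pt f z) = homog c 0 (graph_pt (\<lambda>_. 0) z)" by (simp add: homog_def)
  have "(\<lambda>k. homog c (Suc k) (graph_pt f z)) sums (f z * series (shift_coeff c) (graph_pt f z) + (series c (graph_pt (\<lambda>_. 0) z) - homog c 0 (graph_pt (\<lambda>_. 0) z)))"
    unfolding Suc
    by (intro sums_add sums_mult series_sums(1)[OF conv_shift_coeff[OF c] y])
       (use series_sums(1)[OF c y0] sums_Suc_iff[of "\<lambda>k. homog c k (graph_pt (\<lambda>_. 0) z)"] in simp)
  then have "(\<lambda>k. homog c k (graph_pt f z)) sums (f z * series (shift_coeff c) (graph_pt f z) + series c (graph_pt (\<lambda>_. 0) z))"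
    using sums_Suc_iff[of "\<lambda>k. homog c k (graph_pt f z)" "f z * series (shift_coeff c) (graph_pt f z) + (series c (graph_pt (\<lambda>_. 0) z) - homog c 0 (graph_pt (\<lambda>_. 0) z))"] z
    by (simp add: algebra_simps)
  with series_sums(1)[OF c y] show ?thesis using sums_unique2 by (metis add.commute)
qed

lemma series_None_zero: assumes "\<And>\<gamma>. \<gamma> $ None = 0 \<Longrightarrow> c \<gamma> = 0" shows "series c (graph_pt (\<lambda>_. 0) z) = 0"
proof -
  have "homog c k (graph_pt (\<lambda>_. 0) z) = 0" for k
    unfolding homog_def
  proof (rule sum.neutral, rule ballI)
    fix \<gamma> show "c \<gamma> * mpower (graph_pt (\<lambda>_. 0) z) \<gamma> = 0"
      using assms[of \<gamma>] mpower_zero_None[of "graph_pt (\<lambda>_. 0) z" \<gamma>] by (cases "\<gamma> $ None = 0") auto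
  qed
  then show ?thesis by (simp add: series_def)
qed

lemma series_factor_None:
  assumes "conv \<rho> c" "graph_pt f z \<in> polydisc \<rho>" "\<And>\<gamma>. \<gamma> $ None < n \<Longrightarrow> c \<gamma> = 0"
  shows "series c (graph_pt f z) = f z ^ n * series (\<lambda>\<gamma>. c (\<gamma> + axis None n)) (graph_pt f z)"
  using assms
proof (induction n arbitrary: c)
  case 0
  then show ?case by simp
next
  case (Suc n)
  have "series c (graph_pt f z) = f z * series (shift_coeff c) (graph_pt f z)"
    using series_split_None[OF Suc.prems(1,2)] series_None_zero[of c z] Suc.prems(3) by simp
  also have "series (shift_coeff c) (graph_pt f z) = f z ^ n * series (\<lambda>\<gamma>. shift_coeff c (\<gamma> + axis None n)) (graph_pt f z)"
    by (rule Suc.IH[OF conv_shift_coeff[OF Suc.prems(1)] Suc.prems(2)]) (simp add: shift_coeff_def Suc.prems(3) axis_def)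
  also have "(\<lambda>\<gamma>. shift_coeff c (\<gamma> + axis None n)) = (\<lambda>\<gamma>. c (\<gamma> + axis None (Suc n)))"
  proof -
    have "\<gamma> + axis None n + axis None 1 = \<gamma> + (axis None (Suc n) :: nat ^ 'a option)" for \<gamma>
      by (simp add: vec_eq_iff axis_def)
    then show ?thesis by (simp add: shift_coeff_def)
  qed
  finally show ?case by simp
qed

definition log_series :: "(complex ^ 'n \<Rightarrow> complex) \<Rightarrow> (complex ^ 'n \<Rightarrow> complex) \<Rightarrow> (nat ^ 'n option \<Rightarrow> complex) \<Rightarrow> complex ^ 'n \<Rightarrow> complex" where
  "log_series f L c z = series c (graph_pt f z) * L z + series (log_coeff c) (graph_pt f z)"

lemma dcoeff_Some_log_coeff: "dcoeff (Some i) (log_coeff c) = log_coeff (dcoeff (Some i) c)"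
  by (simp add: fun_eq_iff dcoeff_def log_coeff_def axis_def)

lemma axis_same [simp]: "axis i x $ i = x" by (simp add: axis_def)

lemma dcoeff_None_log_coeff: "dcoeff None (log_coeff c) = (\<lambda>\<gamma>. log_coeff (dcoeff None c) \<gamma> + (- 1) * shift_coeff c \<gamma>)"
proof
  fix \<gamma> :: "nat ^ 'a option"
  define N where "N = \<gamma> $ None"
  have ne: "of_nat (Suc N) \<noteq> (0::complex)" by (rule of_nat_neq_0)
  have "of_nat (Suc N) * harm (Suc N) = of_nat (Suc N) * harm N + (1::complex)"
    unfolding harm_Suc distrib_left using right_inverse[OF ne] by simp
  moreover have "dcoeff None (log_coeff c) \<gamma> = - (of_nat (Suc N) * harm (Suc N)) * c (\<gamma> + axis None 1)"
    by (simp add: dcoeff_def log_coeff_def N_def)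
  ultimately show "dcoeff None (log_coeff c) \<gamma> = log_coeff (dcoeff None c) \<gamma> + (- 1) * shift_coeff c \<gamma>"
    by (simp add: dcoeff_def log_coeff_def shift_coeff_def N_def[symmetric] algebra_simps)
qed

text \<open>Differentiation commutes with inserting the logarithm, up to the derivative of \<open>log s\<close> in the part of \<open>c\<close>
that is free of \<open>s\<close>.\<close>

lemma cderiv_log_series:
  fixes f :: "complex ^ 'n \<Rightarrow> complex"
  assumes c: "conv \<rho> c" and z: "graph_pt f z \<in> polydisc \<rho>" and f: "cderiv f z d" "f z \<noteq> 0"
    and L: "cderiv L z ((1 / f z) *s d)"
  shows "cderiv (log_series f L c) z (\<chi> i. log_series f L (dcoeff (Some i) c) z +
     d $ i * (log_series f L (dcoeff None c) z + series c (graph_pt (\<lambda>_. 0) z) / f z))"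
proof -
  have "cderiv (\<lambda>z. series c (graph_pt f z) * L z + series (log_coeff c) (graph_pt f z)) z
    ((series c (graph_pt f z) *s ((1 / f z) *s d) + L z *s (\<chi> i. series (dcoeff (Some i) c) (graph_pt f z) + d $ i * series (dcoeff None c) (graph_pt f z)))
      + (\<chi> i. series (dcoeff (Some i) (log_coeff c)) (graph_pt f z) + d $ i * series (dcoeff None (log_coeff c)) (graph_pt f z)))"
    by (intro cderiv_add cderiv_mult cderiv_series_graph_pt[OF _ z] c conv_log_coeff f L)
  moreover have "((series c (graph_pt f z) *s ((1 / f z) *s d) + L z *s (\<chi> i. series (dcoeff (Some i) c) (graph_pt f z) + d $ i * series (dcoeff None c) (graph_pt f z)))
      + (\<chi> i. series (dcoeff (Some i) (log_coeff c)) (graph_pt f z) + d $ i * series (dcoeff None (log_coeff c)) (graph_pt f z))) =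
    (\<chi> i. log_series f L (dcoeff (Some i) c) z + d $ i * (log_series f L (dcoeff None c) z + series c (graph_pt (\<lambda>_. 0) z) / f z))"
  proof -
    have 1: "series (dcoeff None (log_coeff c)) (graph_pt f z) = series (log_coeff (dcoeff None c)) (graph_pt f z) + (- 1) * series (shift_coeff c) (graph_pt f z)"
      unfolding dcoeff_None_log_coeff
      by (subst series_add[OF conv_log_coeff[OF conv_dcoeff[OF c]] conv_cmult[OF conv_shift_coeff[OF c]] z])
         (simp only: series_cmult[OF conv_shift_coeff[OF c] z])
    have 2: "series c (graph_pt (\<lambda>_. 0) z) / f z = series c (graph_pt f z) / f z - series (shift_coeff c) (graph_pt f z)"
      using series_split_None[OF c z] f(2) by (simp add: field_simps)
    show ?thesis unfolding vec_eq_iff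
      by (simp add: log_series_def dcoeff_Some_log_coeff 1 2 algebra_simps)
  qed
  ultimately show ?thesis unfolding log_series_def[abs_def] by simp
qed

section \<open>Solving the equation in one more variable\<close>

lemma sum_weighted_le:
  assumes "finite X" "0 < x" "summable (\<lambda>k. coeff_size c k * x ^ k)"
  shows "(\<Sum>\<delta>\<in>X. norm (c \<delta>) * x ^ mdeg \<delta>) \<le> (\<Sum>k. coeff_size c k * x ^ k)"
proof -
  define N where "N = (\<Sum>\<delta>\<in>X. mdeg \<delta>)"
  have N: "mdeg ` X \<subseteq> {..N}" using assms(1) unfolding N_def by (auto intro: member_le_sum)
  have "(\<Sum>\<delta>\<in>X. norm (c \<delta>) * x ^ mdeg \<delta>) = (\<Sum>k\<in>{..N}. \<Sum>\<delta> | \<delta> \<in> X \<and> mdeg \<delta> = k. norm (c \<delta>) * x ^ mdeg \<delta>)"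
    by (rule sum.group[OF assms(1) _ N, symmetric]) simp
  also have "\<dots> \<le> (\<Sum>k\<in>{..N}. coeff_size c k * x ^ k)"
  proof (rule sum_mono)
    fix k
    have "(\<Sum>\<delta> | \<delta> \<in> X \<and> mdeg \<delta> = k. norm (c \<delta>) * x ^ mdeg \<delta>) \<le> (\<Sum>\<delta> | mdeg \<delta> = k. norm (c \<delta>) * x ^ mdeg \<delta>)"
      using assms(2) by (intro sum_mono2) auto
    also have "\<dots> = coeff_size c k * x ^ k" by (simp add: coeff_size_def sum_distrib_right)
    finally show "(\<Sum>\<delta> | \<delta> \<in> X \<and> mdeg \<delta> = k. norm (c \<delta>) * x ^ mdeg \<delta>) \<le> coeff_size c k * x ^ k" .
  qed
  also have "\<dots> \<le> (\<Sum>k. coeff_size c k * x ^ k)"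
    using assms by (intro sum_le_suminf) auto
  finally show ?thesis .
qed

definition unit_coeff :: "nat ^ 'k \<Rightarrow> nat ^ 'k \<Rightarrow> complex" where
  "unit_coeff \<delta> \<gamma> = (if \<gamma> = \<delta> then 1 else 0)"

lemma conv_unit_coeff: "conv \<rho> (unit_coeff \<delta>)"
proof -
  have *: "coeff_size (unit_coeff \<delta>) k = 0" if "k \<notin> {mdeg \<delta>}" for k
    unfolding coeff_size_def unit_coeff_def using that by (intro sum.neutral) auto
  show ?thesis unfolding conv_def by (intro allI impI summable_finite[of "{mdeg \<delta>}"]) (simp_all add: *)
qed

lemma mdiff_zero: "\<gamma> - 0 = (\<gamma> :: nat ^ 'k)" by (simp add: vec_eq_iff)

lemma conv_prod_unit_coeff_0 [simp]: "conv_prod (unit_coeff 0) c = c"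
proof
  fix \<gamma>
  have "conv_prod (unit_coeff 0) c \<gamma> = (\<Sum>\<delta> | \<delta> \<le> \<gamma>. if \<delta> = 0 then c \<gamma> else 0)"
    unfolding conv_prod_def unit_coeff_def by (intro sum.cong refl) (simp add: mdiff_zero)
  also have "\<dots> = c \<gamma>"
  proof -
    have "0 \<le> \<gamma>" by (simp add: less_eq_vec_def)
    then show ?thesis by (simp add: sum.delta[OF finite_mle])
  qed
  finally show "conv_prod (unit_coeff 0) c \<gamma> = c \<gamma>" .
qed

lemma homog_unit_coeff_0: "homog (unit_coeff 0) k z = (if k = 0 then 1 else 0)"
proof (cases "k = 0")
  case False
  then show ?thesis unfolding homog_def unit_coeff_def by (auto intro!: sum.neutral)
qed (simp add: homog_def unit_coeff_def)

lemma series_unit_coeff_0 [simp]: "series (unit_coeff 0) z = 1"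
  unfolding series_def homog_unit_coeff_0 using suminf_finite[of "{0}" "\<lambda>k. if k = (0::nat) then 1 else (0::complex)"] by simp

text \<open>The radii in the directions \<open>s\<close>, \<open>z\<^sub>t\<close> and the remaining \<open>z\<^sub>i\<close> will be \<open>\<epsilon>\<^sup>6\<close>, \<open>\<epsilon>\<^sup>5\<close> and
\<open>\<epsilon>\<^sup>4\<close>. By \<open>mi_weight_less\<close>, \<open>r\<^sup>\<beta>\<^sup>0 / r\<^sup>\<beta>\<close> is then at most \<open>\<epsilon>\<close> for every
\<open>\<beta>\<close> of degree at most \<open>k + 1\<close> other than \<open>\<beta>0\<close>, the index of \<open>\<partial>\<^sub>s\<^sup>k \<partial>\<^sub>t\<close>, and the index of
\<open>\<partial>\<^sub>s\<^sup>k\<^sup>+\<^sup>1\<close>. For the latter it is \<open>1/\<epsilon>\<close>, but the coefficient vanishes at \<open>0\<close> and has norm of order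
\<open>\<epsilon>\<^sup>4\<close>.\<close>

definition coord_weight :: "'n \<Rightarrow> 'n option \<Rightarrow> nat" where
  "coord_weight t j = (case j of None \<Rightarrow> 6 | Some i \<Rightarrow> if i = t then 5 else 4)"
definition mi_weight :: "'n \<Rightarrow> nat ^ ('n::finite) option \<Rightarrow> nat" where
  "mi_weight t \<beta> = (\<Sum>j\<in>UNIV. coord_weight t j * \<beta> $ j)"

lemma mi_weight_add: "mi_weight t (\<beta> + \<gamma>) = mi_weight t \<beta> + mi_weight t \<gamma>"
  by (simp add: mi_weight_def sum.distrib algebra_simps)
lemma mi_weight_axis: "mi_weight t (axis j n) = coord_weight t j * n"
  by (simp add: mi_weight_def axis_def if_distrib cong: if_cong)

lemma mi_weight_less:
  fixes \<beta> :: "nat ^ ('n::finite) option"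
  assumes "mdeg \<beta> \<le> Suc k" "\<beta> \<noteq> axis None k + axis (Some t) 1" "\<beta> \<noteq> axis None (Suc k)"
  shows "mi_weight t \<beta> + 1 \<le> mi_weight t (axis None k + axis (Some t) 1)"
proof -
  define N \<tau> \<omega> where "N = \<beta> $ None" and "\<tau> = \<beta> $ Some t" and "\<omega> = (\<Sum>i\<in>UNIV - {t}. \<beta> $ Some i)"
  have deg: "mdeg \<beta> = N + (\<tau> + \<omega>)"
    unfolding mdeg_def sum_option N_def \<tau>_def \<omega>_def by (subst sum.remove[of UNIV t]) auto
  have mi_weight: "mi_weight t \<beta> = 6 * N + (5 * \<tau> + 4 * \<omega>)"
    unfolding mi_weight_def sum_option N_def \<tau>_def \<omega>_def
    by (subst sum.remove[of UNIV t]) (auto simp: coord_weight_def sum_distrib_left intro!: sum.cong)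
  have rest: "\<beta> $ Some i = 0" if "\<omega> = 0" "i \<noteq> t" for i
    using that unfolding \<omega>_def by simp
  have c1: "\<not> (N = Suc k \<and> \<tau> = 0 \<and> \<omega> = 0)"
  proof
    assume *: "N = Suc k \<and> \<tau> = 0 \<and> \<omega> = 0"
    have "\<beta> $ j = axis None (Suc k) $ j" for j
    proof (cases j)
      case (Some i)
      then show ?thesis using * rest[of i] by (cases "i = t") (auto simp: \<tau>_def axis_def)
    qed (use * in \<open>simp add: N_def\<close>)
    then show False using assms(3) by (simp add: vec_eq_iff)
  qed
  have c2: "\<not> (N = k \<and> \<tau> = 1 \<and> \<omega> = 0)"
  proof
    assume *: "N = k \<and> \<tau> = 1 \<and> \<omega> = 0"
    have "\<beta> $ j = (axis None k + axis (Some t) 1) $ j" for j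
    proof (cases j)
      case (Some i)
      then show ?thesis using * rest[of i] by (cases "i = t") (auto simp: \<tau>_def axis_def)
    qed (use * in \<open>simp add: N_def axis_def\<close>)
    then show False using assms(2) by (simp add: vec_eq_iff)
  qed
  have "6 * N + (5 * \<tau> + 4 * \<omega>) + 1 \<le> 6 * k + 5"
    using assms(1) c1 c2 unfolding deg by presburger
  then show ?thesis by (simp add: mi_weight mi_weight_add mi_weight_axis coord_weight_def)
qed

text \<open>The Goursat problem for the operator with leading term \<open>\<partial>\<^sup>\<beta>\<^sup>0\<close>, in terms of \<open>v = \<partial>\<^sup>\<beta>\<^sup>0 h\<close>: for small
\<open>\<epsilon>\<close> the remaining terms have total norm at most \<open>1/2\<close>.\<close>

lemma solve_transport_formal:
  fixes B :: "nat ^ ('n::finite) option \<Rightarrow> nat ^ 'n option \<Rightarrow> complex" and t :: 'n and k :: nat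
  defines "\<beta>0 \<equiv> axis None k + axis (Some t) 1"
  assumes \<rho>: "0 < \<rho>" and B: "\<And>\<beta>. mdeg \<beta> \<le> Suc k \<Longrightarrow> conv \<rho> (B \<beta>)"
    and B0: "B (axis None (Suc k)) 0 = 0" and R: "conv \<rho> R"
  obtains \<rho>' v where "0 < \<rho>'" "conv \<rho>' v"
    "\<And>\<gamma>. v \<gamma> + (\<Sum>\<beta>\<in>{\<beta>. mdeg \<beta> \<le> Suc k} - {\<beta>0}. conv_prod (B \<beta>) (mderiv \<beta> (mintegral \<beta>0 v)) \<gamma>) = R \<gamma>"
proof -
  define S where "S = {\<beta> :: nat ^ 'n option. mdeg \<beta> \<le> Suc k} - {\<beta>0}"
  have finS: "finite S" unfolding S_def by (simp add: finite_mdeg_le)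
  define top :: "nat ^ 'n option" where "top = axis None (Suc k)"
  define x where "x = \<rho> / 2"
  have x: "0 < x" "x < \<rho>" using \<rho> by (auto simp: x_def)
  define C where "C \<beta> = (\<Sum>k. coeff_size (B \<beta>) k * x ^ k)" for \<beta>
  have sB: "summable (\<lambda>k. coeff_size (B \<beta>) k * x ^ k)" if "\<beta> \<in> S" for \<beta>
    using B[of \<beta>] that x by (auto simp: S_def conv_def)
  have C0: "0 \<le> C \<beta>" if "\<beta> \<in> S" for \<beta>
    unfolding C_def using x by (intro suminf_nonneg sB that) auto
  define Ct where "Ct = (\<Sum>\<beta>\<in>S. C \<beta>) * (1 + 1 / x)"
  have Ct: "0 \<le> Ct" unfolding Ct_def using x C0 by (intro mult_nonneg_nonneg sum_nonneg) auto
  define \<epsilon> where "\<epsilon> = min 1 (min x (1 / (2 * (Ct + 1))))"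
  have e: "0 < \<epsilon>" "\<epsilon> \<le> 1" "\<epsilon> \<le> x" "\<epsilon> \<le> 1 / (2 * (Ct + 1))" using x Ct by (auto simp: \<epsilon>_def)
  have eC: "\<epsilon> * Ct \<le> 1 / 2"
  proof -
    have "\<epsilon> * Ct \<le> 1 / (2 * (Ct + 1)) * Ct" using e Ct by (intro mult_right_mono) auto
    also have "\<dots> \<le> 1 / 2" using Ct by (simp add: field_simps)
    finally show ?thesis .
  qed
  define r where "r = (\<lambda>j. \<epsilon> ^ coord_weight t j)"
  have r: "0 < r j" for j using e by (simp add: r_def)
  have gw4: "4 \<le> coord_weight t j" for j by (cases j) (auto simp: coord_weight_def)
  have r4: "r j \<le> \<epsilon> ^ 4" for j unfolding r_def using e gw4 by (intro power_decreasing) auto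
  have e4: "\<epsilon> ^ 4 \<le> x" using power_decreasing[of 1 4 \<epsilon>] e by simp
  have rpw: "rpow r \<beta> = \<epsilon> ^ mi_weight t \<beta>" for \<beta>
    by (simp add: rpow_def r_def mi_weight_def power_sum power_mult)
  have rp4: "rpow r \<delta> \<le> (\<epsilon> ^ 4) ^ mdeg \<delta>" for \<delta>
    unfolding rpow_def mdeg_def power_sum using r4 r
    by (intro prod_mono) (auto simp: less_imp_le intro!: power_mono)
  have rpx: "rpow r \<delta> \<le> x ^ mdeg \<delta>" for \<delta>
    using rp4[of \<delta>] power_mono[OF e4, of "mdeg \<delta>"] e by simp
  \<comment> \<open>bounds for the coefficients on the polyradius \<open>r\<close>; for \<open>top\<close> there is no constant term, and a term of positive degree gains a factor \<open>\<epsilon>\<^sup>4/x\<close> over its bound on the radius \<open>x\<close>\<close>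
  define nb where "nb \<beta> = (if \<beta> = top then C \<beta> * (\<epsilon> ^ 4 / x) else C \<beta>)" for \<beta>
  have nb: "(\<Sum>\<delta>\<in>X. norm (- B \<beta> \<delta>) * rpow r \<delta>) \<le> nb \<beta>" if \<beta>: "\<beta> \<in> S" and X: "finite X" for \<beta> X
  proof (cases "\<beta> = top")
    case False
    have "(\<Sum>\<delta>\<in>X. norm (- B \<beta> \<delta>) * rpow r \<delta>) \<le> (\<Sum>\<delta>\<in>X. norm (B \<beta> \<delta>) * x ^ mdeg \<delta>)"
      using rpx by (intro sum_mono) (simp add: mult_left_mono)
    also have "\<dots> \<le> C \<beta>" unfolding C_def by (rule sum_weighted_le[OF X x(1) sB[OF \<beta>]])
    finally show ?thesis using False by (simp add: nb_def)
  next
    case True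
    have "(\<Sum>\<delta>\<in>X. norm (- B \<beta> \<delta>) * rpow r \<delta>) \<le> (\<Sum>\<delta>\<in>X. norm (B \<beta> \<delta>) * x ^ mdeg \<delta> * (\<epsilon> ^ 4 / x))"
    proof (rule sum_mono)
      fix \<delta>
      show "norm (- B \<beta> \<delta>) * rpow r \<delta> \<le> norm (B \<beta> \<delta>) * x ^ mdeg \<delta> * (\<epsilon> ^ 4 / x)"
      proof (cases "\<delta> = 0")
        case True
        then show ?thesis using B0 \<open>\<beta> = top\<close> by (simp add: top_def)
      next
        case False
        then have d: "1 \<le> mdeg \<delta>" by (simp add: Suc_le_eq zero_less_iff_neq_zero)
        have "(\<epsilon> ^ 4) ^ mdeg \<delta> = x ^ mdeg \<delta> * (\<epsilon> ^ 4 / x) ^ mdeg \<delta>"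
          using x by (simp add: power_divide)
        also have "\<dots> \<le> x ^ mdeg \<delta> * (\<epsilon> ^ 4 / x) ^ 1"
          using x e e4 d by (intro mult_left_mono power_decreasing) auto
        finally have "rpow r \<delta> \<le> x ^ mdeg \<delta> * (\<epsilon> ^ 4 / x)" using rp4[of \<delta>] by simp
        from mult_left_mono[OF this norm_ge_zero[of "B \<beta> \<delta>"]] show ?thesis by (simp add: mult.assoc)
      qed
    qed
    also have "\<dots> = (\<Sum>\<delta>\<in>X. norm (B \<beta> \<delta>) * x ^ mdeg \<delta>) * (\<epsilon> ^ 4 / x)" by (rule sum_distrib_right[symmetric])
    also have "\<dots> \<le> C \<beta> * (\<epsilon> ^ 4 / x)" unfolding C_def using x e
      by (intro mult_right_mono sum_weighted_le[OF X x(1) sB[OF \<beta>]]) auto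
    finally show ?thesis using True by (simp add: nb_def)
  qed
  have trm: "nb \<beta> * (rpow r \<beta>0 / rpow r \<beta>) \<le> \<epsilon> * (C \<beta> * (1 + 1 / x))" if \<beta>: "\<beta> \<in> S" for \<beta>
  proof (cases "\<beta> = top")
    case True
    have "mi_weight t top = Suc (mi_weight t \<beta>0)" by (simp add: top_def \<beta>0_def mi_weight_add mi_weight_axis coord_weight_def)
    then have "nb \<beta> * (rpow r \<beta>0 / rpow r \<beta>) = C \<beta> * (\<epsilon> ^ 3 / x)"
      using True e by (simp add: nb_def rpw field_simps power4_eq_xxxx power3_eq_cube)
    also have "\<dots> \<le> C \<beta> * (\<epsilon> / x)"
      using C0[OF \<beta>] x e power_decreasing[of 1 3 \<epsilon>] by (intro mult_left_mono divide_right_mono) auto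
    also have "\<dots> \<le> \<epsilon> * (C \<beta> * (1 + 1 / x))" using C0[OF \<beta>] e by (simp add: algebra_simps)
    finally show ?thesis .
  next
    case False
    have "mi_weight t \<beta> + 1 \<le> mi_weight t \<beta>0"
      using mi_weight_less[of \<beta> k t] \<beta> False by (simp add: S_def \<beta>0_def top_def)
    then obtain d where d: "mi_weight t \<beta>0 = mi_weight t \<beta> + 1 + d" using le_Suc_ex by blast
    have "nb \<beta> * (rpow r \<beta>0 / rpow r \<beta>) = C \<beta> * (\<epsilon> * \<epsilon> ^ d)"
      using False e by (simp add: nb_def rpw d power_add field_simps)
    also have "\<dots> \<le> C \<beta> * (\<epsilon> * 1)"
      using e C0[OF \<beta>] by (intro mult_left_mono power_le_one) auto
    also have "\<dots> \<le> \<epsilon> * (C \<beta> * (1 + 1 / x))" using C0[OF \<beta>] e x by (simp add: algebra_simps)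
    finally show ?thesis .
  qed
  have q: "(\<Sum>\<beta>\<in>S. nb \<beta> * (rpow r \<beta>0 / rpow r \<beta>)) \<le> 1 / 2"
  proof -
    have "(\<Sum>\<beta>\<in>S. nb \<beta> * (rpow r \<beta>0 / rpow r \<beta>)) \<le> (\<Sum>\<beta>\<in>S. \<epsilon> * (C \<beta> * (1 + 1 / x)))"
      by (rule sum_mono) (rule trm)
    also have "\<dots> = \<epsilon> * Ct" by (simp only: Ct_def sum_distrib_left sum_distrib_right)
    finally show ?thesis using eC by simp
  qed
  define M where "M = (\<Sum>k. coeff_size R k * x ^ k)"
  have M: "norm (R \<gamma>) * mweight \<gamma> * rpow r \<gamma> \<le> M" for \<gamma>
  proof -
    have "mweight \<gamma> \<le> 1" using mweight_add_le[of 0 \<gamma>] by (simp add: mweight_def)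
    then have "norm (R \<gamma>) * mweight \<gamma> * rpow r \<gamma> \<le> norm (R \<gamma>) * 1 * x ^ mdeg \<gamma>"
      using rpx[of \<gamma>] rpow_pos[of r \<gamma>] r by (intro mult_mono mult_nonneg_nonneg) (auto simp: less_imp_le)
    also have "\<dots> \<le> M" unfolding M_def
      using sum_weighted_le[of "{\<gamma>}" x R] x R by (simp add: conv_def)
    finally show ?thesis .
  qed
  have deg: "mdeg \<beta> \<le> mdeg \<beta>0" if "\<beta> \<in> S" for \<beta>
    using that by (simp add: S_def \<beta>0_def)
  have half: "(1/2 :: real) < 1" "0 \<le> (1/2 :: real)" by auto
  obtain v where v: "\<And>\<gamma>. norm (v \<gamma>) * mweight \<gamma> * rpow r \<gamma> \<le> M / (1 - 1 / 2)"
    "\<And>\<gamma>. v \<gamma> = R \<gamma> + (\<Sum>\<beta>\<in>S. conv_prod (\<lambda>\<delta>. - B \<beta> \<delta>) (mderiv \<beta> (mintegral \<beta>0 v)) \<gamma>)"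
    using goursat_formal[of r S \<beta>0 "\<lambda>\<beta> \<delta>. - B \<beta> \<delta>" nb "1/2" R M, OF r deg nb q half M] by blast
  define y where "y = \<epsilon> ^ 6"
  have y: "0 < y" "y \<le> r j" for j
    using e by (auto simp: y_def r_def coord_weight_def intro!: power_decreasing split: option.splits)
  obtain \<rho>' where "0 < \<rho>'" "conv \<rho>' v" using conv_weight_bound[OF v(1) y(2) y(1)] by blast
  moreover have "v \<gamma> + (\<Sum>\<beta>\<in>S. conv_prod (B \<beta>) (mderiv \<beta> (mintegral \<beta>0 v)) \<gamma>) = R \<gamma>" for \<gamma>
    using v(2)[of \<gamma>] by (simp add: conv_prod_def sum_negf)
  ultimately show ?thesis using that unfolding S_def by blast
qed

lemma holo_taylor_family:
  fixes F :: "'b \<Rightarrow> complex ^ 'k \<Rightarrow> complex"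
  assumes "finite S" "open U" "0 \<in> U" "\<And>\<beta>. \<beta> \<in> S \<Longrightarrow> holo_on (F \<beta>) U"
  shows "\<exists>\<rho>>0. polydisc \<rho> \<subseteq> U \<and> (\<forall>\<beta>\<in>S. conv \<rho> (taylor (F \<beta>)) \<and> (\<forall>z\<in>polydisc \<rho>. F \<beta> z = series (taylor (F \<beta>)) z))"
  using assms(1,4)
proof (induction S rule: finite_induct)
  case empty
  obtain \<rho> where "0 < \<rho>" "polydisc \<rho> \<subseteq> U"
    by (rule holo_on_taylor[OF holo_on_const assms(2,3)])
  then show ?case by auto
next
  case (insert b S)
  obtain \<rho> where \<rho>: "0 < \<rho>" "polydisc \<rho> \<subseteq> U" "\<forall>\<beta>\<in>S. conv \<rho> (taylor (F \<beta>)) \<and> (\<forall>z\<in>polydisc \<rho>. F \<beta> z = series (taylor (F \<beta>)) z)"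
    using insert by auto
  obtain \<rho>' where \<rho>': "0 < \<rho>'" "conv \<rho>' (taylor (F b))" "polydisc \<rho>' \<subseteq> U" "\<And>z. z \<in> polydisc \<rho>' \<Longrightarrow> F b z = series (taylor (F b)) z"
    using holo_on_taylor[OF insert.prems[of b] assms(2,3)] by blast
  have "polydisc (min \<rho> \<rho>') \<subseteq> (polydisc \<rho> :: (complex ^ 'k) set)" "polydisc (min \<rho> \<rho>') \<subseteq> (polydisc \<rho>' :: (complex ^ 'k) set)"
    by (rule polydisc_mono, simp)+
  then show ?case using \<rho> \<rho>'
    by (intro exI[of _ "min \<rho> \<rho>'"]) (auto intro: conv_antimono[of \<rho> _ "min \<rho> \<rho>'"] conv_antimono[of \<rho>' _ "min \<rho> \<rho>'"])
qed

lemma holo_on_series_graph_pt: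
  assumes "conv \<rho> c" "holo_on f W" "\<And>z. z \<in> W \<Longrightarrow> graph_pt f z \<in> polydisc \<rho>"
  shows "holo_on (\<lambda>z. series c (graph_pt f z)) W"
  by (rule holo_onI) (use cderiv_series_graph_pt[OF assms(1,3) holo_on_cderiv[OF assms(2)]] in blast)

text \<open>Multiplication by a series without \<open>s\<close> preserves the degree in \<open>s\<close>, hence commutes with inserting harmonic
numbers. So every linear relation between derivatives of \<open>g\<close> with such coefficients persists.\<close>

lemma conv_prod_log_coeff:
  assumes "\<And>\<gamma>. 0 < \<gamma> $ None \<Longrightarrow> a \<gamma> = 0" shows "conv_prod a (log_coeff c) \<gamma> = log_coeff (conv_prod a c) \<gamma>"
proof -
  have "a \<delta> * log_coeff c (\<gamma> - \<delta>) = - harm (\<gamma> $ None) * (a \<delta> * c (\<gamma> - \<delta>))" for \<delta>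
    using assms[of \<delta>] by (cases "\<delta> $ None = 0") (simp_all add: log_coeff_def)
  then show ?thesis unfolding conv_prod_def log_coeff_def[of "\<lambda>\<gamma>. sum _ _"] by (simp only: log_coeff_def conv_prod_def sum_distrib_left)
qed

text \<open>Dividing by \<open>p\<^sub>\<beta>\<^sub>0\<close>, which is nonzero near \<open>0\<close>, and expanding in Taylor series gives coefficients
\<open>B \<beta>\<close> with \<open>B \<beta>0 = 1\<close> and, since \<open>0\<close> is a characteristic point, no constant term in
the coefficient of \<open>\<partial>\<^sub>s\<^sup>k\<^sup>+\<^sup>1\<close>.\<close>

lemma normalised_coefficients:
  fixes f :: "complex ^ 'n \<Rightarrow> complex" and t :: 'n and k :: nat
  defines "\<beta>0 \<equiv> axis None k + axis (Some t) 1"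
  assumes U: "open U" "0 \<in> U" and f: "holo_on f U" and a: "\<And>\<alpha>. mdeg \<alpha> \<le> Suc k \<Longrightarrow> holo_on (a \<alpha>) U"
    and nz: "op_coeff (Suc k) a f \<beta>0 0 \<noteq> 0" and char: "op_coeff (Suc k) a f (axis None (Suc k)) 0 = 0"
  obtains \<rho> B where "0 < \<rho>" "polydisc \<rho> \<subseteq> U" "\<And>z. z \<in> polydisc \<rho> \<Longrightarrow> op_coeff (Suc k) a f \<beta>0 z \<noteq> 0"
    "\<And>\<beta>. mdeg \<beta> \<le> Suc k \<Longrightarrow> conv \<rho> (B \<beta>)" "B \<beta>0 = unit_coeff 0" "B (axis None (Suc k)) 0 = 0"
    "\<And>\<beta> \<gamma>. 0 < \<gamma> $ None \<Longrightarrow> B \<beta> \<gamma> = 0"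
    "\<And>\<beta> g z. mdeg \<beta> \<le> Suc k \<Longrightarrow> z \<in> polydisc \<rho> \<Longrightarrow>
       op_coeff (Suc k) a f \<beta> z = op_coeff (Suc k) a f \<beta>0 z * series (B \<beta>) (graph_pt g z)"
proof -
  let ?p = "op_coeff (Suc k) a f"
  have p: "holo_on (?p \<beta>) U" for \<beta> by (rule op_coeff_holo_on[OF f U(1) a])
  define U1 where "U1 = U \<inter> ?p \<beta>0 -` (- {0})"
  have U1: "open U1" unfolding U1_def
    using continuous_open_preimage[OF holo_on_imp_continuous_on[OF p] U(1), of "- {0}"] by auto
  have U10: "0 \<in> U1" using U nz by (simp add: U1_def)
  define Q where "Q \<beta> z = ?p \<beta> z / ?p \<beta>0 z" for \<beta> z
  have Q: "holo_on (Q \<beta>) U1" for \<beta> unfolding Q_def[abs_def]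
    by (intro holo_on_divide holo_on_subset[OF p]) (auto simp: U1_def)
  obtain \<rho> where \<rho>: "0 < \<rho>" "polydisc \<rho> \<subseteq> U1"
    "\<And>\<beta>. mdeg \<beta> \<le> Suc k \<Longrightarrow> conv \<rho> (taylor (Q \<beta>))"
    "\<And>\<beta> z. mdeg \<beta> \<le> Suc k \<Longrightarrow> z \<in> polydisc \<rho> \<Longrightarrow> Q \<beta> z = series (taylor (Q \<beta>)) z"
    using holo_taylor_family[of "{\<beta>. mdeg \<beta> \<le> Suc k}" U1 Q, OF finite_mdeg_le U1 U10 Q] by blast
  define B where "B \<beta> = (if \<beta> = \<beta>0 then unit_coeff 0 else lift_coeff (taylor (Q \<beta>)))" for \<beta>
  have top: "axis None (Suc k) \<noteq> \<beta>0"
    by (auto simp: \<beta>0_def vec_eq_iff axis_def intro!: exI[of _ None])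
  have 0: "(0 :: complex ^ 'n) \<in> polydisc \<rho>" using \<rho>(1) by (simp add: polydisc_def)
  show ?thesis
  proof (rule that[of \<rho> B])
    show "0 < \<rho>" "polydisc \<rho> \<subseteq> U" using \<rho> by (auto simp: U1_def)
    show nzp: "?p \<beta>0 z \<noteq> 0" if "z \<in> polydisc \<rho>" for z using that \<rho>(2) by (auto simp: U1_def)
    show "conv \<rho> (B \<beta>)" if "mdeg \<beta> \<le> Suc k" for \<beta>
      using \<rho>(3)[OF that] by (simp add: B_def conv_unit_coeff conv_lift_coeff)
    show "B \<beta>0 = unit_coeff 0" by (simp add: B_def)
    have "taylor (Q (axis None (Suc k))) 0 = 0"
      using \<rho>(4)[of "axis None (Suc k)" 0] 0 char by (simp add: Q_def)
    then show "B (axis None (Suc k)) 0 = 0" using top by (simp add: B_def lift_coeff_def zero_vec_def)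
    show "B \<beta> \<gamma> = 0" if "0 < \<gamma> $ None" for \<beta> \<gamma>
      using that by (auto simp: B_def unit_coeff_def lift_coeff_def)
    show "?p \<beta> z = ?p \<beta>0 z * series (B \<beta>) (graph_pt g z)" if "mdeg \<beta> \<le> Suc k" "z \<in> polydisc \<rho>" for \<beta> g z
      using \<rho>(4)[OF that, symmetric] nzp[OF that(2)] by (simp add: B_def series_lift_coeff Q_def)
  qed
qed

lemma series_sum_conv_prod:
  assumes B: "\<And>\<beta>. \<beta> \<in> S \<Longrightarrow> conv \<rho> (B \<beta>)" and c: "\<And>\<beta>. \<beta> \<in> S \<Longrightarrow> conv \<rho> (c \<beta>)" and y: "y \<in> polydisc \<rho>"
    and eq: "\<And>\<gamma>. (\<Sum>\<beta>\<in>S. conv_prod (B \<beta>) (c \<beta>) \<gamma>) = R \<gamma>"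
  shows "(\<Sum>\<beta>\<in>S. series (B \<beta>) y * series (c \<beta>) y) = series R y"
proof -
  have "series R y = series (\<lambda>\<gamma>. \<Sum>\<beta>\<in>S. conv_prod (B \<beta>) (c \<beta>) \<gamma>) y" using eq by simp
  also have "\<dots> = (\<Sum>\<beta>\<in>S. series (conv_prod (B \<beta>) (c \<beta>)) y)"
    by (rule series_sum[OF conv_conv_prod[OF B c] y])
  also have "\<dots> = (\<Sum>\<beta>\<in>S. series (B \<beta>) y * series (c \<beta>) y)"
    by (intro sum.cong refl series_conv_prod[OF B c y])
  finally show ?thesis ..
qed

lemma solve_transport:
  fixes B :: "nat ^ ('n::finite) option \<Rightarrow> nat ^ 'n option \<Rightarrow> complex" and t :: 'n and k :: nat
  defines "\<beta>0 \<equiv> axis None k + axis (Some t) 1"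
  assumes \<rho>: "0 < \<rho>" and B: "\<And>\<beta>. mdeg \<beta> \<le> Suc k \<Longrightarrow> conv \<rho> (B \<beta>)"
    and B1: "B \<beta>0 = unit_coeff 0" and B0: "B (axis None (Suc k)) 0 = 0" and R: "conv \<rho> R"
  obtains \<rho>' h where "0 < \<rho>'" "conv \<rho>' h" "\<And>\<gamma>. \<not> \<beta>0 \<le> \<gamma> \<Longrightarrow> h \<gamma> = 0"
    "\<And>\<gamma>. (\<Sum>\<beta> | mdeg \<beta> \<le> Suc k. conv_prod (B \<beta>) (mderiv \<beta> h) \<gamma>) = R \<gamma>"
proof -
  obtain \<rho>' v where v: "0 < \<rho>'" "conv \<rho>' v"
    "\<And>\<gamma>. v \<gamma> + (\<Sum>\<beta>\<in>{\<beta>. mdeg \<beta> \<le> Suc k} - {\<beta>0}. conv_prod (B \<beta>) (mderiv \<beta> (mintegral \<beta>0 v)) \<gamma>) = R \<gamma>"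
    using solve_transport_formal[of \<rho> k B R t, OF \<rho> B B0 R] unfolding \<beta>0_def by blast
  show ?thesis
  proof (rule that[of \<rho>' "mintegral \<beta>0 v"])
    show "conv \<rho>' (mintegral \<beta>0 v)" by (rule conv_mintegral[OF v(2)])
    show "mintegral \<beta>0 v \<gamma> = 0" if "\<not> \<beta>0 \<le> \<gamma>" for \<gamma> using that by (simp add: mintegral_def)
    have "\<beta>0 \<in> {\<beta>. mdeg \<beta> \<le> Suc k}" by (simp add: \<beta>0_def)
    from sum.remove[OF finite_mdeg_le this, of "\<lambda>\<beta>. conv_prod (B \<beta>) (mderiv \<beta> (mintegral \<beta>0 v)) _"] v(3)
    show "(\<Sum>\<beta> | mdeg \<beta> \<le> Suc k. conv_prod (B \<beta>) (mderiv \<beta> (mintegral \<beta>0 v)) \<gamma>) = R \<gamma>" for \<gamma>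
      by (simp add: B1)
  qed (rule v(1))
qed

text \<open>Any \<open>h\<close> divisible by \<open>s\<^sup>k z\<^sub>t\<close> leaves the term \<open>s\<^sup>k\<close> alone. So \<open>g = s\<^sup>k + h\<close> with
\<open>P' h = - P' s\<^sup>k\<close> is a nonzero solution.\<close>

lemma homogeneous_transport_solution:
  fixes B :: "nat ^ ('n::finite) option \<Rightarrow> nat ^ 'n option \<Rightarrow> complex" and t :: 'n and k :: nat
  defines "\<beta>0 \<equiv> axis None k + axis (Some t) 1"
  assumes \<rho>: "0 < \<rho>" and B: "\<And>\<beta>. mdeg \<beta> \<le> Suc k \<Longrightarrow> conv \<rho> (B \<beta>)"
    and B1: "B \<beta>0 = unit_coeff 0" and B0: "B (axis None (Suc k)) 0 = 0"
  obtains \<rho>' g where "0 < \<rho>'" "conv \<rho>' g" "\<And>\<gamma>. \<gamma> $ None < k \<Longrightarrow> g \<gamma> = 0" "g (axis None k) = 1"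
    "\<And>\<gamma>. (\<Sum>\<beta> | mdeg \<beta> \<le> Suc k. conv_prod (B \<beta>) (mderiv \<beta> g) \<gamma>) = 0"
proof -
  let ?S = "{\<beta> :: nat ^ 'n option. mdeg \<beta> \<le> Suc k}"
  define e where "e = unit_coeff (axis None k :: nat ^ 'n option)"
  define R where "R = (\<lambda>\<gamma>. (-1) * (\<Sum>\<beta>\<in>?S. conv_prod (B \<beta>) (mderiv \<beta> e) \<gamma>))"
  have "conv \<rho> R" unfolding R_def e_def
    by (intro conv_cmult conv_sum conv_conv_prod conv_mderiv conv_unit_coeff B) auto
  then obtain \<rho>' h where h: "0 < \<rho>'" "conv \<rho>' h" "\<And>\<gamma>. \<not> \<beta>0 \<le> \<gamma> \<Longrightarrow> h \<gamma> = 0"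
    "\<And>\<gamma>. (\<Sum>\<beta>\<in>?S. conv_prod (B \<beta>) (mderiv \<beta> h) \<gamma>) = R \<gamma>"
    using solve_transport[of \<rho> k B t R, OF \<rho> B B1[unfolded \<beta>0_def] B0] unfolding \<beta>0_def by blast
  define g where "g = (\<lambda>\<gamma>. e \<gamma> + h \<gamma>)"
  show ?thesis
  proof (rule that[of \<rho>' g])
    show "conv \<rho>' g" unfolding g_def e_def by (intro conv_add conv_unit_coeff h)
    show "g \<gamma> = 0" if "\<gamma> $ None < k" for \<gamma>
    proof -
      have "\<not> \<beta>0 \<le> \<gamma>" using that by (auto simp: \<beta>0_def less_eq_vec_def axis_def not_le intro!: exI[of _ None])
      moreover have "\<gamma> \<noteq> axis None k" using that by auto
      ultimately show ?thesis using h(3) by (simp add: g_def e_def unit_coeff_def)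
    qed
    have "\<not> \<beta>0 \<le> axis None k" by (auto simp: \<beta>0_def less_eq_vec_def axis_def intro!: exI[of _ "Some t"])
    then show "g (axis None k) = 1" using h(3) by (simp add: g_def e_def unit_coeff_def)
    show "(\<Sum>\<beta>\<in>?S. conv_prod (B \<beta>) (mderiv \<beta> g) \<gamma>) = 0" for \<gamma>
    proof -
      have "conv_prod (B \<beta>) (mderiv \<beta> g) \<gamma> = conv_prod (B \<beta>) (mderiv \<beta> e) \<gamma> + conv_prod (B \<beta>) (mderiv \<beta> h) \<gamma>" for \<beta>
        unfolding conv_prod_def sum.distrib[symmetric]
        by (intro sum.cong refl) (simp add: mderiv_def g_def distrib_left)
      then show ?thesis using h(4)[of \<gamma>] by (simp add: sum.distrib R_def)
    qed
  qed (rule h(1))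
qed

section \<open>A logarithm does not extend\<close>

text \<open>Around its simple zero \<open>x'/x\<close> has the integral \<open>2\<pi>\<i>\<close> over a circle, but a function with a primitive has
integral \<open>0\<close>.\<close>

lemma not_log_derivative:
  fixes x y :: "complex \<Rightarrow> complex"
  assumes x: "x holomorphic_on ball 0 d" and d: "0 < d" and x0: "x 0 = 0" "deriv x 0 \<noteq> 0"
    and nz: "\<And>t. t \<in> ball 0 d - {0} \<Longrightarrow> x t \<noteq> 0"
    and y: "\<And>t. t \<in> ball 0 d - {0} \<Longrightarrow> (y has_field_derivative deriv x t / x t) (at t)"
  shows False
proof -
  define x1 where "x1 t = (if t = 0 then deriv x 0 else x t / t)" for t
  have x1: "x1 holomorphic_on ball 0 d"
  proof -
    have "(\<lambda>t. if t = 0 then deriv x 0 else (x t - x 0) / (t - 0)) = x1"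
      by (simp add: fun_eq_iff x1_def x0)
    then show ?thesis using pole_lemma_open[OF x open_ball, of 0] by simp
  qed
  have x1nz: "x1 t \<noteq> 0" if "t \<in> ball 0 d" for t
    using nz[of t] x0 that by (auto simp: x1_def)
  define r where "r = d / 2"
  have r: "0 < r" "r < d" using d by (auto simp: r_def)
  have circ: "path_image (circlepath 0 r) = sphere 0 r" using r by simp
  have sub: "sphere 0 r \<subseteq> ball 0 d - {0}" using r by auto
  have 1: "((\<lambda>t. deriv x t / x t) has_contour_integral 0) (circlepath 0 r)"
  proof (rule Cauchy_theorem_primitive[where f = y and S = "ball 0 d - {0}"])
    show "(y has_field_derivative deriv x t / x t) (at t within ball 0 d - {0})" if "t \<in> ball 0 d - {0}" for t
      using y[OF that] by (rule has_field_derivative_at_within)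
  qed (use circ sub in auto)
  have 2: "((\<lambda>t. deriv x1 t / x1 t) has_contour_integral 0) (circlepath 0 r)"
  proof (rule Cauchy_theorem_convex_simple)
    show "(\<lambda>t. deriv x1 t / x1 t) holomorphic_on ball 0 d"
      by (intro holomorphic_on_divide holomorphic_deriv x1 open_ball x1nz)
  qed (use circ sub in auto)
  have 3: "((\<lambda>t. 1 / (t - 0)) has_contour_integral (2 * of_real pi * \<i> * 1)) (circlepath 0 r)"
    by (rule Cauchy_integral_circlepath_simple) (use r in auto)
  have eq: "deriv x t / x t = 1 / (t - 0) + deriv x1 t / x1 t" if t: "t \<in> ball 0 d - {0}" for t
  proof -
    have "((\<lambda>t. t * x1 t) has_field_derivative (x1 t + t * deriv x1 t)) (at t)"
      using holomorphic_derivI[OF x1 open_ball, of t] t by (auto intro!: derivative_eq_intros)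
    moreover have "\<forall>\<^sub>F t in nhds t. t * x1 t = x t"
      by (simp add: x1_def x0)
    ultimately have "(x has_field_derivative (x1 t + t * deriv x1 t)) (at t)"
      by (subst (asm) DERIV_cong_ev[OF refl _ refl])
    then have "deriv x t = x1 t + t * deriv x1 t" by (rule DERIV_imp_deriv)
    moreover have "x t = t * x1 t" using t by (simp add: x1_def)
    ultimately show ?thesis using x1nz[of t] t by (simp add: field_simps)
  qed
  have "((\<lambda>t. 1 / (t - 0) + deriv x1 t / x1 t) has_contour_integral (2 * of_real pi * \<i> * 1 + 0)) (circlepath 0 r)"
    by (rule has_contour_integral_add[OF 3 2])
  moreover have "((\<lambda>t. 1 / (t - 0) + deriv x1 t / x1 t) has_contour_integral 0) (circlepath 0 r)"
    using has_contour_integral_eq[OF 1, of "\<lambda>t. 1 / (t - 0) + deriv x1 t / x1 t"] eq sub circ by blast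
  ultimately have "2 * of_real pi * \<i> * 1 + 0 = (0::complex)"
    by (rule has_contour_integral_unique)
  then show False by simp
qed

lemma cderiv_log_branch:
  assumes L: "holo_on L W" "open W" "\<And>z. z \<in> W \<Longrightarrow> exp (L z) = f z" and z: "z \<in> W"
  shows "cderiv L z ((1 / f z) *s grad f z)"
proof -
  have "cderiv (\<lambda>z. exp (L z)) z (exp (L z) *s grad L z)"
    by (rule cderiv_chain1[OF holo_on_cderiv[OF L(1) z]]) (auto intro!: derivative_eq_intros)
  then have "cderiv f z (exp (L z) *s grad L z)" by (rule cderiv_cong_open[OF _ L(2) z L(3)])
  then have "grad f z = f z *s grad L z" using L(3)[OF z] by (simp add: grad_eqI)
  moreover have "f z \<noteq> 0" using L(3)[OF z] by auto
  ultimately have "(1 / f z) *s grad f z = grad L z" by (simp add: vec_eq_iff)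
  then show ?thesis using holo_on_cderiv[OF L(1) z] by simp
qed

text \<open>On \<open>W\<close> the function \<open>v = w - H\<close> is \<open>G L\<close> with \<open>\<partial>\<^sub>i L = \<partial>\<^sub>i f / f\<close>. Cleared of denominators
this is a relation \<open>E = 0\<close> between holomorphic functions on the connected set \<open>N\<close>, hence holds near
\<open>0\<close>, even if \<open>W\<close> is far from \<open>0\<close>.\<close>

lemma log_not_extends:
  fixes f G H :: "complex ^ 'n \<Rightarrow> complex"
  assumes V: "open V" and f: "holo_on f V" and G: "holo_on G V" and H: "holo_on H V"
    and f0: "f 0 = 0" "pd i f 0 \<noteq> 0"
    and Gnz: "\<forall>\<^sub>F t in at 0. G (axis i t) \<noteq> 0"
  shows "\<not> extends_holomorphically f S V (\<lambda>_. 0) G H"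
proof
  assume "extends_holomorphically f S V (\<lambda>_. 0) G H"
  then obtain N w W u where N: "open N" "connected N" "0 \<in> N" "N \<subseteq> V" and w: "holo_on w N"
    and W: "W \<noteq> {}" "W \<subseteq> N - S" and u: "local_branch f (\<lambda>_. 0) G H W u" "\<And>z. z \<in> W \<Longrightarrow> w z = u z"
    unfolding extends_holomorphically_def by blast
  obtain L where oW: "open W" and L: "holo_on L W" "\<And>z. z \<in> W \<Longrightarrow> exp (L z) = f z"
    and uL: "\<And>z. z \<in> W \<Longrightarrow> u z = 0 / f z + G z * L z + H z"
    using u(1) unfolding local_branch_def by blast
  define v where "v z = w z - H z" for z
  have v: "holo_on v N" unfolding v_def[abs_def] by (intro holo_on_diff w holo_on_subset[OF H N(4)])
  note fN = holo_on_subset[OF f N(4)] and GN = holo_on_subset[OF G N(4)]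
  define E where "E z = G z * G z * pd i f z - f z * (G z * pd i v z - v z * pd i G z)" for z
  have "holo_on E N" unfolding E_def[abs_def]
    by (intro holo_on_diff holo_on_mult pd_holo_on fN GN v N(1))
  moreover have "E z = 0" if z: "z \<in> W" for z
  proof -
    have zN: "z \<in> N" using z W by auto
    have vW: "v x = G x * L x" if "x \<in> W" for x using u(2)[OF that] uL[OF that] by (simp add: v_def)
    have "cderiv (\<lambda>z. G z * L z) z (G z *s ((1 / f z) *s grad f z) + L z *s grad G z)"
      by (intro cderiv_mult holo_on_cderiv[OF GN zN] cderiv_log_branch[OF L(1) oW L(2) z])
    then have "cderiv v z (G z *s ((1 / f z) *s grad f z) + L z *s grad G z)"
      by (rule cderiv_cong_open[OF _ oW z]) (simp add: vW)
    from pd_eqI[OF this, of i] have "pd i v z = G z * (pd i f z / f z) + L z * pd i G z"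
      by (simp add: grad_def)
    moreover have "f z \<noteq> 0" using L(2)[OF z] by auto
    ultimately show ?thesis by (simp add: E_def vW[OF z] field_simps)
  qed
  ultimately have E: "E z = 0" if "z \<in> N" for z
    using holo_on_identity[OF _ N(1,2) oW W(1) _ _ that] W(2) by blast
  have ax0: "axis i 0 = (0 :: complex ^ 'n)" by (simp add: vec_eq_iff axis_def)
  have "\<forall>\<^sub>F t in at 0. f (0 + axis i t) \<noteq> 0"
    by (rule isolated_zero_of_deriv[OF axis_line_deriv[OF fN]]) (use N f0 in \<open>auto simp: ax0\<close>)
  with Gnz have "\<forall>\<^sub>F t in at 0. G (axis i t) \<noteq> 0 \<and> f (axis i t) \<noteq> 0"
    by (simp add: eventually_conj)
  then obtain d1 where d1: "d1 > 0" "\<And>t. t \<noteq> 0 \<Longrightarrow> norm t < d1 \<Longrightarrow> G (axis i t) \<noteq> 0 \<and> f (axis i t) \<noteq> 0"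
    by (auto simp: eventually_at dist_norm)
  obtain e where e: "e > 0" "ball 0 e \<subseteq> N" using N open_contains_ball by blast
  define d where "d = min d1 e"
  have d: "0 < d" using d1 e by (simp add: d_def)
  have inN: "axis i t \<in> N" if "t \<in> ball 0 d" for t
    using that e by (auto simp: d_def norm_axis_complex subset_iff)
  define x where "x = (\<lambda>t. f (0 + axis i t))"
  define y where "y t = v (0 + axis i t) / G (0 + axis i t)" for t
  have dx: "(x has_field_derivative pd i f (axis i t)) (at t)" if "t \<in> ball 0 d" for t
    using axis_line_deriv[OF fN, of 0 i t] inN[OF that] by (simp add: x_def)
  show False
  proof (rule not_log_derivative[of x d y])
    show "x holomorphic_on ball 0 d"
      unfolding holomorphic_on_def field_differentiable_def using dx has_field_derivative_at_within by blast
    show "x 0 = 0" "deriv x 0 \<noteq> 0"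
      using DERIV_imp_deriv[OF dx[of 0]] d f0 by (auto simp: x_def ax0)
    show "x t \<noteq> 0" if "t \<in> ball 0 d - {0}" for t using that d1 by (simp add: x_def d_def)
    show "(y has_field_derivative deriv x t / x t) (at t)" if t: "t \<in> ball 0 d - {0}" for t
    proof -
      have tN: "axis i t \<in> N" and nz: "G (axis i t) \<noteq> 0" "f (axis i t) \<noteq> 0" using inN t d1 by (auto simp: d_def)
      have "(y has_field_derivative (pd i v (axis i t) * G (axis i t) - v (axis i t) * pd i G (axis i t)) / (G (axis i t) * G (axis i t))) (at t)"
        unfolding y_def[abs_def]
        using DERIV_divide[OF axis_line_deriv[OF v, of 0 i t] axis_line_deriv[OF GN, of 0 i t]] tN nz by simp
      moreover have "(pd i v (axis i t) * G (axis i t) - v (axis i t) * pd i G (axis i t)) / (G (axis i t) * G (axis i t)) = deriv x t / x t"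
        using E[OF tN] nz DERIV_imp_deriv[OF dx[of t]] t unfolding E_def x_def by (simp add: field_simps)
      ultimately show ?thesis by simp
    qed
  qed (use d in auto)
qed

section \<open>Construction of the ramified solution\<close>

text \<open>The function obtained from \<open>\<partial>\<^sup>\<beta> g\<close> by inserting the logarithm. For \<open>\<partial>\<^sup>\<beta> = \<partial>\<^sub>s\<^sup>k\<^sup>+\<^sup>1\<close> it contains
also the term \<open>u(z)/f(z)\<close> that arises in the last differentiation, where \<open>u(z)\<close> is the value at \<open>s = 0\<close> of
\<open>\<partial>\<^sub>s\<^sup>k g\<close>. With this correction the family satisfies the hypothesis of \<open>chain_rule\<close>.\<close>

definition log_family :: "nat \<Rightarrow> (complex ^ 'n \<Rightarrow> complex) \<Rightarrow> (complex ^ 'n \<Rightarrow> complex) \<Rightarrow> (nat ^ ('n::finite) option \<Rightarrow> complex) \<Rightarrow>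
    nat ^ 'n option \<Rightarrow> complex ^ 'n \<Rightarrow> complex" where
  "log_family k f L g \<beta> z = log_series f L (mderiv \<beta> g) z +
     (if \<beta> = axis None (Suc k) then series (mderiv (axis None k) g) (graph_pt (\<lambda>_. 0) z) / f z else 0)"

lemma eq_axis_None: assumes "mdeg \<beta> \<le> k" "\<beta> $ None = k" shows "\<beta> = axis None k"
proof -
  have "(\<Sum>i\<in>UNIV. \<beta> $ Some i) = 0" using assms by (simp add: mdeg_def sum_option)
  then have "\<beta> $ Some i = 0" for i by simp
  then have "\<beta> $ j = axis None k $ j" for j using assms(2) by (cases j) (auto simp: axis_def)
  then show ?thesis by (simp add: vec_eq_iff)
qed

lemma cderiv_log_family:
  fixes f :: "complex ^ 'n \<Rightarrow> complex"
  assumes W: "open W" and f: "holo_on f W" and L: "holo_on L W" "\<And>z. z \<in> W \<Longrightarrow> exp (L z) = f z"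
    and g: "conv \<rho> g" "\<And>\<gamma>. \<gamma> $ None < k \<Longrightarrow> g \<gamma> = 0" and \<rho>: "\<And>z. z \<in> W \<Longrightarrow> graph_pt f z \<in> polydisc \<rho>"
    and \<beta>: "mdeg \<beta> < Suc k" and z: "z \<in> W"
  shows "cderiv (log_family k f L g \<beta>) z
    (\<chi> i. log_family k f L g (\<beta> + axis (Some i) 1) z + pd i f z * log_family k f L g (\<beta> + axis None 1) z)"
proof -
  have fz: "f z \<noteq> 0" using L(2)[OF z] by auto
  have "\<beta> \<noteq> axis None (Suc k)" using \<beta> by auto
  then have K: "log_family k f L g \<beta> = log_series f L (mderiv \<beta> g)" by (simp add: log_family_def fun_eq_iff)
  have S: "log_series f L (dcoeff (Some i) (mderiv \<beta> g)) z = log_family k f L g (\<beta> + axis (Some i) 1) z" for i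
  proof -
    have "(\<beta> + axis (Some i) 1) $ Some i \<noteq> axis None (Suc k) $ Some i" by (simp add: axis_def)
    then have "\<beta> + axis (Some i) 1 \<noteq> axis None (Suc k)" by metis
    then show ?thesis by (simp add: log_family_def mderiv_Suc)
  qed
  have N: "log_series f L (dcoeff None (mderiv \<beta> g)) z + series (mderiv \<beta> g) (graph_pt (\<lambda>_. 0) z) / f z = log_family k f L g (\<beta> + axis None 1) z"
  proof (cases "\<beta> = axis None k")
    case True
    then have "\<beta> + axis None 1 = axis None (Suc k)" by (simp add: vec_eq_iff axis_def)
    then show ?thesis using True by (simp add: log_family_def mderiv_Suc[symmetric])
  next
    case False
    have "\<beta> + axis None 1 \<noteq> axis None (Suc k)"
    proof
      assume eq: "\<beta> + axis None 1 = axis None (Suc k)"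
      have "\<beta> $ j = axis None k $ j" for j
        using arg_cong[OF eq, of "\<lambda>\<beta>. \<beta> $ j"] by (cases j) (auto simp: axis_def)
      then show False using False by (simp add: vec_eq_iff)
    qed
    moreover have "series (mderiv \<beta> g) (graph_pt (\<lambda>_. 0) z) = 0"
    proof (rule series_None_zero)
      fix \<gamma> :: "nat ^ 'n option" assume "\<gamma> $ None = 0"
      moreover have "\<beta> $ None < k"
        using False eq_axis_None[of \<beta> k] \<beta> component_le_mdeg[of \<beta> None] by fastforce
      ultimately have "g (\<gamma> + \<beta>) = 0" by (intro g(2)) simp
      then show "mderiv \<beta> g \<gamma> = 0" by (simp add: mderiv_def)
    qed
    ultimately show ?thesis by (simp add: log_family_def mderiv_Suc)
  qed
  have "cderiv (log_series f L (mderiv \<beta> g)) z (\<chi> i. log_series f L (dcoeff (Some i) (mderiv \<beta> g)) z +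
     grad f z $ i * (log_series f L (dcoeff None (mderiv \<beta> g)) z + series (mderiv \<beta> g) (graph_pt (\<lambda>_. 0) z) / f z))"
    by (rule cderiv_log_series[OF conv_mderiv[OF g(1)] \<rho>[OF z] holo_on_cderiv[OF f z] fz cderiv_log_branch[OF L(1) W L(2) z]])
  then show ?thesis unfolding K S N by (simp add: grad_def)
qed

text \<open>\<open>G = g(f, z)\<close> and \<open>H = (Hg)(f, z) + h(f, z)\<close>, where \<open>P' g = 0\<close> and \<open>h\<close> solves \<open>P' h = - A u / f\<close>.
The last part of the conclusion, which serves to prove that the solution does not extend, holds because
\<open>g = s\<^sup>k (1 + \<dots>)\<close> and \<open>f\<close> has a simple zero at \<open>0\<close> on the line in question.\<close>

lemma ramified_solution_exists:
  fixes f :: "complex ^ 'n \<Rightarrow> complex" and k :: nat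
  assumes U: "open U" "0 \<in> U" and f: "holo_on f U" and a: "\<And>\<alpha>. mdeg \<alpha> \<le> Suc k \<Longrightarrow> holo_on (a \<alpha>) U"
    and f0: "f 0 = 0" "grad f 0 \<noteq> 0"
    and char: "\<And>z. z \<in> U \<Longrightarrow> f z = 0 \<Longrightarrow> principal_symbol (Suc k) a z (grad f z) = 0"
    and simple: "grad (principal_symbol (Suc k) a 0) (grad f 0) \<noteq> 0"
  shows "\<exists>V G H. open V \<and> 0 \<in> V \<and> V \<subseteq> U \<and> ramified_solution (Suc k) a f {z \<in> U. f z = 0} V (\<lambda>_. 0) G H \<and>
    (\<forall>i. pd i f 0 \<noteq> 0 \<longrightarrow> (\<forall>\<^sub>F t in at 0. G (axis i t) \<noteq> 0))"
proof -
  let ?p = "op_coeff (Suc k) a f"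
  let ?S = "{\<beta> :: nat ^ 'n option. mdeg \<beta> \<le> Suc k}"
  obtain t where t: "grad (principal_symbol (Suc k) a 0) (grad f 0) $ t \<noteq> 0" using simple by (auto simp: vec_eq_iff)
  define \<beta>0 where "\<beta>0 = (axis None k + axis (Some t) 1 :: nat ^ 'n option)"
  define top where "top = (axis None (Suc k) :: nat ^ 'n option)"
  have p0: "?p \<beta>0 0 \<noteq> 0" unfolding \<beta>0_def op_coeff_subtop by (rule t)
  have van: "?p top z = 0" if "z \<in> U" "f z = 0" for z unfolding top_def op_coeff_top by (rule char[OF that])
  obtain \<rho> B where \<rho>: "0 < \<rho>" "polydisc \<rho> \<subseteq> U" and nz: "\<And>z. z \<in> polydisc \<rho> \<Longrightarrow> ?p \<beta>0 z \<noteq> 0"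
    and B: "\<And>\<beta>. mdeg \<beta> \<le> Suc k \<Longrightarrow> conv \<rho> (B \<beta>)" "B \<beta>0 = unit_coeff 0" "B top 0 = 0"
    "\<And>\<beta> \<gamma>. 0 < \<gamma> $ None \<Longrightarrow> B \<beta> \<gamma> = 0"
    and pB: "\<And>\<beta> g z. mdeg \<beta> \<le> Suc k \<Longrightarrow> z \<in> polydisc \<rho> \<Longrightarrow> ?p \<beta> z = ?p \<beta>0 z * series (B \<beta>) (graph_pt g z)"
    using normalised_coefficients[of U f k a t, OF U f a p0[unfolded \<beta>0_def] van[OF U(2) f0(1), unfolded top_def]]
    unfolding \<beta>0_def top_def by blast
  obtain \<rho>1 g where g: "0 < \<rho>1" "conv \<rho>1 g" "\<And>\<gamma>. \<gamma> $ None < k \<Longrightarrow> g \<gamma> = 0" "g (axis None k) = 1"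
    "\<And>\<gamma>. (\<Sum>\<beta>\<in>?S. conv_prod (B \<beta>) (mderiv \<beta> g) \<gamma>) = 0"
    using homogeneous_transport_solution[of \<rho> k B t, OF \<rho>(1) B(1) B(2)[unfolded \<beta>0_def] B(3)[unfolded top_def]] by blast
  obtain i0 where i0: "pd i0 f 0 \<noteq> 0" using f0(2) by (auto simp: vec_eq_iff grad_def)
  obtain V1 q where V1: "open V1" "0 \<in> V1" "V1 \<subseteq> U" and q: "holo_on q V1" "\<And>z. z \<in> V1 \<Longrightarrow> ?p top z = f z * q z"
    using holo_divide_by_defining[OF op_coeff_holo_on[OF f U(1) a] f U f0(1) i0 van] by blast
  define u where "u z = series (mderiv (axis None k) g) (graph_pt (\<lambda>_. 0) z)" for z :: "complex ^ 'n"
  define \<rho>2 where "\<rho>2 = min \<rho> \<rho>1"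
  have \<rho>2: "0 < \<rho>2" "\<rho>2 \<le> \<rho>" "\<rho>2 \<le> \<rho>1" using \<rho> g by (auto simp: \<rho>2_def)
  have 0: "(0 :: complex ^ 'n) \<in> polydisc r" if "0 < r" for r using that by (simp add: polydisc_def)
  define V2 where "V2 = V1 \<inter> polydisc \<rho>2"
  have V2: "open V2" "0 \<in> V2" using V1 0[OF \<rho>2(1)] by (auto simp: V2_def open_polydisc)
  have u: "holo_on u V2" unfolding u_def[abs_def]
  proof (rule holo_on_series_graph_pt[OF conv_mderiv[OF g(2)] holo_on_const])
    show "graph_pt (\<lambda>_. 0) z \<in> polydisc \<rho>1" if "z \<in> V2" for z
      using that g(1) polydisc_mono[OF \<rho>2(3)] by (auto simp: graph_pt_in_polydisc V2_def)
  qed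
  \<comment> \<open>\<open>P\<close> applied to the logarithmic part will be \<open>A u / f = q u\<close>; a second series \<open>h\<close> is to cancel it, and the normalised equation has been divided by \<open>p\<^sub>\<beta>\<^sub>0\<close>\<close>
  define R where "R z = - (q z * u z / ?p \<beta>0 z)" for z
  have "holo_on R V2" unfolding R_def[abs_def]
    by (intro holo_on_minus holo_on_divide holo_on_mult u holo_on_subset[OF q(1)] holo_on_subset[OF op_coeff_holo_on[OF f U(1) a]])
       (use V1 nz polydisc_mono[OF \<rho>2(2)] in \<open>auto simp: V2_def\<close>)
  then obtain \<rho>3 where \<rho>3: "0 < \<rho>3" "conv \<rho>3 (taylor R)" "polydisc \<rho>3 \<subseteq> V2" "\<And>z. z \<in> polydisc \<rho>3 \<Longrightarrow> R z = series (taylor R) z"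
    using holo_on_taylor[OF _ V2] by blast
  define \<rho>4 where "\<rho>4 = min \<rho> \<rho>3"
  have \<rho>4: "0 < \<rho>4" "\<rho>4 \<le> \<rho>" "\<rho>4 \<le> \<rho>3" using \<rho> \<rho>3 by (auto simp: \<rho>4_def)
  obtain \<rho>5 h where h: "0 < \<rho>5" "conv \<rho>5 h" "\<And>\<gamma>. (\<Sum>\<beta>\<in>?S. conv_prod (B \<beta>) (mderiv \<beta> h) \<gamma>) = lift_coeff (taylor R) \<gamma>"
    by (rule solve_transport[of \<rho>4 k B t "lift_coeff (taylor R)", OF \<rho>4(1) conv_antimono[OF B(1) \<rho>4(2)] B(2)[unfolded \<beta>0_def] B(3)[unfolded top_def]
       conv_antimono[OF conv_lift_coeff[OF \<rho>3(2)] \<rho>4(3)]]) (assumption, (rule that; assumption))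
  define r where "r = min \<rho>5 (min \<rho>3 (min \<rho>1 \<rho>))"
  have r: "0 < r" "r \<le> \<rho>5" "r \<le> \<rho>3" "r \<le> \<rho>1" "r \<le> \<rho>" using h(1) \<rho>3(1) g(1) \<rho>(1) by (auto simp: r_def)
  define V where "V = (U \<inter> f -` ball 0 r) \<inter> polydisc r"
  have "open (U \<inter> f -` ball 0 r)"
    by (rule continuous_open_preimage[OF holo_on_imp_continuous_on[OF f] U(1) open_ball])
  then have "open V" unfolding V_def by (rule open_Int[OF _ open_polydisc])
  moreover have "0 \<in> V" unfolding V_def by (intro IntI vimageI2 0 r(1) U(2)) (simp add: f0(1) r(1))
  moreover have "V \<subseteq> U" unfolding V_def by blast
  ultimately have V: "open V" "0 \<in> V" "V \<subseteq> U" by this+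
  have VP: "graph_pt f z \<in> polydisc r" "z \<in> polydisc r" if "z \<in> V" for z using that by (auto simp: V_def graph_pt_in_polydisc)
  have fV: "holo_on f V" by (rule holo_on_subset[OF f V(3)])
  have gr: "conv r g" and hr: "conv r h" and Br: "\<And>\<beta>. mdeg \<beta> \<le> Suc k \<Longrightarrow> conv r (B \<beta>)"
    using conv_antimono[OF g(2) r(4)] conv_antimono[OF h(2) r(2)] conv_antimono[OF B(1) r(5)] by auto
  define G where "G z = series g (graph_pt f z)" for z
  define H where "H z = series (log_coeff g) (graph_pt f z) + series h (graph_pt f z)" for z
  have GH: "holo_on G V" "holo_on H V" unfolding G_def[abs_def] H_def[abs_def]
    using holo_on_series_graph_pt[OF gr fV VP(1)]
      holo_on_add[OF holo_on_series_graph_pt[OF conv_log_coeff[OF gr] fV VP(1)] holo_on_series_graph_pt[OF hr fV VP(1)]] by auto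
  have sol: "diff_op (Suc k) a u0 z = 0" if W: "W \<subseteq> V - {z \<in> U. f z = 0}" "local_branch f (\<lambda>_. 0) G H W u0" and z: "z \<in> W" for W u0 z
  proof -
    obtain L where oW: "open W" and L: "holo_on L W" "\<And>z. z \<in> W \<Longrightarrow> exp (L z) = f z"
      and uL: "\<And>z. z \<in> W \<Longrightarrow> u0 z = 0 / f z + G z * L z + H z"
      using W(2) unfolding local_branch_def by blast
    have WV: "W \<subseteq> V" using W(1) by blast
    have fW: "holo_on f W" by (rule holo_on_subset[OF fV WV])
    have WP: "graph_pt f z \<in> polydisc r" if "z \<in> W" for z using VP WV that by auto
    \<comment> \<open>the solution together with all the functions that its derivatives involve; \<open>K 0\<close> is the branch \<open>u0\<close> itself\<close>
    define K where "K \<beta> z = log_family k f L g \<beta> z + series (mderiv \<beta> h) (graph_pt f z)" for \<beta> z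
    have K: "cderiv (K \<beta>) z (\<chi> i. K (\<beta> + axis (Some i) 1) z + pd i f z * K (\<beta> + axis None 1) z)"
      if "mdeg \<beta> < Suc k" "z \<in> W" for \<beta> z
    proof -
      have "cderiv (\<lambda>z. log_family k f L g \<beta> z + series (mderiv \<beta> h) (graph_pt f z)) z
        ((\<chi> i. log_family k f L g (\<beta> + axis (Some i) 1) z + pd i f z * log_family k f L g (\<beta> + axis None 1) z) +
         (\<chi> i. series (dcoeff (Some i) (mderiv \<beta> h)) (graph_pt f z) + grad f z $ i * series (dcoeff None (mderiv \<beta> h)) (graph_pt f z)))"
        by (intro cderiv_add cderiv_log_family[OF oW fW L gr g(3) WP that] cderiv_series_graph_pt[OF conv_mderiv[OF hr] WP[OF that(2)] holo_on_cderiv[OF fW that(2)]])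
      moreover have "((\<chi> i. log_family k f L g (\<beta> + axis (Some i) 1) z + pd i f z * log_family k f L g (\<beta> + axis None 1) z) +
         (\<chi> i. series (dcoeff (Some i) (mderiv \<beta> h)) (graph_pt f z) + grad f z $ i * series (dcoeff None (mderiv \<beta> h)) (graph_pt f z)))
         = (\<chi> i. K (\<beta> + axis (Some i) 1) z + pd i f z * K (\<beta> + axis None 1) z)"
        by (simp add: vec_eq_iff K_def mderiv_Suc grad_def algebra_simps)
      ultimately show ?thesis unfolding K_def[abs_def] by simp
    qed
    have "(0 :: nat ^ 'n option) \<noteq> axis None (Suc k)" by (auto simp: vec_eq_iff axis_def intro!: exI[of _ None])
    then have u0: "u0 z = K 0 z" if "z \<in> W" for z
      using uL[OF that] by (simp add: K_def log_family_def log_series_def G_def H_def)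
    have zr: "z \<in> polydisc \<rho>" and z3: "z \<in> polydisc \<rho>3"
      using subsetD[OF polydisc_mono[OF r(5)] VP(2)] subsetD[OF polydisc_mono[OF r(3)] VP(2)] subsetD[OF WV z] by auto
    \<comment> \<open>from relations between coefficients back to the functions on the graph of \<open>f\<close>\<close>
    have fl: "(\<Sum>\<beta>\<in>?S. ?p \<beta> z * series (c \<beta>) (graph_pt f z)) = ?p \<beta>0 z * series T (graph_pt f z)"
      if "\<And>\<beta>. \<beta> \<in> ?S \<Longrightarrow> conv r (c \<beta>)" "\<And>\<gamma>. (\<Sum>\<beta>\<in>?S. conv_prod (B \<beta>) (c \<beta>) \<gamma>) = T \<gamma>" for c T
    proof -
      have "(\<Sum>\<beta>\<in>?S. ?p \<beta> z * series (c \<beta>) (graph_pt f z)) = (\<Sum>\<beta>\<in>?S. ?p \<beta>0 z * (series (B \<beta>) (graph_pt f z) * series (c \<beta>) (graph_pt f z)))"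
        by (intro sum.cong refl) (use pB[OF _ zr, of _ f] in simp)
      also have "\<dots> = ?p \<beta>0 z * series T (graph_pt f z)"
        unfolding sum_distrib_left[symmetric]
        by (subst series_sum_conv_prod[of ?S r B c "graph_pt f z" T, OF _ that(1) WP[OF z] that(2)]) (use Br in auto)
      finally show ?thesis .
    qed
    have 1: "(\<Sum>\<beta>\<in>?S. ?p \<beta> z * series (mderiv \<beta> g) (graph_pt f z)) = 0"
      using fl[of "\<lambda>\<beta>. mderiv \<beta> g" "\<lambda>\<gamma>. 0", OF conv_mderiv[OF gr] g(5)] by (simp add: series_zero)
    have "(\<Sum>\<beta>\<in>?S. conv_prod (B \<beta>) (log_coeff (mderiv \<beta> g)) \<gamma>) = 0" for \<gamma>
    proof -
      have "(\<Sum>\<beta>\<in>?S. conv_prod (B \<beta>) (log_coeff (mderiv \<beta> g)) \<gamma>) = (\<Sum>\<beta>\<in>?S. - harm (\<gamma> $ None) * conv_prod (B \<beta>) (mderiv \<beta> g) \<gamma>)"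
        by (intro sum.cong refl) (simp add: conv_prod_log_coeff[OF B(4)] log_coeff_def[of "conv_prod _ _"])
      also have "\<dots> = - harm (\<gamma> $ None) * (\<Sum>\<beta>\<in>?S. conv_prod (B \<beta>) (mderiv \<beta> g) \<gamma>)"
        by (rule sum_distrib_left[symmetric])
      finally show ?thesis using g(5)[of \<gamma>] by simp
    qed
    then have 2: "(\<Sum>\<beta>\<in>?S. ?p \<beta> z * series (log_coeff (mderiv \<beta> g)) (graph_pt f z)) = 0"
      using fl[of "\<lambda>\<beta>. log_coeff (mderiv \<beta> g)" "\<lambda>\<gamma>. 0", OF conv_log_coeff[OF conv_mderiv[OF gr]]] by (simp add: series_zero)
    have 3: "(\<Sum>\<beta>\<in>?S. ?p \<beta> z * series (mderiv \<beta> h) (graph_pt f z)) = ?p \<beta>0 z * R z"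
      using fl[of "\<lambda>\<beta>. mderiv \<beta> h" "lift_coeff (taylor R)", OF conv_mderiv[OF hr] h(3)] \<rho>3(4)[OF z3] by (simp add: series_lift_coeff)
    have fz: "f z \<noteq> 0" using L(2)[OF z] by auto
    have "z \<in> V1" using z3 \<rho>3(3) by (auto simp: V2_def)
    then have 4: "?p top z * (u z / f z) = q z * u z" using q(2) fz by simp
    have 5: "?p \<beta>0 z * R z = - (q z * u z)" using nz[OF zr] by (simp add: R_def)
    have topS: "top \<in> ?S" by (simp add: top_def)
    have fin: "finite ?S" by (rule finite_mdeg_le)
    have "diff_op (Suc k) a u0 z = diff_op (Suc k) a (K 0) z"
      by (rule diff_op_cong_open[OF oW z u0])
    also have "\<dots> = (\<Sum>\<beta>\<in>?S. ?p \<beta> z * K \<beta> z)" by (rule diff_op_chain[OF fW oW K z])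
    also have "\<dots> = (\<Sum>\<beta>\<in>?S. ?p \<beta> z * series (mderiv \<beta> g) (graph_pt f z) * L z + ?p \<beta> z * series (log_coeff (mderiv \<beta> g)) (graph_pt f z)
        + (if \<beta> = top then ?p top z * (u z / f z) else 0) + ?p \<beta> z * series (mderiv \<beta> h) (graph_pt f z))"
      by (intro sum.cong refl) (auto simp: K_def log_family_def log_series_def u_def top_def algebra_simps)
    also have "\<dots> = (\<Sum>\<beta>\<in>?S. ?p \<beta> z * series (mderiv \<beta> g) (graph_pt f z)) * L z + (\<Sum>\<beta>\<in>?S. ?p \<beta> z * series (log_coeff (mderiv \<beta> g)) (graph_pt f z))
        + ?p top z * (u z / f z) + (\<Sum>\<beta>\<in>?S. ?p \<beta> z * series (mderiv \<beta> h) (graph_pt f z))"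
      unfolding sum.distrib sum_distrib_right[symmetric] using topS by (simp add: sum.delta[OF fin])
    also have "\<dots> = 0" unfolding 1 2 3 4 5 by simp
    finally show ?thesis .
  qed
  have ram: "ramified_solution (Suc k) a f {z \<in> U. f z = 0} V (\<lambda>_. 0) G H"
    unfolding ramified_solution_def using GH sol by (auto simp: holo_on_const)
  have "\<forall>\<^sub>F t in at 0. G (axis i t) \<noteq> 0" if i: "pd i f 0 \<noteq> 0" for i
  proof -
    have ax0: "axis i 0 = (0 :: complex ^ 'n)" by (simp add: vec_eq_iff axis_def)
    \<comment> \<open>\<open>G = f\<^sup>k c(f, z)\<close>, and \<open>c\<close> has constant term \<open>1\<close>\<close>
    define c where "c = (\<lambda>\<gamma>. g (\<gamma> + axis None k))"
    have "conv r c"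
    proof (rule conv_le[OF conv_mderiv[OF gr, of "axis None k"]])
      fix j show "coeff_size c j \<le> coeff_size (mderiv (axis None k) g) j" unfolding coeff_size_def
      proof (rule sum_mono)
        fix \<gamma> :: "nat ^ 'n option"
        have "1 \<le> real (mfact (\<gamma> + axis None k)) / real (mfact \<gamma>)"
          using mfact_add_le[of \<gamma> "axis None k"] by simp
        from mult_right_mono[OF this norm_ge_zero[of "c \<gamma>"]]
        show "norm (c \<gamma>) \<le> norm (mderiv (axis None k) g \<gamma>)" by (simp add: mderiv_def c_def norm_mult norm_divide)
      qed
    qed
    then have "holo_on (\<lambda>z. series c (graph_pt f z)) V" by (rule holo_on_series_graph_pt[OF _ fV VP(1)])
    then have "isCont (\<lambda>t. series c (graph_pt f (0 + axis i t))) 0"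
      using axis_line_deriv[of "\<lambda>z. series c (graph_pt f z)" V 0 i 0] V(2) ax0 by (auto intro: DERIV_isCont)
    moreover have "graph_pt f 0 = 0" by (simp add: vec_eq_iff split_option_all f0)
    ultimately have "((\<lambda>t. series c (graph_pt f (axis i t))) \<longlongrightarrow> 1) (at 0)"
      using g(4) by (simp add: isCont_def ax0 c_def)
    then have "\<forall>\<^sub>F t in at 0. series c (graph_pt f (axis i t)) \<noteq> 0" by (rule tendsto_imp_eventually_ne) simp
    moreover have "\<forall>\<^sub>F t in at 0. f (0 + axis i t) \<noteq> 0"
      by (rule isolated_zero_of_deriv[OF axis_line_deriv[OF f]]) (use U f0 i in \<open>auto simp: ax0\<close>)
    moreover have "\<forall>\<^sub>F t in at 0. axis i t \<in> V"
    proof -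
      have "isCont (axis i :: complex \<Rightarrow> complex ^ 'n) 0" by (intro linear_continuous_at bounded_linear_axis)
      then show ?thesis using V(1,2) by (auto simp: isCont_def ax0 intro: topological_tendstoD)
    qed
    ultimately show ?thesis
    proof eventually_elim
      case (elim t)
      have "G (axis i t) = f (axis i t) ^ k * series c (graph_pt f (axis i t))"
        unfolding G_def c_def by (rule series_factor_None[OF gr VP(1)[OF elim(3)] g(3)])
      then show ?case using elim by simp
    qed
  qed
  with V ram show ?thesis by blast
qed

text \<open>The order \<open>m\<close> is positive, since a symbol of order \<open>0\<close> does not depend on \<open>\<zeta>\<close>, so that
\<open>ramified_solution_exists\<close> applies with \<open>m = k + 1\<close>. Its solution answers both parts of the claim.\<close>

theorem proposition1p2:
  fixes m :: nat
    and a :: "nat ^ 'n \<Rightarrow> complex ^ 'n \<Rightarrow> complex"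
    and f :: "complex ^ 'n \<Rightarrow> complex"
    and U S :: "(complex ^ 'n) set"
  assumes "open U" and "0 \<in> U"
    and "\<And>\<alpha>. mdeg \<alpha> \<le> m \<Longrightarrow> holo_on (a \<alpha>) U"
    and "defining_function f S U" and "0 \<in> S"
    and "simply_characteristic m a f S"
  shows "(\<exists>V F G H. open V \<and> 0 \<in> V \<and> V \<subseteq> U \<and> ramified_solution m a f S V F G H) \<and>
         (\<exists>V F G H. open V \<and> 0 \<in> V \<and> V \<subseteq> U \<and> ramified_solution m a f S V F G H \<and>
            \<not> (\<forall>\<^sub>F z in nhds 0. F z = 0 \<and> G z = 0) \<and>
            \<not> extends_holomorphically f S V F G H)"
proof -
  have f: "holo_on f U" and S: "S = {z \<in> U. f z = 0}" and f0: "f 0 = 0" "grad f 0 \<noteq> 0"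
    using assms(4,5) unfolding defining_function_def by auto
  have char: "principal_symbol m a z (grad f z) = 0" if "z \<in> U" "f z = 0" for z
    using assms(6) that S unfolding simply_characteristic_def by auto
  have simple: "grad (principal_symbol m a 0) (grad f 0) \<noteq> 0"
    using assms(5,6) unfolding simply_characteristic_def by auto
  have "m \<noteq> 0"
  proof
    assume "m = 0"
    then have "word \<alpha> = []" if "mdeg \<alpha> = m" for \<alpha> :: "nat ^ 'n"
      using that length_word[of \<alpha>] by (simp del: length_word)
    then have "grad (principal_symbol m a 0) (grad f 0) = 0"
      by (simp add: grad_eqI[OF cderiv_principal_symbol] vec_eq_iff)
    then show False using simple by simp
  qed
  then obtain k where m: "m = Suc k" by (cases m) auto
  obtain V G H where V: "open V" "0 \<in> V" "V \<subseteq> U" and ram: "ramified_solution m a f S V (\<lambda>_. 0) G H"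
    and G: "\<And>i. pd i f 0 \<noteq> 0 \<Longrightarrow> \<forall>\<^sub>F t in at 0. G (axis i t) \<noteq> 0"
    using ramified_solution_exists[of U f k a, OF assms(1,2) f assms(3)[unfolded m] f0 char[unfolded m] simple[unfolded m]]
    unfolding m S by blast
  obtain i where i: "pd i f 0 \<noteq> 0" using f0(2) by (auto simp: vec_eq_iff grad_def)
  have "\<not> (\<forall>\<^sub>F z in nhds 0. (0 :: complex) = 0 \<and> G z = 0)"
  proof
    assume "\<forall>\<^sub>F z in nhds 0. (0 :: complex) = 0 \<and> G z = 0"
    then obtain T where T: "open T" "0 \<in> T" "\<And>z. z \<in> T \<Longrightarrow> G z = 0" by (auto simp: eventually_nhds)
    have "isCont (axis i :: complex \<Rightarrow> complex ^ 'n) 0" by (intro linear_continuous_at bounded_linear_axis)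
    moreover have "axis i 0 = (0 :: complex ^ 'n)" by (simp add: vec_eq_iff axis_def)
    ultimately have "\<forall>\<^sub>F t in at 0. axis i t \<in> T"
      using T(1,2) by (auto simp: isCont_def intro: topological_tendstoD)
    with G[OF i] have "\<forall>\<^sub>F t in at (0::complex). False"
      by eventually_elim (use T(3) in auto)
    then show False by simp
  qed
  moreover have "\<not> extends_holomorphically f S V (\<lambda>_. 0) G H"
    by (rule log_not_extends[OF V(1) holo_on_subset[OF f V(3)] _ _ f0(1) i G[OF i]])
       (use ram in \<open>auto simp: ramified_solution_def\<close>)
  ultimately show ?thesis using V ram by blast
qed

end
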